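(* Let $d\geq 3$ be a fixed integer, and let $Y_{\mathcal{G}}$ denote the number of spanning trees of a uniformly random $d$-regular simple graph on the vertex set $\{1,\ldots,n\}$. Then, as $n\to\infty$ (restricted to even $n$ when $d$ is odd), \[ \mathbb{E} Y_{\mathcal{G}} \sim \exp\left(\frac{6d^{2}-14d+7}{4\left(d-1\right)^{2}}\right)\, \frac{\left(d-1\right)^{1/2}}{n\left(d-2\right)^{3/2}}\, \left(\frac{\left(d-1\right)^{d-1}}{\left(d^{2}-2d\right)^{d/2-1}} \right)^{n}. \]
   Context: The random graph is drawn uniformly from the set of all $d$-regular simple graphs (no loops, no multiple edges) on vertex set $\{1,\ldots,n\}$. *)

theory Defs
  imports "HOL-Probability.Probability" "HOL-Library.Landau_Symbols"
begin

text \<open>A simple graph on the vertex set \<open>V\<close> is given by its edge set, a set of two-element subsets of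
  \<open>V\<close>; this excludes loops and multiple edges.\<close>

definition simple_graphs :: "'a set \<Rightarrow> 'a set set set" where
  "simple_graphs V = {E. E \<subseteq> {e. e \<subseteq> V \<and> card e = 2}}"

definition graph_degree :: "'a set set \<Rightarrow> 'a \<Rightarrow> nat" where
  "graph_degree E v = card {e \<in> E. v \<in> e}"

definition regular_graphs :: "nat \<Rightarrow> 'a set \<Rightarrow> 'a set set set" where
  "regular_graphs d V = {E \<in> simple_graphs V. \<forall>v\<in>V. graph_degree E v = d}"

definition graph_connected :: "'a set \<Rightarrow> 'a set set \<Rightarrow> bool" where
  "graph_connected V E \<longleftrightarrow> V \<noteq> {} \<and> (\<forall>u\<in>V. \<forall>v\<in>V. (u, v) \<in> {(x, y). {x, y} \<in> E}\<^sup>*)"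

text \<open>A cycle is listed by its successive distinct vertices; the \<open>mod\<close> closes it up.\<close>

definition graph_cycle :: "'a set set \<Rightarrow> 'a list \<Rightarrow> bool" where
  "graph_cycle E vs \<longleftrightarrow> length vs \<ge> 3 \<and> distinct vs \<and>
     (\<forall>i<length vs. {vs ! i, vs ! (Suc i mod length vs)} \<in> E)"

definition graph_tree :: "'a set \<Rightarrow> 'a set set \<Rightarrow> bool" where
  "graph_tree V E \<longleftrightarrow> E \<in> simple_graphs V \<and> graph_connected V E \<and> (\<nexists>vs. graph_cycle E vs)"

text \<open>A spanning subgraph has all of \<open>V\<close> as its vertices, so it is determined by its edge set.\<close>

definition spanning_trees :: "'a set \<Rightarrow> 'a set set \<Rightarrow> 'a set set set" where
  "spanning_trees V E = {T. T \<subseteq> E \<and> graph_tree V T}"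

text \<open>The value is meaningful only if \<open>d\<close>-regular graphs on \<open>{1..n}\<close> exist, since \<open>pmf_of_set {}\<close> is
  unspecified.\<close>

definition random_regular_graph :: "nat \<Rightarrow> nat \<Rightarrow> nat set set pmf" where
  "random_regular_graph d n = pmf_of_set (regular_graphs d {1..n})"

definition expected_spanning_trees :: "nat \<Rightarrow> nat \<Rightarrow> real" where
  "expected_spanning_trees d n =
     measure_pmf.expectation (random_regular_graph d n) (\<lambda>E. real (card (spanning_trees {1..n} E)))"

end

theory Submission
  imports Defs "HOL-Library.Ramsey" "HOL-Real_Asymp.Real_Asymp"
begin

text \<open>
  Summing over the trees \<open>T\<close> instead of the regular graphs, the expectation becomes the number of pairs
  of a tree \<open>T\<close> and a simple graph that avoids \<open>T\<close> and has the degrees \<open>r v = d - deg T v\<close>, divided by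
  the number of regular graphs.

  Both are counted in the configuration model, where half-edges are paired at random. A pairing fails
  to give a simple graph that avoids a graph \<open>X\<close> if it has a defect: a loop, a double edge or an edge
  of \<open>X\<close>. The generating function \<open>f t = E ((1 - t) ^ defects)\<close> satisfies \<open>f' t \<approx> - \<mu> * f t\<close>, where \<open>\<mu>\<close>
  is the mean number of defects: the derivative is a sum over the possible defects, and removing one of
  them leaves a smaller configuration model. By induction on the number of half-edges,
  \<open>f 1 \<approx> exp (- \<mu>)\<close> with a uniform error.

  The number of trees with given degrees is a multinomial coefficient, so the degrees \<open>r\<close> of the
  complement of a tree are distributed like the numbers of elements which a random set of
  \<open>(d - 2) * n + 2\<close> out of \<open>n * (d - 1)\<close> points has in each of \<open>n\<close> blocks. Second moments show that \<open>\<mu>\<close> is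
  concentrated under this distribution. The exponential factor of the theorem is the quotient of the two
  Poisson probabilities, and the remaining factor comes from Stirling's formula.
\<close>

section \<open>Weighted means\<close>

definition weighted_mean :: "'b set \<Rightarrow> ('b \<Rightarrow> real) \<Rightarrow> ('b \<Rightarrow> real) \<Rightarrow> real" where
  "weighted_mean A w f = (\<Sum>x\<in>A. w x * f x) / sum w A"

lemma weighted_mean_const: "sum w A \<noteq> 0 \<Longrightarrow> weighted_mean A w (\<lambda>_. c) = c"
  by (simp add: weighted_mean_def flip: sum_distrib_right)

lemma weighted_mean_add:
  "weighted_mean A w (\<lambda>x. f x + g x) = weighted_mean A w f + weighted_mean A w g"
  by (simp add: weighted_mean_def distrib_left sum.distrib add_divide_distrib)

lemma weighted_mean_diff:
  "weighted_mean A w (\<lambda>x. f x - g x) = weighted_mean A w f - weighted_mean A w g"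
  by (simp add: weighted_mean_def right_diff_distrib sum_subtractf diff_divide_distrib)

lemma weighted_mean_cmult: "weighted_mean A w (\<lambda>x. c * f x) = c * weighted_mean A w f"
  by (simp add: weighted_mean_def sum_distrib_left mult.left_commute)

lemma weighted_mean_sum:
  "weighted_mean A w (\<lambda>x. \<Sum>i\<in>I. f i x) = (\<Sum>i\<in>I. weighted_mean A w (f i))"
  unfolding weighted_mean_def sum_distrib_left sum_divide_distrib by (rule sum.swap)

lemma weighted_mean_cong:
  "(\<And>x. x \<in> A \<Longrightarrow> f x = g x) \<Longrightarrow> weighted_mean A w f = weighted_mean A w g"
  by (simp add: weighted_mean_def)

lemma weighted_mean_mono:
  assumes "\<And>x. x \<in> A \<Longrightarrow> 0 \<le> w x" "\<And>x. x \<in> A \<Longrightarrow> f x \<le> g x"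
  shows "weighted_mean A w f \<le> weighted_mean A w g"
  unfolding weighted_mean_def
  by (intro divide_right_mono sum_mono mult_left_mono sum_nonneg) (use assms in auto)

lemma weighted_mean_nonneg:
  assumes "\<And>x. x \<in> A \<Longrightarrow> 0 \<le> w x" "\<And>x. x \<in> A \<Longrightarrow> 0 \<le> f x"
  shows "0 \<le> weighted_mean A w f"
  unfolding weighted_mean_def
  by (intro divide_nonneg_nonneg sum_nonneg mult_nonneg_nonneg) (use assms in auto)

lemma abs_weighted_mean_le:
  assumes "\<And>x. x \<in> A \<Longrightarrow> 0 \<le> w x"
  shows "\<bar>weighted_mean A w f\<bar> \<le> weighted_mean A w (\<lambda>x. \<bar>f x\<bar>)"
proof -
  have "weighted_mean A w f \<le> weighted_mean A w (\<lambda>x. \<bar>f x\<bar>)"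
    "weighted_mean A w (\<lambda>x. - \<bar>f x\<bar>) \<le> weighted_mean A w f"
    using assms by (auto intro!: weighted_mean_mono)
  moreover have "weighted_mean A w (\<lambda>x. - \<bar>f x\<bar>) = - weighted_mean A w (\<lambda>x. \<bar>f x\<bar>)"
    using weighted_mean_cmult[of A w "- 1" "\<lambda>x. \<bar>f x\<bar>"] by simp
  ultimately show ?thesis by linarith
qed

lemma weighted_mean_square_dist:
  assumes "sum w A \<noteq> 0"
  shows "weighted_mean A w (\<lambda>x. (f x - c)\<^sup>2) =
    weighted_mean A w (\<lambda>x. (f x)\<^sup>2) - 2 * c * weighted_mean A w f + c\<^sup>2"
proof -
  have "weighted_mean A w (\<lambda>x. (f x - c)\<^sup>2) = weighted_mean A w (\<lambda>x. (f x)\<^sup>2 - (2 * c) * f x + c\<^sup>2)"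
    by (simp add: power2_diff mult_ac add.commute add_diff_eq)
  then show ?thesis
    unfolding weighted_mean_add weighted_mean_diff weighted_mean_cmult weighted_mean_const[OF assms] .
qed

lemma weighted_mean_abs_le_sqrt:
  assumes nonneg: "\<And>x. x \<in> A \<Longrightarrow> 0 \<le> w x" and total: "sum w A \<noteq> 0"
  shows "weighted_mean A w (\<lambda>x. \<bar>f x\<bar>) \<le> sqrt (weighted_mean A w (\<lambda>x. (f x)\<^sup>2))"
proof -
  define c where "c = weighted_mean A w (\<lambda>x. \<bar>f x\<bar>)"
  have "0 \<le> weighted_mean A w (\<lambda>x. (\<bar>f x\<bar> - c)\<^sup>2)"
    by (intro weighted_mean_nonneg nonneg) simp_all
  also have "\<dots> = weighted_mean A w (\<lambda>x. (f x)\<^sup>2) - c\<^sup>2"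
    unfolding weighted_mean_square_dist[OF total] by (simp add: c_def power2_eq_square)
  finally show ?thesis unfolding c_def[symmetric] by (intro real_le_rsqrt) simp
qed

lemma weighted_mean_fibres:
  assumes A: "finite A" and B: "finite B" "g ` A \<subseteq> B" and nonneg: "\<And>x. x \<in> A \<Longrightarrow> 0 \<le> w x"
    and c: "c \<noteq> 0" "\<And>y. y \<in> B \<Longrightarrow> sum w {x \<in> A. g x = y} = c * u y"
  shows "weighted_mean A w f = weighted_mean B u (\<lambda>y. weighted_mean {x \<in> A. g x = y} w f)"
proof -
  let ?fibre = "\<lambda>y. {x \<in> A. g x = y}"
  have "(\<Sum>x\<in>?fibre y. w x * f x) = c * (u y * weighted_mean (?fibre y) w f)" if y: "y \<in> B" for y
  proof (cases "sum w (?fibre y) = 0")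
    case True
    then have "w x = 0" if "x \<in> ?fibre y" for x
      using sum_nonneg_eq_0_iff[of "?fibre y" w] A nonneg that by auto
    then show ?thesis using True c(2)[OF y] c(1) by simp
  next
    case False
    then show ?thesis using c(2)[OF y] by (simp add: weighted_mean_def)
  qed
  then have "(\<Sum>x\<in>A. w x * f x) = c * (\<Sum>y\<in>B. u y * weighted_mean (?fibre y) w f)"
    using sum.group[OF A B, of "\<lambda>x. w x * f x"] by (simp add: sum_distrib_left)
  moreover have "sum w A = c * sum u B"
    using sum.group[OF A B, of w] c(2) by (simp add: sum_distrib_left)
  ultimately show ?thesis using c(1) by (simp add: weighted_mean_def)
qed

lemma weighted_mean_constant_weight:
  assumes "c \<noteq> 0" "\<And>x. x \<in> A \<Longrightarrow> w x = c"
  shows "weighted_mean A w f = weighted_mean A (\<lambda>_. 1) f"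
  using assms by (simp add: weighted_mean_def flip: sum_distrib_left)

section \<open>Multigraphs in the configuration model\<close>

text \<open>A loop at \<open>v\<close> is represented by the singleton \<open>{v}\<close>.\<close>

definition multigraph_edges :: "'a set \<Rightarrow> 'a set set" where
  "multigraph_edges V = [V]\<^bsup>1\<^esup> \<union> [V]\<^bsup>2\<^esup>"

definition incidence :: "'a set \<Rightarrow> 'a \<Rightarrow> nat" where
  "incidence e v = (if v \<in> e then if card e = 1 then 2 else 1 else 0)"

definition half_edges :: "'a set \<Rightarrow> ('a \<Rightarrow> nat) \<Rightarrow> nat" where
  "half_edges V r = (\<Sum>v\<in>V. r v)"

definition multigraphs :: "'a set \<Rightarrow> ('a \<Rightarrow> nat) \<Rightarrow> ('a set \<Rightarrow> nat) set" where
  "multigraphs V r = {m. (\<forall>e. e \<notin> multigraph_edges V \<longrightarrow> m e = 0) \<and>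
     (\<forall>v\<in>V. (\<Sum>e\<in>multigraph_edges V. incidence e v * m e) = r v)}"

text \<open>If each vertex \<open>v\<close> carries \<open>r v\<close> half-edges, this is the number of perfect matchings of the
  half-edges that induce the multigraph \<open>m\<close>. The factor \<open>2 / card e\<close> is \<open>2\<close> for a loop, whose two
  half-edges can be interchanged, and \<open>1\<close> otherwise.\<close>

definition pairing_weight :: "'a set \<Rightarrow> ('a \<Rightarrow> nat) \<Rightarrow> ('a set \<Rightarrow> nat) \<Rightarrow> real" where
  "pairing_weight V r m =
     (\<Prod>v\<in>V. fact (r v)) / (\<Prod>e\<in>multigraph_edges V. (2 / real (card e)) ^ m e * fact (m e))"

definition remove_copies :: "nat \<Rightarrow> 'a set \<Rightarrow> ('a \<Rightarrow> nat) \<Rightarrow> 'a \<Rightarrow> nat" where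
  "remove_copies k e r v = r v - k * incidence e v"

definition add_copies :: "nat \<Rightarrow> 'a set \<Rightarrow> ('a set \<Rightarrow> nat) \<Rightarrow> 'a set \<Rightarrow> nat" where
  "add_copies k e m = m(e := m e + k)"

text \<open>The number of sets of \<open>k\<close> disjoint pairs of half-edges that form copies of \<open>e\<close>.\<close>

definition copy_choices :: "nat \<Rightarrow> 'a set \<Rightarrow> ('a \<Rightarrow> nat) \<Rightarrow> real" where
  "copy_choices k e r =
     (\<Prod>v\<in>e. fact (k * incidence e v) * real (r v choose (k * incidence e v))) / ((2 / real (card e)) ^ k * fact k)"

lemma finite_nsets [simp]: "finite V \<Longrightarrow> finite ([V]\<^bsup>k\<^esup>)"
  by (rule finite_imp_finite_nsets)

lemma finite_multigraph_edges [simp]: "finite V \<Longrightarrow> finite (multigraph_edges V)"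
  by (simp add: multigraph_edges_def)

lemma multigraph_edge_cases:
  assumes "e \<in> multigraph_edges V"
  obtains v where "v \<in> V" "e = {v}" | u v where "u \<in> V" "v \<in> V" "u \<noteq> v" "e = {u, v}"
  using assms by (auto simp: multigraph_edges_def nsets_one elim!: nsets2_E)

lemma singleton_in_multigraph_edges [simp]: "{v} \<in> multigraph_edges V \<longleftrightarrow> v \<in> V"
  by (auto simp: multigraph_edges_def nsets_one nsets_def)

lemma doubleton_in_multigraph_edges [simp]: "{u, v} \<in> multigraph_edges V \<longleftrightarrow> u \<in> V \<and> v \<in> V"
  by (cases "u = v") (auto simp: multigraph_edges_def nsets_def)

lemma multigraph_edge_subset: "e \<in> multigraph_edges V \<Longrightarrow> e \<subseteq> V"
  by (auto simp: multigraph_edges_def nsets_def)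

lemma multigraph_edge_ne: "e \<in> multigraph_edges V \<Longrightarrow> e \<noteq> {}"
  by (auto elim!: multigraph_edge_cases)

lemma multigraph_edge_finite: "e \<in> multigraph_edges V \<Longrightarrow> finite e"
  by (auto simp: multigraph_edges_def nsets_def)

lemma incidence_pos: "e \<in> multigraph_edges V \<Longrightarrow> v \<in> e \<Longrightarrow> incidence e v > 0"
  by (auto simp: incidence_def elim!: multigraph_edge_cases)

lemma sum_incidence:
  assumes "finite V" "e \<in> multigraph_edges V"
  shows "(\<Sum>v\<in>V. incidence e v) = 2"
proof -
  have "(\<Sum>v\<in>V. incidence e v) = (\<Sum>v\<in>e. incidence e v)"
    using assms(1) multigraph_edge_subset[OF assms(2)]
    by (intro sum.mono_neutral_right) (auto simp: incidence_def)
  also have "\<dots> = 2" using assms(2) by (cases rule: multigraph_edge_cases) (auto simp: incidence_def)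
  finally show ?thesis .
qed

lemma multigraph_incidence_le:
  assumes "finite V" "m \<in> multigraphs V r" "e \<in> multigraph_edges V" "v \<in> V"
  shows "m e * incidence e v \<le> r v"
proof -
  have "incidence e v * m e \<le> (\<Sum>e\<in>multigraph_edges V. incidence e v * m e)"
    using assms by (intro member_le_sum) auto
  also have "\<dots> = r v" using assms by (simp add: multigraphs_def)
  finally show ?thesis by (simp add: mult.commute)
qed

lemma multigraph_le_degree:
  assumes "finite V" "m \<in> multigraphs V r" "e \<in> multigraph_edges V" "v \<in> e"
  shows "m e \<le> r v"
proof -
  have "m e * 1 \<le> m e * incidence e v"
    using incidence_pos[OF assms(3,4)] by (intro mult_left_mono) auto
  also have "\<dots> \<le> r v"
    by (rule multigraph_incidence_le[OF assms(1-3)]) (use assms multigraph_edge_subset in blast)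
  finally show ?thesis by simp
qed

lemma finite_multigraphs [simp]:
  assumes "finite V"
  shows "finite (multigraphs V r)"
proof (rule finite_subset)
  show "multigraphs V r \<subseteq> {m. \<forall>e. (e \<in> multigraph_edges V \<longrightarrow> m e \<in> {..half_edges V r}) \<and>
      (e \<notin> multigraph_edges V \<longrightarrow> m e = 0)}"
  proof (clarsimp, intro conjI allI impI)
    fix m e assume m: "m \<in> multigraphs V r"
    show "m e = 0" if "e \<notin> multigraph_edges V" using m that by (simp add: multigraphs_def)
    assume e: "e \<in> multigraph_edges V"
    then obtain v where v: "v \<in> e" "v \<in> V" by (cases rule: multigraph_edge_cases) auto
    have "m e \<le> r v" by (rule multigraph_le_degree[OF assms m e v(1)])
    also have "\<dots> \<le> half_edges V r" unfolding half_edges_def using assms v by (intro member_le_sum) auto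
    finally show "m e \<le> half_edges V r" .
  qed
  show "finite {m. \<forall>e. (e \<in> multigraph_edges V \<longrightarrow> m e \<in> {..half_edges V r}) \<and>
      (e \<notin> multigraph_edges V \<longrightarrow> m e = 0)}"
    by (rule finite_set_of_finite_funs) (use assms in auto)
qed

lemma pairing_weight_nonneg: "pairing_weight V r m \<ge> 0"
  unfolding pairing_weight_def by (intro divide_nonneg_nonneg prod_nonneg) auto

lemma copy_choices_nonneg: "copy_choices k e r \<ge> 0"
  unfolding copy_choices_def by (intro divide_nonneg_nonneg prod_nonneg) auto

lemma copy_choices_eq_0_iff:
  assumes "e \<in> multigraph_edges V"
  shows "copy_choices k e r = 0 \<longleftrightarrow> (\<exists>v\<in>e. r v < k * incidence e v)"
  using multigraph_edge_finite[OF assms] multigraph_edge_ne[OF assms]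
  by (auto simp: copy_choices_def binomial_eq_0_iff)

lemma half_edges_remove_copies:
  assumes V: "finite V" and e: "e \<in> multigraph_edges V" and fits: "\<forall>v\<in>e. k * incidence e v \<le> r v"
  shows "half_edges V (remove_copies k e r) + 2 * k = half_edges V r"
proof -
  have "half_edges V (remove_copies k e r) + (\<Sum>v\<in>V. k * incidence e v) = half_edges V r"
    unfolding half_edges_def sum.distrib[symmetric]
    using fits by (intro sum.cong) (auto simp: remove_copies_def incidence_def)
  then show ?thesis by (simp add: sum_incidence[OF V e] flip: sum_distrib_left)
qed

lemma sum_incidence_add_copies:
  assumes "finite V" "e \<in> multigraph_edges V"
  shows "(\<Sum>f\<in>multigraph_edges V. incidence f v * add_copies k e m f) =
    (\<Sum>f\<in>multigraph_edges V. incidence f v * m f) + k * incidence e v"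
proof -
  have "(\<Sum>f\<in>multigraph_edges V. incidence f v * add_copies k e m f) =
      (\<Sum>f\<in>multigraph_edges V. incidence f v * m f + (if f = e then k * incidence e v else 0))"
    by (intro sum.cong) (auto simp: add_copies_def algebra_simps)
  then show ?thesis using assms by (simp add: sum.distrib)
qed

lemma prod_fact_remove_copies:
  assumes V: "finite V" and e: "e \<in> multigraph_edges V" and fits: "\<forall>v\<in>e. k * incidence e v \<le> r v"
  shows "(\<Prod>v\<in>V. fact (r v)) =
    copy_choices k e r * ((2 / real (card e)) ^ k * fact k) * (\<Prod>v\<in>V. fact (remove_copies k e r v))"
proof -
  let ?j = "\<lambda>v. k * incidence e v"
  have choices: "copy_choices k e r * ((2 / real (card e)) ^ k * fact k) =
      (\<Prod>v\<in>e. fact (?j v) * real (r v choose ?j v))"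
    using multigraph_edge_ne[OF e] multigraph_edge_finite[OF e] by (simp add: copy_choices_def)
  have "(\<Prod>v\<in>V. fact (r v) :: real) =
      (\<Prod>v\<in>V. (if v \<in> e then fact (?j v) * real (r v choose ?j v) else 1) * fact (remove_copies k e r v))"
  proof (rule prod.cong[OF refl])
    fix v
    show "fact (r v) = (if v \<in> e then fact (?j v) * real (r v choose ?j v) else 1) * fact (remove_copies k e r v)"
      using fits by (auto simp: remove_copies_def binomial_fact) (simp add: incidence_def)
  qed
  also have "\<dots> = (\<Prod>v\<in>e. fact (?j v) * real (r v choose ?j v)) * (\<Prod>v\<in>V. fact (remove_copies k e r v))"
    unfolding prod.distrib using V multigraph_edge_subset[OF e]
    by (simp add: Int_absorb1 flip: prod.inter_restrict) (simp add: prod.distrib)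
  finally show ?thesis unfolding choices .
qed

lemma pairing_weight_add_copies:
  assumes V: "finite V" and e: "e \<in> multigraph_edges V" and fits: "\<forall>v\<in>e. k * incidence e v \<le> r v"
  shows "pairing_weight V r (add_copies k e m) * real ((m e + k) choose k) =
    copy_choices k e r * pairing_weight V (remove_copies k e r) m"
proof -
  let ?sym = "\<lambda>m f. (2 / real (card f)) ^ m f * fact (m f) :: real"
  let ?rest = "\<Prod>f\<in>multigraph_edges V - {e}. ?sym m f"
  have "(\<Prod>f\<in>multigraph_edges V - {e}. ?sym (add_copies k e m) f) = ?rest"
    by (intro prod.cong) (auto simp: add_copies_def)
  then have added: "(\<Prod>f\<in>multigraph_edges V. ?sym (add_copies k e m) f) =
      (2 / real (card e)) ^ (m e + k) * fact (m e + k) * ?rest"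
    using V e by (simp add: prod.remove add_copies_def)
  have original: "(\<Prod>f\<in>multigraph_edges V. ?sym m f) = ?sym m e * ?rest"
    using V e by (simp add: prod.remove)
  have choose: "fact (m e + k) = real ((m e + k) choose k) * fact k * fact (m e)"
    by (simp add: binomial_fact)
  have "card e > 0" using multigraph_edge_ne[OF e] multigraph_edge_finite[OF e] by (simp add: card_gt_0_iff)
  moreover have "(m e + k) choose k > 0" by simp
  ultimately show ?thesis
    unfolding pairing_weight_def added original choose prod_fact_remove_copies[OF V e fits]
    by (simp add: power_add)
qed

lemma add_copies_in_multigraphs_iff:
  assumes V: "finite V" and e: "e \<in> multigraph_edges V" and fits: "\<forall>v\<in>e. k * incidence e v \<le> r v"
  shows "add_copies k e m \<in> multigraphs V r \<longleftrightarrow> m \<in> multigraphs V (remove_copies k e r)"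
proof -
  have "(\<Sum>f\<in>multigraph_edges V. incidence f v * add_copies k e m f) = r v \<longleftrightarrow>
      (\<Sum>f\<in>multigraph_edges V. incidence f v * m f) = remove_copies k e r v" for v
  proof -
    have "k * incidence e v \<le> r v" using fits by (cases "v \<in> e") (auto simp: incidence_def)
    then show ?thesis unfolding sum_incidence_add_copies[OF V e] remove_copies_def by linarith
  qed
  moreover have "add_copies k e m f = m f" if "f \<notin> multigraph_edges V" for f
    using that e by (auto simp: add_copies_def)
  ultimately show ?thesis by (simp add: multigraphs_def)
qed

lemma sum_multigraphs_choose_copies:
  assumes V: "finite V" and e: "e \<in> multigraph_edges V"
  shows "(\<Sum>m\<in>multigraphs V r. pairing_weight V r m * (real (m e choose k) * f m)) =
    copy_choices k e r * (\<Sum>m\<in>multigraphs V (remove_copies k e r).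
      pairing_weight V (remove_copies k e r) m * f (add_copies k e m))"
proof (cases "\<forall>v\<in>e. k * incidence e v \<le> r v")
  case False
  then obtain v where v: "v \<in> e" "r v < k * incidence e v" by (auto simp: not_le)
  have "m e choose k = 0" if m: "m \<in> multigraphs V r" for m
  proof -
    have "v \<in> V" using v multigraph_edge_subset[OF e] by auto
    then have "m e * incidence e v < k * incidence e v"
      using multigraph_incidence_le[OF V m e] v by (meson order.strict_trans1)
    then show ?thesis by simp
  qed
  moreover have "copy_choices k e r = 0"
    using v copy_choices_eq_0_iff[OF e] by auto
  ultimately show ?thesis by (simp add: sum.neutral)
next
  case True
  let ?r = "remove_copies k e r"
  have "(\<Sum>m\<in>multigraphs V r. pairing_weight V r m * (real (m e choose k) * f m)) =
      (\<Sum>m\<in>{m \<in> multigraphs V r. k \<le> m e}. pairing_weight V r m * (real (m e choose k) * f m))"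
    using V by (intro sum.mono_neutral_right) (auto simp: not_le)
  also have "\<dots> = (\<Sum>m\<in>multigraphs V ?r. copy_choices k e r * (pairing_weight V ?r m * f (add_copies k e m)))"
  proof (rule sum.reindex_bij_witness[of _ "add_copies k e" "\<lambda>m. m(e := m e - k)"])
    fix m assume m: "m \<in> {m \<in> multigraphs V r. k \<le> m e}"
    let ?m = "m(e := m e - k)"
    show add: "add_copies k e ?m = m" using m by (auto simp: add_copies_def)
    show "?m \<in> multigraphs V ?r" using m add_copies_in_multigraphs_iff[OF V e True, of ?m] by (simp add: add)
    show "copy_choices k e r * (pairing_weight V ?r ?m * f (add_copies k e ?m)) =
        pairing_weight V r m * (real (m e choose k) * f m)"
      using pairing_weight_add_copies[OF V e True, of ?m] m by (simp add: add mult_ac)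
  next
    fix m assume "m \<in> multigraphs V ?r"
    then show "add_copies k e m \<in> {m \<in> multigraphs V r. k \<le> m e}"
      using add_copies_in_multigraphs_iff[OF V e True, of m] by (simp add: add_copies_def)
    show "(add_copies k e m)(e := add_copies k e m e - k) = m" by (auto simp: add_copies_def)
  qed
  finally show ?thesis by (simp add: sum_distrib_left)
qed

definition matching_count :: "nat \<Rightarrow> real" where
  "matching_count N = fact N / (2 ^ (N div 2) * fact (N div 2))"

lemma matching_count_pos: "matching_count N > 0"
  by (simp add: matching_count_def)

lemma matching_count_reduce:
  assumes "even N" "N \<ge> 2"
  shows "matching_count N = (real N - 1) * matching_count (N - 2)"
proof -
  obtain k where "N = 2 * Suc k" using assms by (metis evenE mult_0_right not0_implies_Suc not_numeral_le_zero)
  then show ?thesis by (simp add: matching_count_def divide_simps)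
qed

lemma matching_count_ratio:
  assumes "even N" "N \<ge> 2"
  shows "matching_count (N - 2) / matching_count N = 1 / (real N - 1)"
  unfolding matching_count_reduce[OF assms] using matching_count_pos[of "N - 2"] by simp

lemma matching_count_ratio_4:
  assumes "even N" "N \<ge> 4"
  shows "matching_count (N - 4) / matching_count N = 1 / ((real N - 1) * (real N - 3))"
proof -
  have "matching_count (N - 2) = (real (N - 2) - 1) * matching_count (N - 2 - 2)"
    using assms by (intro matching_count_reduce) auto
  then have "matching_count N = (real N - 1) * ((real N - 3) * matching_count (N - 4))"
    using assms matching_count_reduce[of N] by (simp add: of_nat_diff)
  then show ?thesis using matching_count_pos[of "N - 4"] by simp
qed

lemma real_choose_two: "real (n choose 2) = real n * (real n - 1) / 2"
  by (induction n) (auto simp: numeral_2_eq_2 field_simps)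

lemma copy_choices_loop: "copy_choices 1 {v} r = real (r v choose 2)"
  by (simp add: copy_choices_def incidence_def)

lemma copy_choices_pair: "u \<noteq> v \<Longrightarrow> copy_choices 1 {u, v} r = real (r u) * real (r v)"
  by (simp add: copy_choices_def incidence_def)

lemma copy_choices_double_pair:
  "u \<noteq> v \<Longrightarrow> copy_choices 2 {u, v} r = 2 * real (r u choose 2) * real (r v choose 2)"
  by (simp add: copy_choices_def incidence_def)

lemma sum_multigraph_edges_at_vertex:
  assumes V: "finite V" and v: "v \<in> V"
  shows "(\<Sum>e\<in>multigraph_edges V. real (incidence e v) * h e) =
    (\<Sum>u\<in>V. real (incidence {v, u} v) * h {v, u})"
proof -
  have "(\<Sum>e\<in>multigraph_edges V. real (incidence e v) * h e) =
      (\<Sum>e\<in>(\<lambda>u. {v, u}) ` V. real (incidence e v) * h e)"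
  proof (rule sum.mono_neutral_right)
    show "(\<lambda>u. {v, u}) ` V \<subseteq> multigraph_edges V" using v by auto
    have "v \<notin> e" if "e \<in> multigraph_edges V - (\<lambda>u. {v, u}) ` V" for e
      using that by (auto elim!: multigraph_edge_cases)
    then show "\<forall>e\<in>multigraph_edges V - (\<lambda>u. {v, u}) ` V. real (incidence e v) * h e = 0"
      by (simp add: incidence_def)
  qed (use V in simp)
  then show ?thesis by (simp add: sum.reindex inj_on_def doubleton_eq_iff)
qed

lemma sum_copy_choices_at_vertex:
  assumes V: "finite V" and v: "v \<in> V"
  shows "(\<Sum>e\<in>multigraph_edges V. real (incidence e v) * copy_choices 1 e r) =
    real (r v) * (real (half_edges V r) - 1)"
proof -
  have "real (incidence {v, u} v) * copy_choices 1 {v, u} r =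
      real (r v) * (real (r u) - (if u = v then 1 else 0))" for u
  proof (cases "u = v")
    case True
    then show ?thesis using copy_choices_loop[of v r] by (simp add: incidence_def real_choose_two)
  next
    case False
    then show ?thesis using copy_choices_pair[of v u r] by (simp add: incidence_def)
  qed
  then show ?thesis unfolding sum_multigraph_edges_at_vertex[OF V v]
    using V v by (simp add: half_edges_def sum_subtractf flip: sum_distrib_left)
qed

lemma multigraphs_no_half_edges:
  assumes V: "finite V" and r: "\<forall>v\<in>V. r v = 0"
  shows "multigraphs V r = {\<lambda>_. 0}"
proof -
  have "m e = 0" if m: "m \<in> multigraphs V r" for m e
  proof (cases "e \<in> multigraph_edges V")
    case True
    then obtain v where "v \<in> e" "v \<in> V" by (cases rule: multigraph_edge_cases) auto
    then show ?thesis using multigraph_le_degree[OF V m True] r by fastforce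
  qed (use m in \<open>simp add: multigraphs_def\<close>)
  moreover have "(\<lambda>_. 0) \<in> multigraphs V r" using r by (simp add: multigraphs_def)
  ultimately show ?thesis by (auto simp: fun_eq_iff)
qed

lemma sum_pairing_weight_at_vertex:
  assumes V: "finite V" and v: "v \<in> V"
  shows "real (r v) * sum (pairing_weight V r) (multigraphs V r) =
    (\<Sum>e\<in>multigraph_edges V. real (incidence e v) *
      (copy_choices 1 e r * sum (pairing_weight V (remove_copies 1 e r)) (multigraphs V (remove_copies 1 e r))))"
proof -
  have "real (r v) * pairing_weight V r m =
      (\<Sum>e\<in>multigraph_edges V. real (incidence e v) * (pairing_weight V r m * real (m e choose 1)))"
    if "m \<in> multigraphs V r" for m
  proof -
    have "real (r v) = (\<Sum>e\<in>multigraph_edges V. real (incidence e v) * real (m e))"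
      using that v by (auto simp: multigraphs_def simp flip: of_nat_mult of_nat_sum)
    then show ?thesis by (simp add: sum_distrib_left mult_ac)
  qed
  then have "real (r v) * sum (pairing_weight V r) (multigraphs V r) = (\<Sum>m\<in>multigraphs V r.
      \<Sum>e\<in>multigraph_edges V. real (incidence e v) * (pairing_weight V r m * real (m e choose 1)))"
    by (simp add: sum_distrib_left)
  also have "\<dots> = (\<Sum>e\<in>multigraph_edges V. real (incidence e v) *
      (\<Sum>m\<in>multigraphs V r. pairing_weight V r m * (real (m e choose 1) * 1)))"
    unfolding sum_distrib_left by (subst sum.swap) simp
  finally show ?thesis
    by (simp add: sum_multigraphs_choose_copies[OF V, of _ r 1 "\<lambda>_. 1", simplified] cong: sum.cong)
qed

lemma sum_pairing_weight:
  assumes V: "finite V" and "even (half_edges V r)"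
  shows "sum (pairing_weight V r) (multigraphs V r) = matching_count (half_edges V r)"
  using assms(2)
proof (induction "half_edges V r" arbitrary: r rule: less_induct)
  case less
  let ?N = "half_edges V r"
  let ?Z = "\<lambda>r. sum (pairing_weight V r) (multigraphs V r)"
  show ?case
  proof (cases "?N = 0")
    case True
    then have "\<forall>v\<in>V. r v = 0" using V by (simp add: half_edges_def)
    then show ?thesis
      using True multigraphs_no_half_edges[OF V] by (simp add: pairing_weight_def matching_count_def)
  next
    case False
    then obtain v where v: "v \<in> V" "r v > 0" using V by (auto simp: half_edges_def)
    have N: "?N \<ge> 2" using False less.prems by (cases "?N = 1") auto
    have Z: "copy_choices 1 e r * ?Z (remove_copies 1 e r) = copy_choices 1 e r * matching_count (?N - 2)"
      if e: "e \<in> multigraph_edges V" for e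
    proof (cases "copy_choices 1 e r = 0")
      case False
      then have "half_edges V (remove_copies 1 e r) + 2 * 1 = ?N"
        by (intro half_edges_remove_copies[OF V e]) (auto simp: copy_choices_eq_0_iff[OF e] not_less)
      then have "half_edges V (remove_copies 1 e r) = ?N - 2" by simp
      then show ?thesis using less.hyps[of "remove_copies 1 e r"] less.prems N by simp
    qed simp
    have "real (r v) * ?Z r =
        (\<Sum>e\<in>multigraph_edges V. real (incidence e v) * copy_choices 1 e r) * matching_count (?N - 2)"
      unfolding sum_pairing_weight_at_vertex[OF V v(1)] sum_distrib_right
      by (intro sum.cong refl) (simp only: Z mult.assoc)
    also have "\<dots> = real (r v) * matching_count ?N"
      using sum_copy_choices_at_vertex[OF V v(1), of r] matching_count_reduce[OF less.prems N] by simp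
    finally show ?thesis using v(2) by simp
  qed
qed

definition pairing_mean :: "'a set \<Rightarrow> ('a \<Rightarrow> nat) \<Rightarrow> (('a set \<Rightarrow> nat) \<Rightarrow> real) \<Rightarrow> real" where
  "pairing_mean V r = weighted_mean (multigraphs V r) (pairing_weight V r)"

lemma pairing_mean_const:
  assumes "finite V" "even (half_edges V r)"
  shows "pairing_mean V r (\<lambda>_. c) = c"
  unfolding pairing_mean_def
  by (rule weighted_mean_const) (use assms in \<open>simp add: sum_pairing_weight matching_count_pos less_imp_neq[symmetric]\<close>)

lemma pairing_mean_choose_copies:
  assumes V: "finite V" and e: "e \<in> multigraph_edges V" and even: "even (half_edges V r)"
  shows "pairing_mean V r (\<lambda>m. real (m e choose k) * f m) =
    copy_choices k e r * (matching_count (half_edges V r - 2 * k) / matching_count (half_edges V r)) *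
    pairing_mean V (remove_copies k e r) (\<lambda>m. f (add_copies k e m))"
proof (cases "copy_choices k e r = 0")
  case True
  then show ?thesis using sum_multigraphs_choose_copies[OF V e, of r k f]
    by (simp add: pairing_mean_def weighted_mean_def)
next
  case False
  then have N: "half_edges V (remove_copies k e r) + 2 * k = half_edges V r"
    by (intro half_edges_remove_copies[OF V e]) (auto simp: copy_choices_eq_0_iff[OF e] not_less)
  then have "even (half_edges V (remove_copies k e r))" using even by (simp flip: N)
  then have "sum (pairing_weight V (remove_copies k e r)) (multigraphs V (remove_copies k e r)) =
      matching_count (half_edges V r - 2 * k)"
    unfolding sum_pairing_weight[OF V \<open>even (half_edges V (remove_copies k e r))\<close>] N[symmetric] by simp
  then show ?thesis using matching_count_pos[of "half_edges V r - 2 * k"]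
    unfolding pairing_mean_def weighted_mean_def sum_multigraphs_choose_copies[OF V e] sum_pairing_weight[OF V even]
    by simp
qed

section \<open>Poisson approximation\<close>

text \<open>A defect of a multigraph is a loop, an edge in \<open>X\<close> or a pair of parallel edges, so that the
  multigraphs without defects are the simple graphs avoiding \<open>X\<close>.\<close>

definition defect_size :: "'a set set \<Rightarrow> 'a set \<Rightarrow> nat" where
  "defect_size X e = (if card e = 1 \<or> e \<in> X then 1 else 2)"

definition defects :: "'a set \<Rightarrow> 'a set set \<Rightarrow> ('a set \<Rightarrow> nat) \<Rightarrow> nat" where
  "defects V X m = (\<Sum>e\<in>multigraph_edges V. m e choose defect_size X e)"

definition defect_gf :: "'a set \<Rightarrow> 'a set set \<Rightarrow> ('a \<Rightarrow> nat) \<Rightarrow> real \<Rightarrow> real" where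
  "defect_gf V X r t = pairing_mean V r (\<lambda>m. (1 - t) ^ defects V X m)"

definition defect_rate :: "'a set \<Rightarrow> 'a set set \<Rightarrow> ('a \<Rightarrow> nat) \<Rightarrow> 'a set \<Rightarrow> real" where
  "defect_rate V X r e = copy_choices (defect_size X e) e r *
     (matching_count (half_edges V r - 2 * defect_size X e) / matching_count (half_edges V r))"

definition remove_defect :: "'a set set \<Rightarrow> 'a set \<Rightarrow> ('a \<Rightarrow> nat) \<Rightarrow> 'a \<Rightarrow> nat" where
  "remove_defect X e = remove_copies (defect_size X e) e"

definition add_defect :: "'a set set \<Rightarrow> 'a set \<Rightarrow> ('a set \<Rightarrow> nat) \<Rightarrow> 'a set \<Rightarrow> nat" where
  "add_defect X e = add_copies (defect_size X e) e"

lemma pairing_mean_mono: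
  "(\<And>m. m \<in> multigraphs V r \<Longrightarrow> f m \<le> g m) \<Longrightarrow> pairing_mean V r f \<le> pairing_mean V r g"
  unfolding pairing_mean_def by (rule weighted_mean_mono) (auto simp: pairing_weight_nonneg)

lemma pairing_mean_dist_le:
  assumes "\<And>m. m \<in> multigraphs V r \<Longrightarrow> \<bar>f m - g m\<bar> \<le> h m"
  shows "\<bar>pairing_mean V r f - pairing_mean V r g\<bar> \<le> pairing_mean V r h"
proof -
  have "\<bar>pairing_mean V r f - pairing_mean V r g\<bar> \<le> pairing_mean V r (\<lambda>m. \<bar>f m - g m\<bar>)"
    unfolding pairing_mean_def weighted_mean_diff[symmetric]
    by (rule abs_weighted_mean_le) (simp add: pairing_weight_nonneg)
  also have "\<dots> \<le> pairing_mean V r h" by (rule pairing_mean_mono) (rule assms)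
  finally show ?thesis .
qed

lemma defects_add_defect:
  assumes "finite V" "e \<in> multigraph_edges V"
  shows "defects V X (add_defect X e m) + (m e choose defect_size X e) =
    defects V X m + ((m e + defect_size X e) choose defect_size X e)"
proof -
  have "(\<Sum>f\<in>multigraph_edges V - {e}. add_defect X e m f choose defect_size X f) =
      (\<Sum>f\<in>multigraph_edges V - {e}. m f choose defect_size X f)"
    by (intro sum.cong) (auto simp: add_defect_def add_copies_def)
  then show ?thesis
    using assms by (simp add: defects_def sum.remove add_defect_def add_copies_def)
qed

lemma defect_gf_has_real_derivative:
  assumes V: "finite V" and even: "even (half_edges V r)"
  shows "(defect_gf V X r has_real_derivative
    - (\<Sum>e\<in>multigraph_edges V. defect_rate V X r e *
         pairing_mean V (remove_defect X e r) (\<lambda>m. (1 - t) ^ (defects V X (add_defect X e m) - 1)))) (at t)"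
proof -
  let ?D = "defects V X"
  have "(\<Sum>e\<in>multigraph_edges V. defect_rate V X r e *
        pairing_mean V (remove_defect X e r) (\<lambda>m. (1 - t) ^ (?D (add_defect X e m) - 1))) =
      (\<Sum>e\<in>multigraph_edges V. pairing_mean V r (\<lambda>m. real (m e choose defect_size X e) * (1 - t) ^ (?D m - 1)))"
    unfolding defect_rate_def remove_defect_def add_defect_def
    by (intro sum.cong refl pairing_mean_choose_copies[OF V _ even, symmetric])
  also have "\<dots> = pairing_mean V r (\<lambda>m. \<Sum>e\<in>multigraph_edges V. real (m e choose defect_size X e) * (1 - t) ^ (?D m - 1))"
    unfolding pairing_mean_def by (rule weighted_mean_sum[symmetric])
  also have "\<dots> = pairing_mean V r (\<lambda>m. real (?D m) * (1 - t) ^ (?D m - 1))"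
    by (simp add: defects_def sum_distrib_right)
  finally have rates: "(\<Sum>e\<in>multigraph_edges V. defect_rate V X r e *
        pairing_mean V (remove_defect X e r) (\<lambda>m. (1 - t) ^ (?D (add_defect X e m) - 1))) =
      pairing_mean V r (\<lambda>m. real (?D m) * (1 - t) ^ (?D m - 1))" .
  have "((\<lambda>t. pairing_mean V r (\<lambda>m. (1 - t) ^ ?D m)) has_real_derivative
      (\<Sum>m\<in>multigraphs V r. pairing_weight V r m * (- (real (?D m) * (1 - t) ^ (?D m - 1)))) /
      sum (pairing_weight V r) (multigraphs V r)) (at t)"
    unfolding pairing_mean_def weighted_mean_def
    by (intro DERIV_cdivide DERIV_sum DERIV_cmult) (auto intro!: derivative_eq_intros)
  then show ?thesis
    unfolding rates defect_gf_def[abs_def] by (simp add: pairing_mean_def weighted_mean_def sum_negf)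
qed

lemma choose_two_le:
  assumes "k \<le> d"
  shows "real (k choose 2) \<le> real d * real k"
proof -
  have "real k * (real k - 1) \<le> real k * (2 * real d)" using assms by (intro mult_left_mono) auto
  then show ?thesis by (simp add: real_choose_two mult_ac)
qed

lemma copy_choices_le:
  assumes e: "e \<in> multigraph_edges V" and r: "\<forall>v\<in>V. r v \<le> d"
  shows "copy_choices 1 e r \<le> real d ^ 2"
  using e
proof (cases rule: multigraph_edge_cases)
  case (1 v)
  then have "real (r v choose 2) \<le> real d * real (r v)" using r by (intro choose_two_le) auto
  also have "\<dots> \<le> real d * real d" using 1 r by (intro mult_left_mono) auto
  finally show ?thesis using 1 copy_choices_loop[of v r] by (simp add: power2_eq_square)
next
  case (2 u v)
  then have "real (r u) * real (r v) \<le> real d * real d" using r by (intro mult_mono) auto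
  then show ?thesis using 2 copy_choices_pair[of u v r] by (simp add: power2_eq_square)
qed

lemma pairing_mean_copies_le:
  assumes V: "finite V" and e: "e \<in> multigraph_edges V" and even: "even (half_edges V r)"
    and N: "half_edges V r \<ge> 2" and r: "\<forall>v\<in>V. r v \<le> d"
  shows "pairing_mean V r (\<lambda>m. real (m e)) \<le> real d ^ 2 / (real (half_edges V r) - 1)"
proof -
  let ?N = "half_edges V r"
  let ?P = "pairing_mean V (remove_copies 1 e r) (\<lambda>_. 1)"
  have "pairing_mean V r (\<lambda>m. real (m e)) = copy_choices 1 e r * (matching_count (?N - 2) / matching_count ?N) * ?P"
    using pairing_mean_choose_copies[OF V e even, of 1 "\<lambda>_. 1"] by simp
  also have "\<dots> = copy_choices 1 e r * ?P / (real ?N - 1)"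
    unfolding matching_count_ratio[OF even N] by simp
  also have "\<dots> \<le> real d ^ 2 / (real ?N - 1)"
  proof (rule divide_right_mono)
    show "copy_choices 1 e r * ?P \<le> real d ^ 2"
    proof (cases "copy_choices 1 e r = 0")
      case False
      then have "half_edges V (remove_copies 1 e r) + 2 * 1 = ?N"
        by (intro half_edges_remove_copies[OF V e]) (auto simp: copy_choices_eq_0_iff[OF e] not_less)
      then have "even (half_edges V (remove_copies 1 e r))" using even by (simp flip: \<open>_ = ?N\<close>)
      then show ?thesis using copy_choices_le[OF e r] by (simp add: pairing_mean_const[OF V])
    qed simp
  qed (use N in linarith)
  finally show ?thesis .
qed

lemma defect_gf_add_defect_dist_le:
  assumes V: "finite V" and e: "e \<in> multigraph_edges V" and even: "even (half_edges V r)"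
    and N: "half_edges V r \<ge> 2" and r: "\<forall>v\<in>V. r v \<le> d" and t: "0 \<le> t" "t \<le> 1"
  shows "\<bar>pairing_mean V r (\<lambda>m. (1 - t) ^ (defects V X (add_defect X e m) - 1)) - defect_gf V X r t\<bar> \<le>
    real d ^ 2 / (real (half_edges V r) - 1)"
proof -
  have "\<bar>(1 - t) ^ (defects V X (add_defect X e m) - 1) - (1 - t) ^ defects V X m\<bar> \<le> real (m e)" for m
  proof (cases "m e = 0")
    case True
    then have "defects V X (add_defect X e m) = Suc (defects V X m)"
      using defects_add_defect[OF V e, of X m] by (simp add: defect_size_def numeral_2_eq_2 split: if_splits)
    then show ?thesis by simp
  next
    case False
    have "0 \<le> (1 - t) ^ j \<and> (1 - t) ^ j \<le> 1" for j using t by (simp add: power_le_one)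
    then have "\<bar>(1 - t) ^ i - (1 - t) ^ j\<bar> \<le> 1" for i j
      using abs_diff_le_iff[of _ _ 1] by (smt (verit))
    also have "1 \<le> real (m e)" using False by simp
    finally show ?thesis .
  qed
  then have "\<bar>pairing_mean V r (\<lambda>m. (1 - t) ^ (defects V X (add_defect X e m) - 1)) - defect_gf V X r t\<bar> \<le>
      pairing_mean V r (\<lambda>m. real (m e))"
    unfolding defect_gf_def by (intro pairing_mean_dist_le)
  then show ?thesis using pairing_mean_copies_le[OF V e even N r] by linarith
qed

lemma defect_gf_0:
  assumes "finite V" "even (half_edges V r)"
  shows "defect_gf V X r 0 = 1"
  using assms by (simp add: defect_gf_def pairing_mean_const)

lemma defect_gf_bounds:
  assumes "finite V" "even (half_edges V r)" "0 \<le> t" "t \<le> 1"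
  shows "0 \<le> defect_gf V X r t" "defect_gf V X r t \<le> 1"
  using pairing_mean_mono[of V r "\<lambda>_. 0" "\<lambda>m. (1 - t) ^ defects V X m"]
    pairing_mean_mono[of V r "\<lambda>m. (1 - t) ^ defects V X m" "\<lambda>_. 1"] assms
  by (auto simp: defect_gf_def pairing_mean_const power_le_one)

definition loop_choices :: "'a set \<Rightarrow> ('a \<Rightarrow> nat) \<Rightarrow> real" where
  "loop_choices V r = (\<Sum>v\<in>V. real (r v choose 2))"

definition edge_choices :: "'a set set \<Rightarrow> ('a \<Rightarrow> nat) \<Rightarrow> real" where
  "edge_choices X r = (\<Sum>e\<in>X. \<Prod>v\<in>e. real (r v))"

definition loop_mean :: "'a set \<Rightarrow> ('a \<Rightarrow> nat) \<Rightarrow> real" where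
  "loop_mean V r = loop_choices V r / real (half_edges V r)"

definition edge_mean :: "'a set \<Rightarrow> 'a set set \<Rightarrow> ('a \<Rightarrow> nat) \<Rightarrow> real" where
  "edge_mean V X r = edge_choices X r / real (half_edges V r)"

definition defect_mean :: "'a set \<Rightarrow> 'a set set \<Rightarrow> ('a \<Rightarrow> nat) \<Rightarrow> real" where
  "defect_mean V X r = loop_mean V r + (loop_mean V r)\<^sup>2 + edge_mean V X r"

definition admissible :: "nat \<Rightarrow> 'a set \<Rightarrow> 'a set set \<Rightarrow> ('a \<Rightarrow> nat) \<Rightarrow> bool" where
  "admissible d V X r \<longleftrightarrow> finite V \<and> X \<subseteq> [V]\<^bsup>2\<^esup> \<and> even (half_edges V r) \<and>
     (\<forall>v\<in>V. r v \<le> d) \<and> (\<forall>v\<in>V. graph_degree X v \<le> d)"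

lemma subset_nsets_2E:
  assumes "X \<subseteq> [V]\<^bsup>2\<^esup>" "e \<in> X"
  obtains u v where "e = {u, v}" "u \<in> V" "v \<in> V" "u \<noteq> v"
  using subsetD[OF assms] by (rule nsets2_E)

lemma real_power_le_power:
  assumes "0 < i" "i \<le> j"
  shows "real k ^ i \<le> real k ^ j"
  using assms by (cases "k = 0") (auto simp: zero_power intro: power_increasing)

lemma real_le_square: "real k \<le> real k ^ 2"
  using real_power_le_power[of 1 2 k] by simp

lemma half_edges_mono: "\<forall>v\<in>V. r' v \<le> r v \<Longrightarrow> half_edges V r' \<le> half_edges V r"
  unfolding half_edges_def by (intro sum_mono) auto

lemma half_edges_diff:
  "real (half_edges V r) - real (half_edges V r') = (\<Sum>v\<in>V. real (r v) - real (r' v))"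
  by (simp add: half_edges_def sum_subtractf)

lemma sum_edges_vertices:
  fixes h :: "'a \<Rightarrow> real"
  assumes V: "finite V" and X: "X \<subseteq> [V]\<^bsup>2\<^esup>"
  shows "(\<Sum>e\<in>X. \<Sum>v\<in>e. h v) = (\<Sum>v\<in>V. h v * real (graph_degree X v))"
proof -
  have fin: "finite X" using X V finite_subset finite_nsets by blast
  have "(\<Sum>e\<in>X. \<Sum>v\<in>e. h v) = (\<Sum>e\<in>X. \<Sum>v\<in>V. if v \<in> e then h v else 0)"
    using X V by (intro sum.cong refl sum.mono_neutral_cong_left) (auto simp: nsets_def)
  also have "\<dots> = (\<Sum>v\<in>V. \<Sum>e\<in>X. if v \<in> e then h v else 0)" by (rule sum.swap)
  also have "\<dots> = (\<Sum>v\<in>V. h v * real (graph_degree X v))"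
    using fin by (simp add: graph_degree_def mult.commute flip: sum.inter_filter)
  finally show ?thesis .
qed

lemma loop_choices_diff_bounds:
  assumes "\<forall>v\<in>V. r v \<le> d" "\<forall>v\<in>V. r' v \<le> r v"
  shows "0 \<le> loop_choices V r - loop_choices V r'"
    "loop_choices V r - loop_choices V r' \<le> real d * (real (half_edges V r) - real (half_edges V r'))"
proof -
  have bounds: "0 \<le> real (r v choose 2) - real (r' v choose 2) \<and>
      real (r v choose 2) - real (r' v choose 2) \<le> real d * (real (r v) - real (r' v))" if "v \<in> V" for v
  proof (cases "r v = r' v")
    case False
    let ?a = "real (r v)" and ?b = "real (r' v)"
    have term_bounds: "?b + 1 \<le> ?a" "?a \<le> real d" "0 \<le> ?b" using assms that False by (auto simp: Suc_le_eq simp flip: of_nat_Suc)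
    have "real (r v choose 2) - real (r' v choose 2) = ((?a + ?b - 1) / 2) * (?a - ?b)"
      by (simp add: real_choose_two field_simps)
    moreover have "((?a + ?b - 1) / 2) * (?a - ?b) \<le> real d * (?a - ?b)"
      using term_bounds by (intro mult_right_mono) auto
    moreover have "0 \<le> ((?a + ?b - 1) / 2) * (?a - ?b)" using term_bounds by (intro mult_nonneg_nonneg) auto
    ultimately show ?thesis by linarith
  qed simp
  show "0 \<le> loop_choices V r - loop_choices V r'"
    unfolding loop_choices_def sum_subtractf[symmetric] using bounds by (intro sum_nonneg) auto
  show "loop_choices V r - loop_choices V r' \<le> real d * (real (half_edges V r) - real (half_edges V r'))"
    unfolding loop_choices_def half_edges_diff sum_subtractf[symmetric] sum_distrib_left
    using bounds by (intro sum_mono) auto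
qed

lemma edge_choices_diff_bounds:
  assumes V: "finite V" and X: "X \<subseteq> [V]\<^bsup>2\<^esup>" and deg: "\<forall>v\<in>V. graph_degree X v \<le> d"
    and r: "\<forall>v\<in>V. r v \<le> d" "\<forall>v\<in>V. r' v \<le> r v"
  shows "0 \<le> edge_choices X r - edge_choices X r'"
    "edge_choices X r - edge_choices X r' \<le> real d ^ 2 * (real (half_edges V r) - real (half_edges V r'))"
proof -
  have bounds: "0 \<le> (\<Prod>v\<in>e. real (r v)) - (\<Prod>v\<in>e. real (r' v)) \<and>
      (\<Prod>v\<in>e. real (r v)) - (\<Prod>v\<in>e. real (r' v)) \<le> real d * (\<Sum>v\<in>e. real (r v) - real (r' v))"
    if e: "e \<in> X" for e
  proof -
    obtain u v where uv: "e = {u, v}" "u \<in> V" "v \<in> V" "u \<noteq> v" using X e by (rule subset_nsets_2E)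
    have term_bounds: "r' u \<le> r u" "r' v \<le> r v" "r u \<le> d" "r v \<le> d" using uv r by auto
    have "real (r' u) * real (r' v) \<le> real (r u) * real (r v)"
      using term_bounds by (intro mult_mono) auto
    moreover have "real (r v) * (real (r u) - real (r' u)) \<le> real d * (real (r u) - real (r' u))"
      using term_bounds by (intro mult_right_mono) auto
    moreover have "real (r' u) * (real (r v) - real (r' v)) \<le> real d * (real (r v) - real (r' v))"
      using term_bounds by (intro mult_right_mono) auto
    ultimately show ?thesis using uv by (simp add: algebra_simps)
  qed
  show "0 \<le> edge_choices X r - edge_choices X r'"
    unfolding edge_choices_def sum_subtractf[symmetric] using bounds by (intro sum_nonneg) auto
  have "edge_choices X r - edge_choices X r' \<le> (\<Sum>e\<in>X. real d * (\<Sum>v\<in>e. real (r v) - real (r' v)))"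
    unfolding edge_choices_def sum_subtractf[symmetric] using bounds by (intro sum_mono) (auto simp: sum_subtractf)
  also have "\<dots> = real d * (\<Sum>v\<in>V. (real (r v) - real (r' v)) * real (graph_degree X v))"
    unfolding sum_distrib_left[symmetric] sum_edges_vertices[OF V X] ..
  also have "\<dots> \<le> real d * (\<Sum>v\<in>V. (real (r v) - real (r' v)) * real d)"
    using deg r by (intro mult_left_mono sum_mono) auto
  finally show "edge_choices X r - edge_choices X r' \<le> real d ^ 2 * (real (half_edges V r) - real (half_edges V r'))"
    by (simp add: half_edges_diff power2_eq_square mult_ac sum_distrib_left)
qed

lemma loop_choices_bounds:
  assumes "\<forall>v\<in>V. r v \<le> d"
  shows "0 \<le> loop_choices V r" "loop_choices V r \<le> real d * real (half_edges V r)"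
  using loop_choices_diff_bounds[OF assms, of "\<lambda>_. 0"] by (auto simp: loop_choices_def half_edges_def numeral_2_eq_2)

lemma edge_choices_bounds:
  assumes "finite V" "X \<subseteq> [V]\<^bsup>2\<^esup>" "\<forall>v\<in>V. graph_degree X v \<le> d" "\<forall>v\<in>V. r v \<le> d"
  shows "0 \<le> edge_choices X r" "edge_choices X r \<le> real d ^ 2 * real (half_edges V r)"
proof -
  have "(\<Prod>v\<in>e. real 0) = 0" if "e \<in> X" for e
    using that assms(2) by (auto simp: nsets_2_eq dest!: subsetD)
  then have "edge_choices X (\<lambda>_. 0) = 0" unfolding edge_choices_def by (intro sum.neutral) auto
  then show "0 \<le> edge_choices X r" "edge_choices X r \<le> real d ^ 2 * real (half_edges V r)"
    using edge_choices_diff_bounds[OF assms, of "\<lambda>_. 0"] by (auto simp: half_edges_def)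
qed

lemma loop_mean_bounds:
  assumes "\<forall>v\<in>V. r v \<le> d"
  shows "0 \<le> loop_mean V r" "loop_mean V r \<le> real d"
  using loop_choices_bounds[OF assms] by (auto simp: loop_mean_def divide_le_eq)

lemma edge_mean_bounds:
  assumes "finite V" "X \<subseteq> [V]\<^bsup>2\<^esup>" "\<forall>v\<in>V. graph_degree X v \<le> d" "\<forall>v\<in>V. r v \<le> d"
  shows "0 \<le> edge_mean V X r" "edge_mean V X r \<le> real d ^ 2"
  using edge_choices_bounds[OF assms] by (auto simp: edge_mean_def divide_le_eq)

lemma defect_mean_bounds:
  assumes "admissible d V X r"
  shows "0 \<le> defect_mean V X r" "defect_mean V X r \<le> 3 * real d ^ 2"
proof -
  have loops: "0 \<le> loop_mean V r" "loop_mean V r \<le> real d"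
    using loop_mean_bounds[of V r d] assms by (auto simp: admissible_def)
  moreover have "0 \<le> edge_mean V X r" "edge_mean V X r \<le> real d ^ 2"
    using edge_mean_bounds[of V X d r] assms by (auto simp: admissible_def)
  moreover have "(loop_mean V r)\<^sup>2 \<le> real d ^ 2" using loops by (intro power_mono) auto
  ultimately show "0 \<le> defect_mean V X r" "defect_mean V X r \<le> 3 * real d ^ 2"
    unfolding defect_mean_def using real_le_square[of d] zero_le_power2[of "loop_mean V r"] by linarith+
qed

lemma quotient_dist_le:
  fixes S S' N N' c :: real
  assumes S: "0 \<le> S - S'" "S - S' \<le> c * (N - N')" and S': "0 \<le> S'" "S' \<le> c * N'" and N: "0 < N'" "N' \<le> N"
  shows "\<bar>S / N - S' / N'\<bar> \<le> c * (N - N') / N"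
proof -
  have q: "0 \<le> S' / N'" "S' / N' \<le> c" using S' N by (auto simp: divide_le_eq)
  have "0 \<le> (S' / N') * (N - N')" "(S' / N') * (N - N') \<le> c * (N - N')"
    using q N by (simp_all only: mult_nonneg_nonneg mult_right_mono diff_ge_0_iff_ge)
  then have "\<bar>(S - S') - (S' / N') * (N - N')\<bar> \<le> c * (N - N')" using S by linarith
  moreover have "S / N - S' / N' = ((S - S') - (S' / N') * (N - N')) / N"
    using N by (simp add: field_simps)
  ultimately show ?thesis using N by (simp add: abs_divide divide_right_mono)
qed

lemma defect_mean_dist_le:
  assumes adm: "admissible d V X r" and smaller: "\<forall>v\<in>V. r' v \<le> r v"
    and N: "half_edges V r \<le> half_edges V r' + 4" "0 < half_edges V r'"
  shows "\<bar>defect_mean V X r - defect_mean V X r'\<bar> \<le> 16 * real d ^ 2 / real (half_edges V r)"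
proof -
  let ?N = "real (half_edges V r)" and ?N' = "real (half_edges V r')"
  have V: "finite V" and X: "X \<subseteq> [V]\<^bsup>2\<^esup>" "\<forall>v\<in>V. graph_degree X v \<le> d" and r: "\<forall>v\<in>V. r v \<le> d"
    using adm by (auto simp: admissible_def)
  then have r': "\<forall>v\<in>V. r' v \<le> d" using smaller by (meson order_trans)
  have sizes: "0 < ?N'" "?N' \<le> ?N" "?N - ?N' \<le> 4" using N half_edges_mono[OF smaller] by auto
  have scale: "c * (?N - ?N') / ?N \<le> 4 * c / ?N" if "0 \<le> c" for c
    using mult_left_mono[OF sizes(3) that] sizes by (intro divide_right_mono) auto
  have loop: "\<bar>loop_mean V r - loop_mean V r'\<bar> \<le> 4 * real d / ?N"
    unfolding loop_mean_def
    using quotient_dist_le[OF loop_choices_diff_bounds[OF r smaller] loop_choices_bounds[OF r'] sizes(1,2)] scale[of "real d"]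
    by simp
  have edge: "\<bar>edge_mean V X r - edge_mean V X r'\<bar> \<le> 4 * real d ^ 2 / ?N"
    unfolding edge_mean_def
    using quotient_dist_le[OF edge_choices_diff_bounds[OF V X r smaller] edge_choices_bounds[OF V X r'] sizes(1,2)]
      scale[of "real d ^ 2"] by simp
  have "\<bar>(loop_mean V r)\<^sup>2 - (loop_mean V r')\<^sup>2\<bar> = \<bar>loop_mean V r - loop_mean V r'\<bar> * \<bar>loop_mean V r + loop_mean V r'\<bar>"
    by (simp add: power2_eq_square algebra_simps flip: abs_mult)
  also have "\<dots> \<le> (4 * real d / ?N) * (2 * real d)"
    using loop loop_mean_bounds[OF r] loop_mean_bounds[OF r'] by (intro mult_mono) auto
  finally have "\<bar>(loop_mean V r)\<^sup>2 - (loop_mean V r')\<^sup>2\<bar> \<le> 8 * real d ^ 2 / ?N" by (simp add: power2_eq_square)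
  then have "\<bar>defect_mean V X r - defect_mean V X r'\<bar> \<le> 4 * real d / ?N + 8 * real d ^ 2 / ?N + 4 * real d ^ 2 / ?N"
    unfolding defect_mean_def using loop edge by linarith
  also have "\<dots> \<le> 16 * real d ^ 2 / ?N"
    using real_le_square[of d] sizes unfolding add_divide_distrib[symmetric] by (intro divide_right_mono) auto
  finally show ?thesis .
qed

lemma sum_nsets_2:
  fixes h :: "'a set \<Rightarrow> real"
  assumes "finite V"
  shows "2 * (\<Sum>e\<in>[V]\<^bsup>2\<^esup>. h e) = (\<Sum>u\<in>V. \<Sum>v\<in>V - {u}. h {u, v})"
proof -
  let ?S = "Sigma V (\<lambda>u. V - {u})"
  have "(\<Sum>u\<in>V. \<Sum>v\<in>V - {u}. h {u, v}) = (\<Sum>x\<in>?S. h {fst x, snd x})"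
    using assms by (simp add: sum.Sigma split_def)
  also have "\<dots> = (\<Sum>e\<in>[V]\<^bsup>2\<^esup>. \<Sum>x\<in>{x \<in> ?S. {fst x, snd x} = e}. h {fst x, snd x})"
    using assms by (intro sum.group[symmetric]) auto
  also have "\<dots> = (\<Sum>e\<in>[V]\<^bsup>2\<^esup>. 2 * h e)"
  proof (intro sum.cong refl)
    fix e assume "e \<in> [V]\<^bsup>2\<^esup>"
    then obtain a b where ab: "e = {a, b}" "a \<in> V" "b \<in> V" "a \<noteq> b" by (rule nsets2_E)
    have "{x \<in> ?S. {fst x, snd x} = e} = {(a, b), (b, a)}"
      using ab by (auto simp: doubleton_eq_iff)
    then show "(\<Sum>x\<in>{x \<in> ?S. {fst x, snd x} = e}. h {fst x, snd x}) = 2 * h e"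
      using ab by (simp add: insert_commute)
  qed
  finally show ?thesis by (simp add: sum_distrib_left)
qed

lemma sum_nsets_2_prod:
  fixes h :: "'a \<Rightarrow> real"
  assumes "finite V"
  shows "2 * (\<Sum>e\<in>[V]\<^bsup>2\<^esup>. \<Prod>v\<in>e. h v) = (\<Sum>v\<in>V. h v)\<^sup>2 - (\<Sum>v\<in>V. (h v)\<^sup>2)"
proof -
  have "2 * (\<Sum>e\<in>[V]\<^bsup>2\<^esup>. \<Prod>v\<in>e. h v) = (\<Sum>u\<in>V. \<Sum>v\<in>V - {u}. h u * h v)"
    unfolding sum_nsets_2[OF assms] by (intro sum.cong) auto
  also have "\<dots> = (\<Sum>u\<in>V. h u * (\<Sum>v\<in>V. h v) - (h u)\<^sup>2)"
    using assms by (intro sum.cong refl)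
      (simp add: sum_diff1 right_diff_distrib power2_eq_square flip: sum_distrib_left)
  also have "\<dots> = (\<Sum>v\<in>V. h v)\<^sup>2 - (\<Sum>v\<in>V. (h v)\<^sup>2)"
    by (simp add: sum_subtractf power2_eq_square flip: sum_distrib_right)
  finally show ?thesis .
qed

lemma defect_rate_nonneg: "defect_rate V X r e \<ge> 0"
  by (simp add: defect_rate_def copy_choices_nonneg less_imp_le matching_count_pos)

lemma defect_rate_loop:
  assumes "even (half_edges V r)" "half_edges V r \<ge> 2"
  shows "defect_rate V X r {v} = real (r v choose 2) / (real (half_edges V r) - 1)"
  using matching_count_ratio[OF assms] copy_choices_loop[of v r]
  by (simp add: defect_rate_def defect_size_def)

lemma defect_rate_forbidden:
  assumes "even (half_edges V r)" "half_edges V r \<ge> 2" "e \<in> [V]\<^bsup>2\<^esup>" "e \<in> X"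
  shows "defect_rate V X r e = (\<Prod>v\<in>e. real (r v)) / (real (half_edges V r) - 1)"
proof -
  obtain u v where "e = {u, v}" "u \<noteq> v" using assms(3) by (rule nsets2_E)
  then show ?thesis using matching_count_ratio[OF assms(1,2)] copy_choices_pair[of u v r] assms(4)
    by (simp add: defect_rate_def defect_size_def)
qed

lemma defect_rate_double:
  assumes "even (half_edges V r)" "half_edges V r \<ge> 4" "e \<in> [V]\<^bsup>2\<^esup>" "e \<notin> X"
  shows "defect_rate V X r e =
    2 * (\<Prod>v\<in>e. real (r v choose 2)) / ((real (half_edges V r) - 1) * (real (half_edges V r) - 3))"
proof -
  obtain u v where "e = {u, v}" "u \<noteq> v" using assms(3) by (rule nsets2_E)
  then show ?thesis using matching_count_ratio_4[OF assms(1,2)] copy_choices_double_pair[of u v r] assms(4)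
    by (simp add: defect_rate_def defect_size_def)
qed

definition excluded_doubles :: "'a set \<Rightarrow> 'a set set \<Rightarrow> ('a \<Rightarrow> nat) \<Rightarrow> real" where
  "excluded_doubles V X r =
     (\<Sum>v\<in>V. (real (r v choose 2))\<^sup>2) + 2 * (\<Sum>e\<in>X. \<Prod>v\<in>e. real (r v choose 2))"

lemma sum_defect_rate:
  assumes V: "finite V" and X: "X \<subseteq> [V]\<^bsup>2\<^esup>" and even: "even (half_edges V r)" and N: "half_edges V r \<ge> 4"
  shows "(\<Sum>e\<in>multigraph_edges V. defect_rate V X r e) =
    (loop_choices V r + edge_choices X r) / (real (half_edges V r) - 1) +
    ((loop_choices V r)\<^sup>2 - excluded_doubles V X r) /
      ((real (half_edges V r) - 1) * (real (half_edges V r) - 3))"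
proof -
  let ?N = "real (half_edges V r)" and ?c = "\<lambda>v. real (r v choose 2)"
  have ge_2: "half_edges V r \<ge> 2" using N by simp
  have loops: "(\<Sum>e\<in>[V]\<^bsup>1\<^esup>. defect_rate V X r e) = loop_choices V r / (?N - 1)"
    using defect_rate_loop[OF even ge_2, of X]
    by (simp add: nsets_one loop_choices_def sum.reindex sum_divide_distrib)
  have forbidden: "(\<Sum>e\<in>X. defect_rate V X r e) = edge_choices X r / (?N - 1)"
    unfolding edge_choices_def sum_divide_distrib
    using X by (intro sum.cong refl defect_rate_forbidden[OF even ge_2]) auto
  have "(\<Sum>e\<in>[V]\<^bsup>2\<^esup> - X. defect_rate V X r e) = 2 * (\<Sum>e\<in>[V]\<^bsup>2\<^esup> - X. \<Prod>v\<in>e. ?c v) / ((?N - 1) * (?N - 3))"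
    unfolding sum_distrib_left sum_divide_distrib
    by (intro sum.cong refl defect_rate_double[OF even N]) auto
  also have "2 * (\<Sum>e\<in>[V]\<^bsup>2\<^esup> - X. \<Prod>v\<in>e. ?c v) =
      (loop_choices V r)\<^sup>2 - excluded_doubles V X r"
    using sum_nsets_2_prod[OF V, of ?c] X V
    by (simp add: sum_diff right_diff_distrib loop_choices_def excluded_doubles_def)
  finally have doubles: "(\<Sum>e\<in>[V]\<^bsup>2\<^esup> - X. defect_rate V X r e) =
      ((loop_choices V r)\<^sup>2 - excluded_doubles V X r) / ((?N - 1) * (?N - 3))" .
  have "[V]\<^bsup>1\<^esup> \<inter> [V]\<^bsup>2\<^esup> = {}" by (auto simp: nsets_def)
  then have "(\<Sum>e\<in>multigraph_edges V. defect_rate V X r e) =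
      (\<Sum>e\<in>[V]\<^bsup>1\<^esup>. defect_rate V X r e) + (\<Sum>e\<in>[V]\<^bsup>2\<^esup>. defect_rate V X r e)"
    using V unfolding multigraph_edges_def by (intro sum.union_disjoint) auto
  also have "(\<Sum>e\<in>[V]\<^bsup>2\<^esup>. defect_rate V X r e) =
      (\<Sum>e\<in>[V]\<^bsup>2\<^esup> - X. defect_rate V X r e) + (\<Sum>e\<in>X. defect_rate V X r e)"
    using V by (intro sum.subset_diff[OF X]) simp
  finally show ?thesis unfolding loops forbidden doubles add_divide_distrib by linarith
qed

lemma sum_choose_two_square_le:
  assumes "\<forall>v\<in>V. r v \<le> d"
  shows "(\<Sum>v\<in>V. (real (r v choose 2))\<^sup>2) \<le> real d ^ 3 * real (half_edges V r)"
proof -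
  have "(real (r v choose 2))\<^sup>2 \<le> real d ^ 3 * real (r v)" if "v \<in> V" for v
  proof -
    have c: "real (r v choose 2) \<le> real d * real (r v)" using assms that by (intro choose_two_le) auto
    moreover have "real d * real (r v) \<le> real d * real d" using assms that by (intro mult_left_mono) auto
    ultimately have "real (r v choose 2) \<le> real d * real d" by (rule order_trans)
    from mult_mono[OF this c] show ?thesis by (simp add: power2_eq_square power3_eq_cube)
  qed
  then show ?thesis unfolding half_edges_def of_nat_sum sum_distrib_left by (rule sum_mono)
qed

lemma sum_prod_choose_two_le:
  assumes X: "X \<subseteq> [V]\<^bsup>2\<^esup>" and r: "\<forall>v\<in>V. r v \<le> d"
  shows "(\<Sum>e\<in>X. \<Prod>v\<in>e. real (r v choose 2)) \<le> real d ^ 2 * edge_choices X r"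
proof -
  have "(\<Prod>v\<in>e. real (r v choose 2)) \<le> real d ^ 2 * (\<Prod>v\<in>e. real (r v))" if "e \<in> X" for e
  proof -
    obtain u v where uv: "e = {u, v}" "u \<noteq> v" and e: "e \<subseteq> V"
      using subset_nsets_2E[OF X \<open>e \<in> X\<close>] by (metis empty_subsetI insert_subset)
    have "(\<Prod>v\<in>e. real (r v choose 2)) \<le> (\<Prod>v\<in>e. real d * real (r v))"
      by (intro prod_mono conjI choose_two_le of_nat_0_le_iff) (use r e in blast)
    then show ?thesis unfolding prod.distrib using uv by (simp add: power2_eq_square)
  qed
  then show ?thesis unfolding edge_choices_def sum_distrib_left by (rule sum_mono)
qed

lemma falling_ratio_bounds:
  fixes n :: real
  assumes n: "n \<ge> 16"
  shows "1 \<le> n\<^sup>2 / ((n - 1) * (n - 3))" "n\<^sup>2 / ((n - 1) * (n - 3)) \<le> 1 + 8 / n"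
proof -
  define p where "p = (n - 1) * (n - 3)"
  have square: "n\<^sup>2 = p + (4 * n - 3)" by (simp add: p_def power2_eq_square algebra_simps)
  have "16 * n \<le> n\<^sup>2" using n by (simp add: power2_eq_square mult_right_mono)
  then have p: "n\<^sup>2 / 2 \<le> p" "p > 0" using n square by auto
  have ratio: "n\<^sup>2 / p = 1 + (4 * n - 3) / p" using p(2) by (simp add: square add_divide_distrib)
  have "(4 * n - 3) / p \<le> 4 * n / (n\<^sup>2 / 2)" using n p by (intro frac_le) auto
  also have "\<dots> = 8 / n" using n by (simp add: power2_eq_square)
  finally have "(4 * n - 3) / p \<le> 8 / n" .
  moreover have "0 \<le> (4 * n - 3) / p" using n p by simp
  ultimately show "1 \<le> n\<^sup>2 / ((n - 1) * (n - 3))" "n\<^sup>2 / ((n - 1) * (n - 3)) \<le> 1 + 8 / n"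
    unfolding p_def[symmetric] ratio by auto
qed

lemma excluded_doubles_bounds:
  assumes adm: "admissible d V X r"
  shows "0 \<le> excluded_doubles V X r" "excluded_doubles V X r \<le> 3 * real d ^ 4 * real (half_edges V r)"
proof -
  let ?n = "real (half_edges V r)"
  have V: "finite V" and X: "X \<subseteq> [V]\<^bsup>2\<^esup>" "\<forall>v\<in>V. graph_degree X v \<le> d" and r: "\<forall>v\<in>V. r v \<le> d"
    using adm by (auto simp: admissible_def)
  show "0 \<le> excluded_doubles V X r"
    unfolding excluded_doubles_def by (intro add_nonneg_nonneg sum_nonneg mult_nonneg_nonneg prod_nonneg) auto
  have "(\<Sum>e\<in>X. \<Prod>v\<in>e. real (r v choose 2)) \<le> real d ^ 2 * (real d ^ 2 * ?n)"
    using sum_prod_choose_two_le[OF X(1) r] edge_choices_bounds(2)[OF V X r]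
    by (meson mult_left_mono order_trans zero_le_power2)
  moreover have "real d ^ 3 * ?n \<le> real d ^ 4 * ?n"
    by (intro mult_right_mono real_power_le_power) auto
  ultimately show "excluded_doubles V X r \<le> 3 * real d ^ 4 * ?n"
    using sum_choose_two_square_le[OF r] by (simp add: excluded_doubles_def power2_eq_square power4_eq_xxxx)
qed

lemma sum_defect_rate_eq_means:
  fixes V X r defines "n \<equiv> real (half_edges V r)"
  assumes "finite V" "X \<subseteq> [V]\<^bsup>2\<^esup>" "even (half_edges V r)" "half_edges V r \<ge> 4"
  shows "(\<Sum>e\<in>multigraph_edges V. defect_rate V X r e) = n / (n - 1) * (loop_mean V r + edge_mean V X r) +
    n\<^sup>2 / ((n - 1) * (n - 3)) * ((loop_mean V r)\<^sup>2 - excluded_doubles V X r / n\<^sup>2)"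
proof -
  have "n > 0" using assms(5) by (simp add: n_def)
  then have "(L + K) / p + (M - Q) / q = n / p * (L / n + K / n) + n\<^sup>2 / q * (M / n\<^sup>2 - Q / n\<^sup>2)" for L K M Q p q
    by (simp add: add_divide_distrib diff_divide_distrib distrib_left right_diff_distrib)
  then show ?thesis
    unfolding sum_defect_rate[OF assms(2-)] loop_mean_def edge_mean_def n_def[symmetric] power_divide .
qed

lemma sum_defect_rate_dist_le:
  assumes adm: "admissible d V X r" and N: "half_edges V r \<ge> 16"
  shows "\<bar>(\<Sum>e\<in>multigraph_edges V. defect_rate V X r e) - defect_mean V X r\<bar> \<le>
    18 * real d ^ 4 / real (half_edges V r)"
proof -
  define n where "n = real (half_edges V r)"
  define q where "q = excluded_doubles V X r / n\<^sup>2"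
  define a b where "a = n / (n - 1)" and "b = n\<^sup>2 / ((n - 1) * (n - 3))"
  let ?l = "loop_mean V r" and ?k = "edge_mean V X r" and ?u = "real d ^ 4 / n"
  have V: "finite V" and X: "X \<subseteq> [V]\<^bsup>2\<^esup>" "\<forall>v\<in>V. graph_degree X v \<le> d" and r: "\<forall>v\<in>V. r v \<le> d"
    using adm by (auto simp: admissible_def)
  have n: "n \<ge> 16" using N by (simp add: n_def)
  have l: "0 \<le> ?l" "?l \<le> real d" and k: "0 \<le> ?k" "?k \<le> real d ^ 2"
    using loop_mean_bounds[OF r] edge_mean_bounds[OF V X r] by auto
  have a: "1 \<le> a" "a - 1 \<le> 2 / n" using n by (simp_all add: a_def field_simps)
  have b: "1 \<le> b" "b - 1 \<le> 8 / n" using falling_ratio_bounds[OF n] by (auto simp: b_def)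
  have q: "0 \<le> q" "q \<le> 3 * ?u"
  proof -
    show "0 \<le> q" using excluded_doubles_bounds(1)[OF adm] by (simp add: q_def)
    have "q \<le> (3 * real d ^ 4 * n) / n\<^sup>2"
      unfolding q_def using excluded_doubles_bounds(2)[OF adm] by (intro divide_right_mono) (simp_all add: n_def)
    then show "q \<le> 3 * ?u" using n by (simp add: power2_eq_square)
  qed
  have d: "real d \<le> real d ^ 4" "real d ^ 2 \<le> real d ^ 4"
    using real_power_le_power[of 1 4 d] real_power_le_power[of 2 4 d] by simp_all
  have lk: "0 \<le> ?l + ?k" "?l + ?k \<le> 2 * real d ^ 4"
    using l k d by linarith+
  have "?l\<^sup>2 \<le> real d ^ 2" using l by (intro power_mono) auto
  then have l2: "?l\<^sup>2 \<le> real d ^ 4" using d by linarith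
  have "8 / n \<le> 1" using n by simp
  then have b2: "b \<le> 2" using b by linarith
  have "(\<Sum>e\<in>multigraph_edges V. defect_rate V X r e) = a * (?l + ?k) + b * (?l\<^sup>2 - q)"
    unfolding a_def b_def q_def n_def
    using adm N by (intro sum_defect_rate_eq_means[OF V X(1)]) (auto simp: admissible_def)
  then have "(\<Sum>e\<in>multigraph_edges V. defect_rate V X r e) - defect_mean V X r =
      (a - 1) * (?l + ?k) + (b - 1) * ?l\<^sup>2 - b * q"
    by (simp add: defect_mean_def algebra_simps)
  moreover have "0 \<le> (a - 1) * (?l + ?k)" "0 \<le> (b - 1) * ?l\<^sup>2" "0 \<le> b * q"
    using a b q lk by (auto intro!: mult_nonneg_nonneg)
  moreover have "(a - 1) * (?l + ?k) \<le> 2 / n * (2 * real d ^ 4)" using a lk n by (intro mult_mono) auto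
  then have "(a - 1) * (?l + ?k) \<le> 4 * ?u" by simp
  moreover have "(b - 1) * ?l\<^sup>2 \<le> 8 / n * real d ^ 4" using b l2 n by (intro mult_mono) auto
  then have "(b - 1) * ?l\<^sup>2 \<le> 8 * ?u" by simp
  moreover have "b * q \<le> 2 * (3 * ?u)" using b b2 q by (intro mult_mono) auto
  moreover have "0 \<le> ?u" using n by simp
  ultimately have "\<bar>(\<Sum>e\<in>multigraph_edges V. defect_rate V X r e) - defect_mean V X r\<bar> \<le> 18 * ?u"
    unfolding abs_le_iff by linarith
  then show ?thesis by (simp add: n_def)
qed

lemma half_edges_remove_defect:
  assumes V: "finite V" and e: "e \<in> multigraph_edges V" and rate: "defect_rate V X r e \<noteq> 0"
  shows "half_edges V (remove_defect X e r) + 2 * defect_size X e = half_edges V r"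
  unfolding remove_defect_def using rate
  by (intro half_edges_remove_copies[OF V e]) (auto simp: defect_rate_def copy_choices_eq_0_iff[OF e] not_less)

lemma admissible_remove_defect:
  assumes adm: "admissible d V X r" and e: "e \<in> multigraph_edges V" and rate: "defect_rate V X r e \<noteq> 0"
  shows "admissible d V X (remove_defect X e r)"
proof -
  have "finite V" "even (half_edges V r)" using adm by (auto simp: admissible_def)
  then have "even (half_edges V (remove_defect X e r))"
    by (simp flip: half_edges_remove_defect[OF _ e rate])
  moreover have "remove_defect X e r v \<le> d" if "v \<in> V" for v
    using adm that by (auto simp: admissible_def remove_defect_def remove_copies_def intro: le_trans[OF diff_le_self])
  ultimately show ?thesis using adm by (simp add: admissible_def)
qed

lemma exp_minus_dist_le:
  fixes x y :: real
  assumes "0 \<le> x" "0 \<le> y"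
  shows "\<bar>exp (- x) - exp (- y)\<bar> \<le> \<bar>x - y\<bar>"
proof -
  have "norm (exp (- x) - exp (- y)) \<le> 1 * norm (x - y)"
    by (rule field_differentiable_bound[of "{0..}" "\<lambda>x. exp (- x)" "\<lambda>x. - exp (- x)"])
      (use assms in \<open>auto intro!: derivative_eq_intros\<close>)
  then show ?thesis by simp
qed

text \<open>The derivative of the generating function is minus the sum of
  \<open>defect_rate V X r e * defect_gf V X (remove_defect X e r)\<close>, up to a small error. Comparing it with
  the derivative of \<open>exp (- (\<mu> * t))\<close> yields, by induction on the number of half-edges, an error of
  order \<open>exp (2 * A * t) / N\<close>, where \<open>A\<close> bounds the sum of the rates.\<close>

definition poisson_error :: "nat \<Rightarrow> real \<Rightarrow> real" where
  "poisson_error d t = 108 * real d ^ 6 * exp (10 * real d ^ 4 * t)"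

lemma poisson_error_step:
  assumes "0 \<le> t" "t \<le> 1"
  shows "(108 * real d ^ 6 * t + 2 / 3 * poisson_error d t) - 2 / 3 * poisson_error d 0 \<le> poisson_error d t"
proof -
  have start: "poisson_error d 0 = 108 * real d ^ 6" by (simp add: poisson_error_def)
  have "108 * real d ^ 6 * t \<le> 108 * real d ^ 6 * 1" using assms by (intro mult_left_mono) auto
  moreover have "108 * real d ^ 6 * 1 \<le> poisson_error d t"
    unfolding poisson_error_def using assms by (intro mult_left_mono) auto
  ultimately show ?thesis unfolding start by linarith
qed

lemma sum_defect_rate_le:
  assumes adm: "admissible d V X r" and N: "half_edges V r \<ge> 16"
  shows "(\<Sum>e\<in>multigraph_edges V. defect_rate V X r e) \<le> 5 * real d ^ 4"
proof -
  have "18 * real d ^ 4 / real (half_edges V r) \<le> 18 * real d ^ 4 / 16"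
    using N by (intro divide_left_mono) auto
  then show ?thesis
    using sum_defect_rate_dist_le[OF adm N] defect_mean_bounds(2)[OF adm] real_power_le_power[of 2 4 d] by simp
qed

lemma defect_gf_derivative_term_dist_le:
  assumes adm: "admissible d V X r" and e: "e \<in> multigraph_edges V" and rate: "defect_rate V X r e \<noteq> 0"
    and N: "half_edges V r \<ge> 16" and t: "0 \<le> t" "t \<le> 1"
    and IH: "\<bar>defect_gf V X (remove_defect X e r) t - exp (- (defect_mean V X (remove_defect X e r) * t))\<bar> \<le>
      c / real (half_edges V (remove_defect X e r))" and c: "0 \<le> c"
  shows "\<bar>pairing_mean V (remove_defect X e r) (\<lambda>m. (1 - t) ^ (defects V X (add_defect X e m) - 1)) -
      exp (- (defect_mean V X r * t))\<bar> \<le> (18 * real d ^ 2 + 4 / 3 * c) / real (half_edges V r)"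
proof -
  define s where "s = remove_defect X e r"
  define N N' where "N = real (half_edges V r)" and "N' = real (half_edges V s)"
  have adm': "admissible d V X s" unfolding s_def by (rule admissible_remove_defect[OF adm e rate])
  have V: "finite V" and s: "\<forall>v\<in>V. s v \<le> d" "even (half_edges V s)" using adm' by (auto simp: admissible_def)
  have few_removed: "half_edges V r \<le> half_edges V s + 4"
    using half_edges_remove_defect[OF V e rate] by (simp add: s_def defect_size_def split: if_splits)
  then have N: "16 \<le> N" "N \<le> N' + 4" using assms(4) by (auto simp: N_def N'_def)
  have "\<bar>pairing_mean V s (\<lambda>m. (1 - t) ^ (defects V X (add_defect X e m) - 1)) - defect_gf V X s t\<bar> \<le>
      real d ^ 2 / (N' - 1)"
    unfolding N'_def by (rule defect_gf_add_defect_dist_le[OF V e s(2) _ s(1) t]) (use few_removed assms(4) in linarith)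
  also have "\<dots> \<le> real d ^ 2 / (N / 2)" using N by (intro divide_left_mono) auto
  finally have shift: "\<bar>pairing_mean V s (\<lambda>m. (1 - t) ^ (defects V X (add_defect X e m) - 1)) - defect_gf V X s t\<bar> \<le>
      2 * real d ^ 2 / N" by (simp add: mult.commute)
  have "c / N' \<le> c / (3 / 4 * N)" using N c by (intro divide_left_mono) auto
  then have poisson: "\<bar>defect_gf V X s t - exp (- (defect_mean V X s * t))\<bar> \<le> 4 / 3 * c / N"
    using IH unfolding s_def[symmetric] N'_def[symmetric] by simp
  have "\<bar>exp (- (defect_mean V X s * t)) - exp (- (defect_mean V X r * t))\<bar> \<le> \<bar>defect_mean V X s * t - defect_mean V X r * t\<bar>"
    using defect_mean_bounds(1)[OF adm'] defect_mean_bounds(1)[OF adm] t by (intro exp_minus_dist_le) auto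
  also have "\<dots> = \<bar>defect_mean V X r - defect_mean V X s\<bar> * t"
    using t by (simp add: abs_mult abs_minus_commute flip: left_diff_distrib)
  also have "\<dots> \<le> (16 * real d ^ 2 / N) * 1"
    unfolding N_def using few_removed t assms(4)
    by (intro mult_mono defect_mean_dist_le[OF adm]) (auto simp: s_def remove_defect_def remove_copies_def)
  finally have mean: "\<bar>exp (- (defect_mean V X s * t)) - exp (- (defect_mean V X r * t))\<bar> \<le> 16 * real d ^ 2 / N" by simp
  have "\<bar>pairing_mean V s (\<lambda>m. (1 - t) ^ (defects V X (add_defect X e m) - 1)) - exp (- (defect_mean V X r * t))\<bar> \<le>
      2 * real d ^ 2 / N + 4 / 3 * c / N + 16 * real d ^ 2 / N"
    using shift poisson mean by linarith
  also have "\<dots> = (18 * real d ^ 2 + 4 / 3 * c) / N" by (simp add: add_divide_distrib)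
  finally show ?thesis unfolding s_def N_def .
qed

lemma abs_sum_rates_diff_le:
  fixes p g :: "'b \<Rightarrow> real"
  assumes p: "\<And>e. e \<in> E \<Longrightarrow> 0 \<le> p e" and g: "\<And>e. e \<in> E \<Longrightarrow> p e \<noteq> 0 \<Longrightarrow> \<bar>g e - y\<bar> \<le> b"
    and sum: "sum p E \<le> A" "\<bar>sum p E - \<mu>\<bar> \<le> \<delta>" and y: "\<bar>y\<bar> \<le> 1" and b: "0 \<le> b"
  shows "\<bar>(\<Sum>e\<in>E. p e * g e) - \<mu> * y\<bar> \<le> A * b + \<delta>"
proof -
  have "(\<Sum>e\<in>E. p e * g e) - \<mu> * y = (\<Sum>e\<in>E. p e * (g e - y)) + (sum p E - \<mu>) * y"
    by (simp add: right_diff_distrib left_diff_distrib sum_subtractf sum_distrib_right)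
  moreover have "\<bar>\<Sum>e\<in>E. p e * (g e - y)\<bar> \<le> A * b"
  proof -
    have "\<bar>\<Sum>e\<in>E. p e * (g e - y)\<bar> \<le> (\<Sum>e\<in>E. p e * b)"
    proof (rule order_trans[OF sum_abs sum_mono])
      fix e assume e: "e \<in> E"
      then show "\<bar>p e * (g e - y)\<bar> \<le> p e * b"
        using p g by (cases "p e = 0") (auto simp: abs_mult intro: mult_left_mono)
    qed
    also have "\<dots> \<le> A * b" unfolding sum_distrib_right[symmetric] using sum b by (intro mult_right_mono)
    finally show ?thesis .
  qed
  moreover have "\<bar>(sum p E - \<mu>) * y\<bar> \<le> \<delta> * 1"
    unfolding abs_mult using sum y by (intro mult_mono) auto
  ultimately show ?thesis by linarith
qed

lemma defect_gf_derivative_dist_le: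
  assumes adm: "admissible d V X r" and N: "half_edges V r \<ge> 16" and t: "0 \<le> t" "t \<le> 1" and c: "0 \<le> c"
    and IH: "\<And>e. e \<in> multigraph_edges V \<Longrightarrow> defect_rate V X r e \<noteq> 0 \<Longrightarrow>
      \<bar>defect_gf V X (remove_defect X e r) t - exp (- (defect_mean V X (remove_defect X e r) * t))\<bar> \<le>
        c / real (half_edges V (remove_defect X e r))"
  shows "\<bar>(\<Sum>e\<in>multigraph_edges V. defect_rate V X r e *
      pairing_mean V (remove_defect X e r) (\<lambda>m. (1 - t) ^ (defects V X (add_defect X e m) - 1))) -
      defect_mean V X r * exp (- (defect_mean V X r * t))\<bar> \<le>
    (108 * real d ^ 6 + 2 / 3 * (10 * real d ^ 4 * c)) / real (half_edges V r)"
proof -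
  let ?n = "real (half_edges V r)"
  have n: "?n > 0" using N by simp
  have "\<bar>(\<Sum>e\<in>multigraph_edges V. defect_rate V X r e *
      pairing_mean V (remove_defect X e r) (\<lambda>m. (1 - t) ^ (defects V X (add_defect X e m) - 1))) -
      defect_mean V X r * exp (- (defect_mean V X r * t))\<bar> \<le>
    5 * real d ^ 4 * ((18 * real d ^ 2 + 4 / 3 * c) / ?n) + 18 * real d ^ 4 / ?n"
    using defect_mean_bounds[OF adm] t c n
    by (intro abs_sum_rates_diff_le defect_rate_nonneg sum_defect_rate_le[OF adm N] sum_defect_rate_dist_le[OF adm N]
      defect_gf_derivative_term_dist_le[OF adm _ _ N t IH c]) auto
  also have "\<dots> = (90 * real d ^ 6 + 18 * real d ^ 4 + 2 / 3 * (10 * real d ^ 4 * c)) / ?n"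
    using n by (simp add: add_divide_distrib distrib_left flip: power_add)
  also have "\<dots> \<le> (108 * real d ^ 6 + 2 / 3 * (10 * real d ^ 4 * c)) / ?n"
    using real_power_le_power[of 4 6 d] n by (intro divide_right_mono) auto
  finally show ?thesis .
qed

lemma defect_gf_poisson_step:
  assumes adm: "admissible d V X r" and N: "half_edges V r \<ge> 16" and t: "0 \<le> t" "t \<le> 1"
    and IH: "\<And>r' s. admissible d V X r' \<Longrightarrow> half_edges V r' < half_edges V r \<Longrightarrow> 0 < half_edges V r' \<Longrightarrow>
      0 \<le> s \<Longrightarrow> s \<le> 1 \<Longrightarrow>
      \<bar>defect_gf V X r' s - exp (- (defect_mean V X r' * s))\<bar> \<le> poisson_error d s / real (half_edges V r')"
  shows "\<bar>defect_gf V X r t - exp (- (defect_mean V X r * t))\<bar> \<le> poisson_error d t / real (half_edges V r)"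
proof (cases "t = 0")
  case True
  then show ?thesis using adm by (simp add: admissible_def defect_gf_0 poisson_error_def)
next
  case False
  define n where "n = real (half_edges V r)"
  define \<mu> where "\<mu> = defect_mean V X r"
  define err where "err s = defect_gf V X r s - exp (- (\<mu> * s))" for s
  define err' where "err' s = - (\<Sum>e\<in>multigraph_edges V. defect_rate V X r e *
    pairing_mean V (remove_defect X e r) (\<lambda>m. (1 - s) ^ (defects V X (add_defect X e m) - 1))) + \<mu> * exp (- (\<mu> * s))" for s
  define bound where "bound s = (108 * real d ^ 6 * s + 2 / 3 * poisson_error d s) / n" for s
  define bound' where "bound' s = (108 * real d ^ 6 + 2 / 3 * (10 * real d ^ 4 * poisson_error d s)) / n" for s
  have V: "finite V" and even: "even (half_edges V r)" using adm by (auto simp: admissible_def)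
  have n: "n \<ge> 16" using N by (simp add: n_def)
  have err: "(err has_real_derivative err' s) (at s)" for s
    unfolding err_def[abs_def] err'_def
    by (rule derivative_eq_intros defect_gf_has_real_derivative[OF V even] refl)+ simp
  have bound: "(bound has_real_derivative bound' s) (at s)" for s
    unfolding bound_def[abs_def] bound'_def poisson_error_def[abs_def]
    using n by (auto intro!: derivative_eq_intros simp: mult_ac)
  have "\<bar>err' s\<bar> \<le> bound' s" if s: "0 \<le> s" "s \<le> 1" for s
  proof -
    have "\<bar>defect_gf V X (remove_defect X e r) s - exp (- (defect_mean V X (remove_defect X e r) * s))\<bar> \<le>
        poisson_error d s / real (half_edges V (remove_defect X e r))"
      if e: "e \<in> multigraph_edges V" "defect_rate V X r e \<noteq> 0" for e
      using half_edges_remove_defect[OF V e] N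
      by (intro IH admissible_remove_defect[OF adm e] s) (auto simp: defect_size_def split: if_splits)
    from defect_gf_derivative_dist_le[OF adm N s _ this] show ?thesis
      by (simp add: err'_def bound'_def n_def \<mu>_def poisson_error_def)
  qed
  then have "norm (err t - err 0) \<le> bound t - bound 0"
    using t False
    by (intro differentiable_bound_general[where f' = err' and \<phi>' = bound'] DERIV_continuous_on)
      (auto simp: has_real_derivative_iff_has_vector_derivative[symmetric] intro: err bound has_field_derivative_at_within)
  moreover have "err 0 = 0" using V even by (simp add: err_def defect_gf_0)
  moreover have "bound t - bound 0 \<le> poisson_error d t / n"
    unfolding bound_def diff_divide_distrib[symmetric]
    using poisson_error_step[OF t, of d] n by (intro divide_right_mono) simp_all
  ultimately show ?thesis by (simp add: err_def \<mu>_def n_def)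
qed

lemma defect_gf_poisson:
  assumes "admissible d V X r" "half_edges V r > 0" "0 \<le> t" "t \<le> 1"
  shows "\<bar>defect_gf V X r t - exp (- (defect_mean V X r * t))\<bar> \<le> poisson_error d t / real (half_edges V r)"
  using assms
proof (induction "half_edges V r" arbitrary: r t rule: less_induct)
  case less
  have V: "finite V" "even (half_edges V r)" and r: "\<forall>v\<in>V. r v \<le> d"
    using less.prems(1) by (auto simp: admissible_def)
  show ?case
  proof (cases "half_edges V r \<ge> 16")
    case True
    then show ?thesis using less by (intro defect_gf_poisson_step[OF less.prems(1)]) auto
  next
    case False
    obtain v where "v \<in> V" "r v > 0" using less.prems(2) by (metis gr0I half_edges_def less_irrefl sum.neutral)
    then have "d \<ge> 1" using r by force
    then have "108 * 1 * 1 \<le> poisson_error d t"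
      unfolding poisson_error_def using less.prems(3) by (intro mult_mono one_le_power) auto
    then have "real (half_edges V r) \<le> poisson_error d t" using False by simp
    then have "1 \<le> poisson_error d t / real (half_edges V r)" using less.prems(2) by (simp add: le_divide_eq_1)
    moreover have "exp (- (defect_mean V X r * t)) \<le> 1"
      using defect_mean_bounds(1)[OF less.prems(1)] less.prems(3) by simp
    moreover have "0 \<le> exp (- (defect_mean V X r * t))" by simp
    ultimately show ?thesis using defect_gf_bounds[OF V less.prems(3,4), of X] unfolding abs_le_iff by linarith
  qed
qed

definition graphs_avoiding :: "'a set \<Rightarrow> 'a set set \<Rightarrow> ('a \<Rightarrow> nat) \<Rightarrow> 'a set set set" where
  "graphs_avoiding V X r = {E \<in> simple_graphs V. E \<inter> X = {} \<and> (\<forall>v\<in>V. graph_degree E v = r v)}"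

lemma simple_graphs_eq_Pow: "simple_graphs V = Pow ([V]\<^bsup>2\<^esup>)"
proof -
  have "[V]\<^bsup>2\<^esup> = {e. e \<subseteq> V \<and> card e = 2}" by (auto simp: nsets_def intro: card_ge_0_finite)
  then show ?thesis by (auto simp: simple_graphs_def)
qed

lemma defects_eq_0_iff:
  assumes "finite V"
  shows "defects V X m = 0 \<longleftrightarrow> (\<forall>e\<in>multigraph_edges V. m e < defect_size X e)"
  using assms by (auto simp: defects_def binomial_eq_0_iff)

lemma sum_incidence_simple_graph:
  assumes V: "finite V" and E: "E \<subseteq> [V]\<^bsup>2\<^esup>"
  shows "(\<Sum>e\<in>multigraph_edges V. incidence e v * of_bool (e \<in> E)) = graph_degree E v"
proof -
  have "(\<Sum>e\<in>multigraph_edges V. incidence e v * of_bool (e \<in> E)) = (\<Sum>e\<in>{e \<in> E. v \<in> e}. 1)"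
    using V E by (intro sum.mono_neutral_cong_right) (auto simp: multigraph_edges_def incidence_def nsets_def)
  then show ?thesis by (simp add: graph_degree_def)
qed

lemma bij_betw_graphs_avoiding_multigraphs:
  assumes V: "finite V"
  shows "bij_betw (\<lambda>E e. of_bool (e \<in> E)) (graphs_avoiding V X r) {m \<in> multigraphs V r. defects V X m = 0}"
proof (rule bij_betw_byWitness[where f' = "\<lambda>m. {e. m e = 1}"])
  let ?G = "graphs_avoiding V X r" and ?M = "{m \<in> multigraphs V r. defects V X m = 0}"
  have binary: "m e = of_bool (m e = 1)" if "m \<in> ?M" for m e
  proof (cases "e \<in> multigraph_edges V")
    case True
    then have "m e < 2" using that by (force simp: defects_eq_0_iff[OF V] defect_size_def split: if_splits)
    then show ?thesis by (auto simp: less_2_cases_iff)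
  qed (use that in \<open>simp add: multigraphs_def\<close>)
  show "\<forall>E\<in>?G. {e. of_bool (e \<in> E) = (1::nat)} = E" by auto
  show "\<forall>m\<in>?M. (\<lambda>e. of_bool (e \<in> {e. m e = 1})) = m"
    using binary by (auto simp: fun_eq_iff)
  show "(\<lambda>E e. of_bool (e \<in> E)) ` ?G \<subseteq> ?M"
  proof clarify
    fix E assume "E \<in> ?G"
    then have E: "E \<subseteq> [V]\<^bsup>2\<^esup>" "E \<inter> X = {}" "\<forall>v\<in>V. graph_degree E v = r v"
      by (auto simp: graphs_avoiding_def simple_graphs_eq_Pow)
    then have "E \<subseteq> multigraph_edges V" by (auto simp: multigraph_edges_def)
    moreover have "of_bool (e \<in> E) < defect_size X e" for e
      using E by (auto simp: defect_size_def nsets_def)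
    ultimately show "(\<lambda>e. of_bool (e \<in> E)) \<in> multigraphs V r \<and> defects V X (\<lambda>e. of_bool (e \<in> E)) = 0"
      using E by (auto simp: multigraphs_def sum_incidence_simple_graph[OF V E(1)] defects_eq_0_iff[OF V])
  qed
  show "(\<lambda>m. {e. m e = 1}) ` ?M \<subseteq> ?G"
  proof clarify
    fix m assume m: "m \<in> multigraphs V r" "defects V X m = 0"
    let ?E = "{e. m e = 1}"
    have edge: "e \<in> multigraph_edges V \<and> card e \<noteq> 1 \<and> e \<notin> X" if "m e = 1" for e
      using m that by (force simp: multigraphs_def defects_eq_0_iff[OF V] defect_size_def split: if_splits)
    then have E: "?E \<subseteq> [V]\<^bsup>2\<^esup>"
      by (auto simp: multigraph_edges_def nsets_def)
    have "m e = of_bool (e \<in> ?E)" for e using binary[of m e] m by simp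
    then have "graph_degree ?E v = r v" if "v \<in> V" for v
      using m(1) that sum_incidence_simple_graph[OF V E, of v] by (simp add: multigraphs_def)
    moreover have "?E \<inter> X = {}" using edge by auto
    ultimately show "?E \<in> ?G" using E by (simp add: graphs_avoiding_def simple_graphs_eq_Pow)
  qed
qed

lemma pairing_weight_no_defects:
  assumes V: "finite V" and "defects V X m = 0"
  shows "pairing_weight V r m = (\<Prod>v\<in>V. fact (r v))"
proof -
  have "(2 / real (card e)) ^ m e * fact (m e) = 1" if e: "e \<in> multigraph_edges V" for e
  proof -
    have "m e < defect_size X e" using assms e by (simp add: defects_eq_0_iff)
    then have "m e = 0 \<or> (m e = 1 \<and> card e \<noteq> 1)" by (auto simp: defect_size_def less_2_cases_iff split: if_splits)
    then show ?thesis using e by (auto simp: multigraph_edges_def nsets_def)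
  qed
  then show ?thesis by (simp add: pairing_weight_def)
qed

lemma card_graphs_avoiding:
  assumes V: "finite V" and even: "even (half_edges V r)"
  shows "real (card (graphs_avoiding V X r)) =
    matching_count (half_edges V r) / (\<Prod>v\<in>V. fact (r v)) * defect_gf V X r 1"
proof -
  let ?M = "{m \<in> multigraphs V r. defects V X m = 0}"
  have "matching_count (half_edges V r) * defect_gf V X r 1 =
      (\<Sum>m\<in>multigraphs V r. pairing_weight V r m * 0 ^ defects V X m)"
    using matching_count_pos[of "half_edges V r"]
    by (simp add: defect_gf_def pairing_mean_def weighted_mean_def sum_pairing_weight[OF V even])
  also have "\<dots> = (\<Sum>m\<in>?M. \<Prod>v\<in>V. fact (r v))"
    using V by (intro sum.mono_neutral_cong_right) (auto simp: pairing_weight_no_defects)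
  also have "\<dots> = real (card (graphs_avoiding V X r)) * (\<Prod>v\<in>V. fact (r v))"
    using bij_betw_same_card[OF bij_betw_graphs_avoiding_multigraphs[OF V, of X r]] by simp
  finally show ?thesis using V by (simp add: nonzero_eq_divide_eq)
qed

section \<open>Trees with given degrees\<close>

abbreviation adjacency :: "'a set set \<Rightarrow> ('a \<times> 'a) set" where
  "adjacency E \<equiv> {(x, y). {x, y} \<in> E}"

lemma graph_cycle_of_chord:
  assumes path: "distinct vs" "successively (\<lambda>x y. {x, y} \<in> E) vs"
    and chord: "{vs ! 0, vs ! i} \<in> E" "2 \<le> i" "i < length vs"
  shows "graph_cycle E (take (Suc i) vs)"
  unfolding graph_cycle_def
proof (intro conjI allI impI)
  fix j assume "j < length (take (Suc i) vs)"
  then consider "j = i" | "j < i" using chord by fastforce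
  then show "{take (Suc i) vs ! j, take (Suc i) vs ! (Suc j mod length (take (Suc i) vs))} \<in> E"
  proof cases
    case 1
    then show ?thesis using chord by (simp add: insert_commute)
  next
    case 2
    then show ?thesis using path(2) chord(3) by (simp add: successively_conv_nth)
  qed
qed (use path chord in auto)

lemma ex_other_neighbour:
  assumes E: "E \<subseteq> [V]\<^bsup>2\<^esup>" and deg: "graph_degree E x \<ge> 2"
  obtains y where "{x, y} \<in> E" "y \<in> V" "y \<noteq> x" "y \<noteq> z"
proof -
  have "\<not> {e \<in> E. x \<in> e} \<subseteq> {{x, z}}"
    using deg card_mono[of "{{x, z}}" "{e \<in> E. x \<in> e}"] by (auto simp: graph_degree_def)
  then obtain e where e: "e \<in> E" "x \<in> e" "e \<noteq> {x, z}" by blast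
  obtain a b where ab: "e = {a, b}" "a \<in> V" "b \<in> V" "a \<noteq> b" using E e(1) by (rule subset_nsets_2E)
  consider "x = a" | "x = b" using e(2) ab(1) by auto
  then show ?thesis
  proof cases
    case 1
    then show ?thesis using that[of b] e ab by auto
  next
    case 2
    then show ?thesis using that[of a] e ab by (auto simp: insert_commute)
  qed
qed

lemma min_degree_two_imp_cycle:
  assumes V: "finite V" "V \<noteq> {}" and E: "E \<subseteq> [V]\<^bsup>2\<^esup>" and deg: "\<forall>v\<in>V. graph_degree E v \<ge> 2"
  shows "\<exists>vs. graph_cycle E vs"
proof -
  define path where "path vs \<longleftrightarrow> vs \<noteq> [] \<and> set vs \<subseteq> V \<and> distinct vs \<and> successively (\<lambda>x y. {x, y} \<in> E) vs" for vs
  obtain v where "v \<in> V" using V by auto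
  then have "path [v]" by (simp add: path_def)
  moreover have "\<forall>vs. path vs \<longrightarrow> length vs < Suc (card V)"
    using V by (auto simp: path_def less_Suc_eq_le distinct_card[symmetric] intro: card_mono)
  ultimately obtain vs where vs: "path vs" and longest: "\<And>ws. path ws \<Longrightarrow> length ws \<le> length vs"
    using ex_has_greatest_nat[of path "[v]" length "Suc (card V)"] by blast
  have path: "vs \<noteq> []" "set vs \<subseteq> V" "distinct vs" "successively (\<lambda>x y. {x, y} \<in> E) vs"
    using vs by (auto simp: path_def)
  then have "vs ! 0 \<in> V" by auto
  then obtain y where y: "{vs ! 0, y} \<in> E" "y \<in> V" "y \<noteq> vs ! 0" "y \<noteq> vs ! 1"
    using ex_other_neighbour[OF E] deg by blast
  have "y \<in> set vs"
  proof (rule ccontr)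
    assume "y \<notin> set vs"
    then have "path (y # vs)" using path y by (auto simp: path_def successively_Cons hd_conv_nth insert_commute)
    then show False using longest by fastforce
  qed
  then obtain i where i: "i < length vs" "y = vs ! i" by (auto simp: in_set_conv_nth)
  have "2 \<le> i"
  proof (rule ccontr)
    assume "\<not> 2 \<le> i"
    then have "i = 0 \<or> i = 1" by auto
    then show False using y(3,4) i(2) by blast
  qed
  then show ?thesis using graph_cycle_of_chord[OF path(3,4)] y(1) i by blast
qed

lemma graph_degree_pos_iff:
  assumes "finite E"
  shows "graph_degree E v > 0 \<longleftrightarrow> (\<exists>e\<in>E. v \<in> e)"
  using assms by (auto simp: graph_degree_def card_gt_0_iff)

lemma graph_degree_insert:
  assumes "finite T" "e \<notin> T"
  shows "graph_degree (insert e T) v = graph_degree T v + of_bool (v \<in> e)"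
proof -
  have "{f \<in> insert e T. v \<in> f} = (if v \<in> e then insert e {f \<in> T. v \<in> f} else {f \<in> T. v \<in> f})" by auto
  then show ?thesis using assms by (simp add: graph_degree_def)
qed

lemma graph_tree_subset: "graph_tree V T \<Longrightarrow> T \<subseteq> [V]\<^bsup>2\<^esup>"
  by (simp add: graph_tree_def simple_graphs_eq_Pow)

lemma graph_tree_finite: "finite V \<Longrightarrow> graph_tree V T \<Longrightarrow> finite T"
  using finite_subset[OF graph_tree_subset finite_nsets] by blast

lemma finite_graph_trees: "finite V \<Longrightarrow> finite {T. graph_tree V T}"
  by (rule finite_subset[of _ "Pow ([V]\<^bsup>2\<^esup>)"]) (auto dest: graph_tree_subset)

lemma graph_tree_degree_pos:
  assumes V: "finite V" and T: "graph_tree V T" and card: "card V \<ge> 2" and v: "v \<in> V"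
  shows "graph_degree T v > 0"
proof -
  have "V \<noteq> {v}" using card by auto
  then obtain w where w: "w \<in> V" "w \<noteq> v" using v by blast
  have "(v, w) \<in> (adjacency T)\<^sup>*" using T v w by (auto simp: graph_tree_def graph_connected_def)
  then obtain y where "{v, y} \<in> T" using w(2) by (auto elim: converse_rtranclE)
  then show ?thesis unfolding graph_degree_pos_iff[OF graph_tree_finite[OF V T]] by blast
qed

lemma graph_tree_has_leaf:
  assumes V: "finite V" and T: "graph_tree V T" and card: "card V \<ge> 2"
  obtains v where "v \<in> V" "graph_degree T v = 1"
proof -
  have "V \<noteq> {}" using card by auto
  then have "\<not> (\<forall>v\<in>V. graph_degree T v \<ge> 2)"
    using min_degree_two_imp_cycle[OF V _ graph_tree_subset[OF T]] T by (auto simp: graph_tree_def)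
  then obtain v where v: "v \<in> V" "graph_degree T v < 2" by auto
  then have "graph_degree T v = 1" using graph_tree_degree_pos[OF V T card, of v] by simp
  then show ?thesis using v(1) that by blast
qed

lemma graph_tree_singleton: "graph_tree {a} T \<longleftrightarrow> T = {}"
proof
  assume "graph_tree {a} T"
  then show "T = {}" using graph_tree_subset nsets_2_eq[of "{a}"] by fastforce
next
  assume "T = {}"
  then show "graph_tree {a} T"
    by (auto simp: graph_tree_def graph_connected_def graph_cycle_def simple_graphs_def intro!: exI[of _ 0])
qed

lemma rtrancl_adjacency_insert_leaf:
  assumes T: "T \<subseteq> [V]\<^bsup>2\<^esup>" and v: "v \<notin> V"
    and path: "(x, y) \<in> (adjacency (insert {v, u} T))\<^sup>*" and x: "x \<noteq> v"
  shows "(x, if y = v then u else y) \<in> (adjacency T)\<^sup>*"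
  using path
proof (induction rule: rtrancl_induct)
  case base
  show ?case using x by simp
next
  case (step y z)
  then consider "{y, z} = {v, u}" | "{y, z} \<in> T" "y \<noteq> v" "z \<noteq> v"
    using T v by (auto simp: nsets_def)
  then show ?case
  proof cases
    case 1
    then have same: "(if y = v then u else y) = (if z = v then u else z)" by (auto simp: doubleton_eq_iff)
    show ?thesis using step.IH unfolding same .
  next
    case 2
    then have "(if y = v then u else y, if z = v then u else z) \<in> adjacency T" by simp
    with step.IH show ?thesis by (rule rtrancl_into_rtrancl)
  qed
qed

lemma graph_connected_insert_leaf:
  assumes T: "T \<subseteq> [V]\<^bsup>2\<^esup>" and u: "u \<in> V" and v: "v \<notin> V"
  shows "graph_connected (insert v V) (insert {v, u} T) \<longleftrightarrow> graph_connected V T"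
proof
  let ?T = "insert {v, u} T"
  assume conn: "graph_connected (insert v V) ?T"
  have "(x, y) \<in> (adjacency T)\<^sup>*" if "x \<in> V" "y \<in> V" for x y
  proof -
    have "(x, y) \<in> (adjacency ?T)\<^sup>*" using conn that by (simp add: graph_connected_def)
    moreover have "x \<noteq> v" "y \<noteq> v" using that v by auto
    ultimately show ?thesis using rtrancl_adjacency_insert_leaf[OF T v, of x y u] by simp
  qed
  then show "graph_connected V T" using u by (auto simp: graph_connected_def)
next
  let ?T = "insert {v, u} T"
  assume conn: "graph_connected V T"
  have "sym (adjacency ?T)" by (auto simp: sym_def insert_commute)
  then have sym: "(x, y) \<in> (adjacency ?T)\<^sup>* \<Longrightarrow> (y, x) \<in> (adjacency ?T)\<^sup>*" for x y
    by (metis sym_rtrancl symD)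
  have "adjacency T \<subseteq> adjacency ?T" by auto
  then have mono: "(adjacency T)\<^sup>* \<subseteq> (adjacency ?T)\<^sup>*" by (rule rtrancl_mono)
  have "(x, u) \<in> (adjacency ?T)\<^sup>*" if "x \<in> insert v V" for x
    using that conn u mono by (auto simp: graph_connected_def)
  then show "graph_connected (insert v V) ?T"
    using sym by (auto simp: graph_connected_def intro: rtrancl_trans)
qed

lemma graph_cycle_insert_leaf:
  assumes T: "T \<subseteq> [V]\<^bsup>2\<^esup>" and v: "v \<notin> V"
  shows "graph_cycle (insert {v, u} T) vs \<longleftrightarrow> graph_cycle T vs"
proof
  assume cycle: "graph_cycle (insert {v, u} T) vs"
  define n where "n = length vs"
  have n: "n \<ge> 3" and dist: "distinct vs"
    and edge: "\<And>i. i < n \<Longrightarrow> {vs ! i, vs ! (Suc i mod n)} \<in> insert {v, u} T"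
    using cycle by (auto simp: graph_cycle_def n_def)
  have only: "w = u" if "{v, w} \<in> insert {v, u} T" for w
    using that T v by (auto simp: doubleton_eq_iff nsets_def)
  have "v \<notin> set vs"
  proof
    assume "v \<in> set vs"
    then obtain i where i: "i < n" "vs ! i = v" by (auto simp: in_set_conv_nth n_def)
    define k where "k = Suc i mod n"
    define j where "j = (if i = 0 then n - 1 else i - 1)"
    have jk: "j < n" "k < n" "Suc j mod n = i" "j \<noteq> k"
      using i n by (auto simp: j_def k_def mod_Suc split: if_splits)
    have "vs ! k = u" using only edge[OF i(1)] i by (simp add: k_def)
    moreover have "vs ! j = u" using only edge[OF jk(1)] i by (simp add: jk(3) insert_commute)
    ultimately show False using dist jk by (metis n_def nth_eq_iff_index_eq)
  qed
  moreover have "vs ! i \<in> set vs" "vs ! (Suc i mod n) \<in> set vs" if "i < n" for i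
  proof -
    have "Suc i mod n < n" using that by (intro mod_less_divisor) auto
    then show "vs ! i \<in> set vs" "vs ! (Suc i mod n) \<in> set vs" using that by (auto simp: n_def)
  qed
  ultimately have "{vs ! i, vs ! (Suc i mod n)} \<noteq> {v, u}" if "i < n" for i
    using that by (metis doubleton_eq_iff)
  then show "graph_cycle T vs" using n dist edge by (auto simp: graph_cycle_def n_def)
qed (auto simp: graph_cycle_def)

lemma graph_tree_insert_leaf:
  assumes "T \<subseteq> [V]\<^bsup>2\<^esup>" "u \<in> V" "v \<notin> V"
  shows "graph_tree (insert v V) (insert {v, u} T) \<longleftrightarrow> graph_tree V T"
proof -
  have "insert {v, u} T \<subseteq> [insert v V]\<^bsup>2\<^esup>"
    using assms nsets_mono[of V "insert v V" 2] by auto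
  then show ?thesis
    using assms by (simp add: graph_tree_def simple_graphs_eq_Pow graph_connected_insert_leaf graph_cycle_insert_leaf[of T V])
qed

lemma graph_tree_remove_leaf:
  assumes V: "finite V" and T: "graph_tree V T" and deg: "graph_degree T v = 1" and v: "v \<in> V"
  obtains u where "u \<in> V - {v}" "{v, u} \<in> T" "graph_tree (V - {v}) (T - {{v, u}})"
proof -
  obtain e where e: "{e \<in> T. v \<in> e} = {e}" using deg by (auto simp: graph_degree_def card_1_singleton_iff)
  then have "e \<in> T" "v \<in> e" by auto
  obtain a b where "e = {a, b}" "a \<in> V" "b \<in> V" "a \<noteq> b"
    using graph_tree_subset[OF T] \<open>e \<in> T\<close> by (rule subset_nsets_2E)
  then obtain u where u: "e = {v, u}" "u \<in> V - {v}" using \<open>v \<in> e\<close> by (auto simp: insert_commute)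
  have rest: "T - {{v, u}} \<subseteq> [V - {v}]\<^bsup>2\<^esup>"
    using graph_tree_subset[OF T] e u by (auto simp: nsets_def)
  have "graph_tree (V - {v}) (T - {{v, u}})"
    using graph_tree_insert_leaf[OF rest u(2), of v] T insert_Diff[OF v] insert_Diff[OF \<open>e \<in> T\<close>] u(1) by simp
  then show ?thesis using that u \<open>e \<in> T\<close> by blast
qed

definition trees_with :: "'a set \<Rightarrow> ('a \<Rightarrow> nat) \<Rightarrow> 'a set set \<Rightarrow> 'a set set set" where
  "trees_with V e F = {T. graph_tree V T \<and> F \<subseteq> T \<and> (\<forall>v\<in>V. graph_degree T v = Suc (e v))}"

lemma finite_trees_with: "finite V \<Longrightarrow> finite (trees_with V e F)"
  by (rule finite_subset[OF _ finite_graph_trees]) (auto simp: trees_with_def)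

lemma trees_with_not_subset: "\<not> F \<subseteq> [V]\<^bsup>2\<^esup> \<Longrightarrow> trees_with V e F = {}"
  by (auto simp: trees_with_def dest: graph_tree_subset)

lemma graph_tree_degree_sum:
  assumes "finite V" "graph_tree V T"
  shows "(\<Sum>v\<in>V. graph_degree T v) + 2 = 2 * card V"
  using assms
proof (induction "card V" arbitrary: V T rule: less_induct)
  case less
  have "V \<noteq> {}" using less.prems by (simp add: graph_tree_def graph_connected_def)
  then have "card V > 0" using less.prems(1) by (simp add: card_gt_0_iff)
  then consider "card V = 1" | "card V \<ge> 2" by linarith
  then show ?case
  proof cases
    case 1
    then obtain a where "V = {a}" by (rule card_1_singletonE)
    then show ?thesis using less.prems(2) by (simp add: graph_tree_singleton graph_degree_def)
  next
    case 2
    obtain l where l: "l \<in> V" "graph_degree T l = 1" using graph_tree_has_leaf[OF less.prems 2] by blast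
    obtain u where u: "u \<in> V - {l}" "{l, u} \<in> T" and tree: "graph_tree (V - {l}) (T - {{l, u}})"
      using graph_tree_remove_leaf[OF less.prems l(2,1)] by blast
    let ?T = "T - {{l, u}}"
    have "graph_degree (insert {l, u} ?T) v = graph_degree ?T v + of_bool (v \<in> {l, u})" for v
      using graph_tree_finite[OF less.prems] by (intro graph_degree_insert) auto
    then have deg: "graph_degree T v = graph_degree ?T v + of_bool (v \<in> {l, u})" for v
      using u(2) by (simp add: insert_absorb)
    have "(\<Sum>v\<in>V. graph_degree T v) = 1 + (\<Sum>v\<in>V - {l}. graph_degree T v)"
      using less.prems l by (simp add: sum.remove)
    also have "(\<Sum>v\<in>V - {l}. graph_degree T v) = (\<Sum>v\<in>V - {l}. graph_degree ?T v + of_bool (v = u))"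
      by (intro sum.cong) (auto simp: deg)
    also have "\<dots> = (\<Sum>v\<in>V - {l}. graph_degree ?T v) + 1"
      using less.prems u by (simp add: sum.distrib of_bool_def)
    finally show ?thesis using less.hyps[OF _ _ tree] less.prems l 2 by simp
  qed
qed

lemma trees_with_leaf_eq:
  assumes V: "finite V" "card V \<ge> 3" and l: "l \<in> V" "e l = 0"
  shows "trees_with V e F =
    (\<Union>u\<in>{u \<in> V - {l}. e u > 0}. insert {l, u} ` trees_with (V - {l}) (e(u := e u - 1)) (F - {{l, u}}))"
    (is "?L = (\<Union>u\<in>?U. insert {l, u} ` ?S u)")
proof (intro equalityI subsetI)
  fix T assume "T \<in> ?L"
  then have T: "graph_tree V T" "F \<subseteq> T" "\<And>v. v \<in> V \<Longrightarrow> graph_degree T v = Suc (e v)"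
    by (auto simp: trees_with_def)
  have "graph_degree T l = 1" using T(3) l by simp
  then obtain u where u: "u \<in> V - {l}" "{l, u} \<in> T" and tree: "graph_tree (V - {l}) (T - {{l, u}})"
    using graph_tree_remove_leaf[OF V(1) T(1) _ l(1)] by blast
  let ?T = "T - {{l, u}}"
  have eq: "T = insert {l, u} ?T" using u(2) by auto
  have "graph_degree (insert {l, u} ?T) v = graph_degree ?T v + of_bool (v \<in> {l, u})" for v
    using graph_tree_finite[OF V(1) T(1)] by (intro graph_degree_insert) auto
  then have deg: "graph_degree T v = graph_degree ?T v + of_bool (v \<in> {l, u})" for v
    using eq by simp
  have "graph_degree ?T u > 0" using graph_tree_degree_pos[OF _ tree _ u(1)] V l by simp
  then have "e u > 0" using deg[of u] T(3)[of u] u by simp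
  moreover have "graph_degree ?T v = Suc ((e(u := e u - 1)) v)" if "v \<in> V - {l}" for v
    using deg[of v] T(3)[of v] that \<open>e u > 0\<close> by (auto split: if_splits)
  ultimately have "?T \<in> ?S u" using tree T(2) by (auto simp: trees_with_def)
  then show "T \<in> (\<Union>u\<in>?U. insert {l, u} ` ?S u)" using u(1) \<open>e u > 0\<close> eq by blast
next
  fix T assume "T \<in> (\<Union>u\<in>?U. insert {l, u} ` ?S u)"
  then obtain u T' where u: "u \<in> V - {l}" "e u > 0" and T': "T' \<in> ?S u" and T: "T = insert {l, u} T'" by auto
  have tree: "graph_tree (V - {l}) T'" and F: "F \<subseteq> T"
    and deg: "\<And>v. v \<in> V - {l} \<Longrightarrow> graph_degree T' v = Suc ((e(u := e u - 1)) v)"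
    using T' T by (auto simp: trees_with_def)
  have sub: "T' \<subseteq> [V - {l}]\<^bsup>2\<^esup>" by (rule graph_tree_subset[OF tree])
  have "graph_tree V T"
    using graph_tree_insert_leaf[OF sub u(1), of l] tree insert_Diff[OF l(1)] by (simp add: T)
  moreover have "graph_degree T v = Suc (e v)" if "v \<in> V" for v
  proof -
    have "{f \<in> T'. l \<in> f} = {}" using sub by (auto simp: nsets_def)
    then have "graph_degree T' l = 0" unfolding graph_degree_def by (simp only: card.empty)
    moreover have "graph_degree T v = graph_degree T' v + of_bool (v \<in> {l, u})"
      unfolding T using graph_tree_finite[OF _ tree] V(1) sub by (intro graph_degree_insert) auto
    ultimately show ?thesis using deg[of v] that l(2) u by (cases "v = l") auto
  qed
  ultimately show "T \<in> ?L" using F by (simp add: trees_with_def)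
qed

lemma card_trees_with_leaf:
  assumes V: "finite V" "card V \<ge> 3" and l: "l \<in> V" "e l = 0"
  shows "card (trees_with V e F) =
    (\<Sum>u\<in>{u \<in> V - {l}. e u > 0}. card (trees_with (V - {l}) (e(u := e u - 1)) (F - {{l, u}})))"
proof -
  let ?S = "\<lambda>u. trees_with (V - {l}) (e(u := e u - 1)) (F - {{l, u}})"
  have notin: "{l, w} \<notin> T" if "T \<in> ?S u" for T u w
    using that graph_tree_subset[of "V - {l}" T] by (auto simp: trees_with_def)
  have "card (trees_with V e F) = (\<Sum>u\<in>{u \<in> V - {l}. e u > 0}. card (insert {l, u} ` ?S u))"
    unfolding trees_with_leaf_eq[where e = e, OF assms]
  proof (rule card_UN_disjoint)
    have "insert {l, u} A \<noteq> insert {l, w} B" if "B \<in> ?S w" "u \<noteq> w" for u w A B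
    proof -
      have "{l, u} \<notin> insert {l, w} B" using notin[OF that(1)] that(2) by (simp add: doubleton_eq_iff)
      then show ?thesis by blast
    qed
    then show "\<forall>u\<in>{u \<in> V - {l}. e u > 0}. \<forall>w\<in>{u \<in> V - {l}. e u > 0}.
        u \<noteq> w \<longrightarrow> insert {l, u} ` ?S u \<inter> insert {l, w} ` ?S w = {}"
      by blast
  qed (use V in \<open>auto intro!: finite_imageI finite_trees_with\<close>)
  also have "\<dots> = (\<Sum>u\<in>{u \<in> V - {l}. e u > 0}. card (?S u))"
  proof (intro sum.cong refl card_image inj_onI)
    fix u A B assume "A \<in> ?S u" "B \<in> ?S u" "insert {l, u} A = insert {l, u} B"
    then show "A = B" using notin by (subst (asm) insert_ident) auto
  qed
  finally show ?thesis .
qed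

definition ordered_tree_count :: "'a set \<Rightarrow> ('a \<Rightarrow> nat) \<Rightarrow> 'a set set \<Rightarrow> real" where
  "ordered_tree_count V e F = real (card (trees_with V e F)) * (\<Prod>v\<in>V. fact (e v))"

lemma ordered_tree_count_leaf:
  assumes V: "finite V" "card V \<ge> 3" and l: "l \<in> V" "e l = 0"
  shows "ordered_tree_count V e F =
    (\<Sum>u\<in>V - {l}. real (e u) * ordered_tree_count (V - {l}) (e(u := e u - 1)) (F - {{l, u}}))"
proof -
  let ?S = "\<lambda>u. trees_with (V - {l}) (e(u := e u - 1)) (F - {{l, u}})"
  have fact: "(\<Prod>v\<in>V. fact (e v) :: real) = real (e u) * (\<Prod>v\<in>V - {l}. fact ((e(u := e u - 1)) v))"
    if u: "u \<in> V - {l}" "e u > 0" for u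
  proof -
    have "(\<Prod>v\<in>V. fact (e v) :: real) = (\<Prod>v\<in>V - {l}. fact (e v))"
      using V l by (simp add: prod.remove)
    also have "\<dots> = (\<Prod>v\<in>V - {l}. (if v = u then real (e u) else 1) * fact ((e(u := e u - 1)) v))"
      using u(2) by (intro prod.cong refl) (auto simp: fact_reduce)
    finally show ?thesis using V u(1) by (simp add: prod.distrib)
  qed
  have "ordered_tree_count V e F =
      (\<Sum>u\<in>{u \<in> V - {l}. e u > 0}. real (card (?S u)) * (\<Prod>v\<in>V. fact (e v)))"
    unfolding ordered_tree_count_def card_trees_with_leaf[where e = e, OF assms] by (simp add: sum_distrib_right)
  also have "\<dots> = (\<Sum>u\<in>{u \<in> V - {l}. e u > 0}. real (e u) * (real (card (?S u)) *
      (\<Prod>v\<in>V - {l}. fact ((e(u := e u - 1)) v))))"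
    using fact by (intro sum.cong refl) auto
  also have "\<dots> = (\<Sum>u\<in>V - {l}. real (e u) * (real (card (?S u)) * (\<Prod>v\<in>V - {l}. fact ((e(u := e u - 1)) v))))"
    using V by (intro sum.mono_neutral_left) auto
  finally show ?thesis by (simp only: ordered_tree_count_def)
qed

lemma ordered_tree_count_leaf_in_edge:
  assumes V: "finite V" "card V \<ge> 3" and l: "l \<in> V" "e l = 0" and w: "w \<in> V - {l}" "{l, w} \<in> F"
  shows "ordered_tree_count V e F =
    real (e w) * ordered_tree_count (V - {l}) (e(w := e w - 1)) (F - {{l, w}})"
proof -
  have "trees_with (V - {l}) (e(u := e u - 1)) (F - {{l, u}}) = {}" if "u \<in> V - {l} - {w}" for u
    using w that by (intro trees_with_not_subset) (auto simp: nsets_def doubleton_eq_iff)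
  then have "ordered_tree_count V e F =
      (\<Sum>u\<in>{w}. real (e u) * ordered_tree_count (V - {l}) (e(u := e u - 1)) (F - {{l, u}}))"
    unfolding ordered_tree_count_leaf[where e = e, OF V l] using V w(1)
    by (intro sum.mono_neutral_right) (auto simp: ordered_tree_count_def)
  then show ?thesis by simp
qed

lemma prod_diff_disjoint:
  fixes s :: "'a set \<Rightarrow> real"
  assumes F: "finite F" "pairwise disjnt F"
  shows "(\<Prod>f\<in>F. s f - of_bool (u \<in> f)) = (\<Prod>f\<in>F. s f) - (\<Sum>f\<in>F. of_bool (u \<in> f) * (\<Prod>g\<in>F - {f}. s g))"
proof (cases "\<exists>f\<in>F. u \<in> f")
  case True
  then obtain f where f: "f \<in> F" "u \<in> f" by auto
  have other: "u \<notin> g" if "g \<in> F - {f}" for g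
    using that f F(2) by (auto simp: pairwise_def disjnt_def)
  have "(\<Prod>g\<in>F - {f}. s g - of_bool (u \<in> g)) = (\<Prod>g\<in>F - {f}. s g)"
    using other by (intro prod.cong) auto
  moreover have "(\<Sum>g\<in>F. of_bool (u \<in> g) * (\<Prod>h\<in>F - {g}. s h)) =
      (\<Sum>g\<in>{f}. of_bool (u \<in> g) * (\<Prod>h\<in>F - {g}. s h))"
    using F(1) f other by (intro sum.mono_neutral_right) auto
  ultimately show ?thesis using F(1) f by (simp add: prod.remove[of F f] left_diff_distrib)
qed (simp add: sum.neutral)

lemma sum_weighted_prod_decrement:
  fixes e :: "'a \<Rightarrow> real"
  assumes U: "finite U" and F: "finite F" "pairwise disjnt F" and sub: "\<forall>f\<in>F. f \<subseteq> U"
  shows "(\<Sum>u\<in>U. e u * (\<Prod>f\<in>F. (\<Sum>v\<in>f. e v) - of_bool (u \<in> f))) =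
    ((\<Sum>u\<in>U. e u) - real (card F)) * (\<Prod>f\<in>F. \<Sum>v\<in>f. e v)"
proof -
  define s where "s f = (\<Sum>v\<in>f. e v)" for f
  have "(\<Sum>u\<in>U. e u * (\<Prod>f\<in>F. s f - of_bool (u \<in> f))) =
      (\<Sum>u\<in>U. e u) * (\<Prod>f\<in>F. s f) - (\<Sum>u\<in>U. \<Sum>f\<in>F. e u * (of_bool (u \<in> f) * (\<Prod>g\<in>F - {f}. s g)))"
    unfolding prod_diff_disjoint[OF F]
    by (simp add: right_diff_distrib sum_subtractf sum_distrib_left sum_distrib_right)
  also have "(\<Sum>u\<in>U. \<Sum>f\<in>F. e u * (of_bool (u \<in> f) * (\<Prod>g\<in>F - {f}. s g))) =
      (\<Sum>f\<in>F. (\<Sum>u\<in>U. e u * of_bool (u \<in> f)) * (\<Prod>g\<in>F - {f}. s g))"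
    unfolding sum_distrib_right by (subst sum.swap) (simp add: mult.assoc)
  also have "\<dots> = (\<Sum>f\<in>F. \<Prod>g\<in>F. s g)"
  proof (rule sum.cong[OF refl])
    fix f assume f: "f \<in> F"
    have "(\<Sum>u\<in>U. e u * of_bool (u \<in> f)) = s f"
      unfolding s_def using U sub f by (intro sum.mono_neutral_cong_right) auto
    then show "(\<Sum>u\<in>U. e u * of_bool (u \<in> f)) * (\<Prod>g\<in>F - {f}. s g) = (\<Prod>g\<in>F. s g)"
      using F(1) f by (simp add: prod.remove)
  qed
  finally show ?thesis by (simp add: s_def left_diff_distrib)
qed

lemma card_Union_pairwise_disjnt_nsets:
  assumes "finite V" "F \<subseteq> [V]\<^bsup>k\<^esup>" "pairwise disjnt F"
  shows "card (\<Union>F) = k * card F"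
proof -
  have "card (\<Union>F) = (\<Sum>f\<in>F. card f)"
    using assms by (intro card_Union_disjoint) (auto simp: nsets_def)
  also have "\<dots> = (\<Sum>f\<in>F. k)" using assms(2) by (intro sum.cong) (auto simp: nsets_def)
  finally show ?thesis by simp
qed

text \<open>Removing such a leaf preserves \<open>card F + 2 \<le> card V\<close>: it either lies on an edge of \<open>F\<close>, which
  is removed as well, or there are vertices to spare.\<close>

lemma ex_removable_leaf:
  assumes V: "finite V" "card V \<ge> 3" and F: "F \<subseteq> [V]\<^bsup>2\<^esup>" "pairwise disjnt F" "card F + 2 \<le> card V"
    and e: "(\<Sum>v\<in>V. e v) + 2 = card V"
  obtains l where "l \<in> V" "e l = 0" "(\<exists>f\<in>F. l \<in> f) \<or> card F + 3 \<le> card V"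
proof -
  let ?Z = "{v \<in> V. e v = 0}"
  have "card {v \<in> V. e v \<noteq> 0} \<le> (\<Sum>v\<in>{v \<in> V. e v \<noteq> 0}. e v)"
    unfolding card_eq_sum by (intro sum_mono) auto
  also have "\<dots> \<le> (\<Sum>v\<in>V. e v)" using V by (intro sum_mono2) auto
  finally have "card {v \<in> V. e v \<noteq> 0} + 2 \<le> card V" using e by simp
  moreover have "card V = card ?Z + card {v \<in> V. e v \<noteq> 0}"
    using V(1) by (subst card_Un_disjoint[symmetric]) (auto intro: arg_cong[where f = card])
  ultimately have "card ?Z \<ge> 2" by simp
  show ?thesis
  proof (cases "card F + 3 \<le> card V")
    case True
    have "?Z \<noteq> {}" using \<open>card ?Z \<ge> 2\<close> by (metis card.empty not_numeral_le_zero)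
    then show ?thesis using that True by blast
  next
    case False
    then have "card V = card F + 2" using F(3) by simp
    have "\<Union>F \<subseteq> V" using F(1) by (auto simp: nsets_def)
    then have "card (V - \<Union>F) = card V - 2 * card F"
      using card_Union_pairwise_disjnt_nsets[OF V(1) F(1,2)] V(1) by (simp add: card_Diff_subset finite_subset)
    then have "card (V - \<Union>F) \<le> 1" using \<open>card V = card F + 2\<close> V(2) by simp
    then have "\<not> ?Z \<subseteq> V - \<Union>F" using \<open>card ?Z \<ge> 2\<close> card_mono[of "V - \<Union>F" ?Z] V(1) by fastforce
    then show ?thesis using that by blast
  qed
qed

lemma trees_with_card_2:
  assumes "card V = 2" "(\<Sum>v\<in>V. e v) = 0"
  shows "trees_with V e {} = {{V}}"
proof -
  obtain a b where V: "V = {a, b}" "a \<noteq> b" using assms(1) by (auto simp: card_2_iff)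
  then have e: "e a = 0" "e b = 0" using assms(2) by auto
  have "graph_tree (insert a {b}) (insert {a, b} {})"
    using V(2) graph_tree_insert_leaf[of "{}" "{b}" b a] by (simp add: graph_tree_singleton)
  then have "{V} \<in> trees_with V e {}"
    using V e by (auto simp: trees_with_def graph_degree_def Collect_conv_if)
  moreover have "T = {V}" if "T \<in> trees_with V e {}" for T
  proof -
    have "T \<subseteq> {V}" using that graph_tree_subset[of V T] V by (auto simp: trees_with_def)
    moreover have "T \<noteq> {}" using that V by (auto simp: trees_with_def graph_degree_def)
    ultimately show ?thesis by blast
  qed
  ultimately show ?thesis by blast
qed

lemma sum_decrement:
  fixes e :: "'a \<Rightarrow> nat"
  assumes "finite A" "0 < e u"
  shows "(\<Sum>v\<in>A. (e(u := e u - 1)) v) + of_bool (u \<in> A) = (\<Sum>v\<in>A. e v)"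
proof -
  have "(\<Sum>v\<in>A. (e(u := e u - 1)) v + of_bool (v = u)) = (\<Sum>v\<in>A. e v)"
    using assms(2) by (intro sum.cong) auto
  then show ?thesis using assms(1) by (simp add: sum.distrib of_bool_def)
qed

lemma prod_sum_decrement:
  fixes e :: "'a \<Rightarrow> nat"
  assumes "\<forall>f\<in>G. finite f" "0 < e u"
  shows "(\<Prod>f\<in>G. \<Sum>v\<in>f. real ((e(u := e u - 1)) v)) = (\<Prod>f\<in>G. (\<Sum>v\<in>f. real (e v)) - of_bool (u \<in> f))"
proof (rule prod.cong[OF refl])
  fix f assume "f \<in> G"
  then have "real (\<Sum>v\<in>f. (e(u := e u - 1)) v) + of_bool (u \<in> f) = real (\<Sum>v\<in>f. e v)"
    using sum_decrement[of f e u] assms by (metis of_nat_add of_nat_of_bool)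
  then show "(\<Sum>v\<in>f. real ((e(u := e u - 1)) v)) = (\<Sum>v\<in>f. real (e v)) - of_bool (u \<in> f)" by simp
qed

text \<open>In the induction step a leaf \<open>l\<close> is removed. This either forces the edge of \<open>F\<close> at \<open>l\<close>, or
  leaves a choice of its neighbour \<open>u\<close>, which lowers \<open>e u\<close> and the factor of the edge of \<open>F\<close>
  through \<open>u\<close> by one.\<close>

lemma ordered_tree_count_step_forced:
  assumes V: "finite V" "card V \<ge> 3" and F: "F \<subseteq> [V]\<^bsup>2\<^esup>" "pairwise disjnt F" and card: "card F + 2 \<le> card V"
    and l: "l \<in> V" "e l = 0" and f: "f \<in> F" "l \<in> f"
    and IH: "\<And>u G. u \<in> V - {l} \<Longrightarrow> G \<subseteq> [V - {l}]\<^bsup>2\<^esup> \<Longrightarrow> pairwise disjnt G \<Longrightarrow> card G + 3 \<le> card V \<Longrightarrow>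
      real (e u) * ordered_tree_count (V - {l}) (e(u := e u - 1)) G =
      real (e u) * (fact (card V - 3 - card G) * (\<Prod>f\<in>G. (\<Sum>v\<in>f. real (e v)) - of_bool (u \<in> f)))"
  shows "ordered_tree_count V e F = fact (card V - 2 - card F) * (\<Prod>f\<in>F. \<Sum>v\<in>f. real (e v))"
proof -
  let ?U = "V - {l}" and ?s = "\<lambda>f. \<Sum>v\<in>f. real (e v)"
  have finF: "finite F" using F(1) V(1) finite_subset finite_nsets by blast
  obtain a b where "f = {a, b}" "a \<in> V" "b \<in> V" "a \<noteq> b" using F(1) f(1) by (rule subset_nsets_2E)
  then obtain w where w: "f = {l, w}" "w \<in> ?U" using f(2) by (auto simp: insert_commute)
  have disj: "l \<notin> g \<and> w \<notin> g" if "g \<in> F - {f}" for g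
    using pairwiseD[OF F(2), of g f] that f(1) w(1) by (simp add: disjnt_def)
  have "[V]\<^bsup>2\<^esup> \<inter> {g. l \<notin> g} \<subseteq> [?U]\<^bsup>2\<^esup>" by (auto simp: nsets_def)
  then have F': "F - {f} \<subseteq> [?U]\<^bsup>2\<^esup>" "pairwise disjnt (F - {f})" "card (F - {f}) + 1 = card F"
    using F disj card.remove[OF finF f(1)] by (blast, auto intro: pairwise_subset)
  have "ordered_tree_count V e F = real (e w) * ordered_tree_count ?U (e(w := e w - 1)) (F - {f})"
    using f(1) w by (simp add: ordered_tree_count_leaf_in_edge[where e = e, OF V l])
  also have "\<dots> = real (e w) * (fact (card V - 3 - card (F - {f})) * (\<Prod>g\<in>F - {f}. ?s g - of_bool (w \<in> g)))"
    using F' card by (intro IH[OF w(2)]) auto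
  also have "(\<Prod>g\<in>F - {f}. ?s g - of_bool (w \<in> g)) = (\<Prod>g\<in>F - {f}. ?s g)"
    using disj by (intro prod.cong) auto
  also have "card V - 3 - card (F - {f}) = card V - 2 - card F" using F'(3) card by linarith
  also have "real (e w) = ?s f" using w l(2) by (auto simp: w(1))
  finally show ?thesis using finF f(1) by (simp add: prod.remove)
qed

lemma ordered_tree_count_step_free:
  assumes V: "finite V" "card V \<ge> 3" and F: "F \<subseteq> [V]\<^bsup>2\<^esup>" "pairwise disjnt F" and card: "card F + 3 \<le> card V"
    and l: "l \<in> V" "e l = 0" "\<forall>f\<in>F. l \<notin> f" and e: "(\<Sum>v\<in>V - {l}. e v) + 2 = card V"
    and IH: "\<And>u G. u \<in> V - {l} \<Longrightarrow> G \<subseteq> [V - {l}]\<^bsup>2\<^esup> \<Longrightarrow> pairwise disjnt G \<Longrightarrow> card G + 3 \<le> card V \<Longrightarrow>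
      real (e u) * ordered_tree_count (V - {l}) (e(u := e u - 1)) G =
      real (e u) * (fact (card V - 3 - card G) * (\<Prod>f\<in>G. (\<Sum>v\<in>f. real (e v)) - of_bool (u \<in> f)))"
  shows "ordered_tree_count V e F = fact (card V - 2 - card F) * (\<Prod>f\<in>F. \<Sum>v\<in>f. real (e v))"
proof -
  let ?U = "V - {l}" and ?s = "\<lambda>f. \<Sum>v\<in>f. real (e v)" and ?k = "card V - 3 - card F"
  have finF: "finite F" using F(1) V(1) finite_subset finite_nsets by blast
  have FU: "F \<subseteq> [?U]\<^bsup>2\<^esup>" "\<forall>f\<in>F. f \<subseteq> ?U" "F - {{l, u}} = F" for u
    using l(3) F(1) by (auto simp: nsets_def)
  have "ordered_tree_count V e F = (\<Sum>u\<in>?U. real (e u) * (fact ?k * (\<Prod>f\<in>F. ?s f - of_bool (u \<in> f))))"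
    unfolding ordered_tree_count_leaf[where e = e, OF V l(1,2)] FU(3)
    by (intro sum.cong refl IH FU(1) F(2) card)
  also have "\<dots> = fact ?k * (\<Sum>u\<in>?U. real (e u) * (\<Prod>f\<in>F. ?s f - of_bool (u \<in> f)))"
    by (simp add: sum_distrib_left mult_ac)
  also have "\<dots> = fact ?k * ((real (\<Sum>u\<in>?U. e u) - real (card F)) * (\<Prod>f\<in>F. ?s f))"
    using V(1) by (simp add: sum_weighted_prod_decrement[OF _ finF F(2) FU(2)])
  also have "real (\<Sum>u\<in>?U. e u) - real (card F) = real (Suc ?k)" using e card by linarith
  also have "fact ?k * (real (Suc ?k) * (\<Prod>f\<in>F. ?s f)) = fact (Suc ?k) * (\<Prod>f\<in>F. ?s f)" by simp
  also have "Suc ?k = card V - 2 - card F" using card by linarith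
  finally show ?thesis .
qed

lemma ordered_tree_count_eq:
  assumes "finite V" "F \<subseteq> [V]\<^bsup>2\<^esup>" "pairwise disjnt F" "card F + 2 \<le> card V" "(\<Sum>v\<in>V. e v) + 2 = card V"
  shows "ordered_tree_count V e F = fact (card V - 2 - card F) * (\<Prod>f\<in>F. \<Sum>v\<in>f. real (e v))"
  using assms
proof (induction "card V" arbitrary: V F e rule: less_induct)
  case less
  note V = less.prems(1) and F = less.prems(2,3) and card = less.prems(4) and e = less.prems(5)
  show ?case
  proof (cases "card V = 2")
    case True
    then have "F = {}" "\<forall>v\<in>V. e v = 0" using card e F(1) V finite_subset[OF F(1)] by auto
    then show ?thesis using True trees_with_card_2[of V e] by (simp add: ordered_tree_count_def)
  next
    case False
    then have n: "card V \<ge> 3" using card by simp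
    obtain l where l: "l \<in> V" "e l = 0" "(\<exists>f\<in>F. l \<in> f) \<or> card F + 3 \<le> card V"
      by (rule ex_removable_leaf[OF V n F card e])
    let ?U = "V - {l}"
    have U: "finite ?U" "card ?U < card V" "card ?U = card V - 1" using V l(1) n by auto
    have eU: "(\<Sum>v\<in>?U. e v) + 2 = card V" using e V l by (simp add: sum.remove)
    have IH: "real (e u) * ordered_tree_count ?U (e(u := e u - 1)) G =
        real (e u) * (fact (card V - 3 - card G) * (\<Prod>f\<in>G. (\<Sum>v\<in>f. real (e v)) - of_bool (u \<in> f)))"
      if u: "u \<in> ?U" and G: "G \<subseteq> [?U]\<^bsup>2\<^esup>" "pairwise disjnt G" "card G + 3 \<le> card V" for u G
    proof (cases "e u = 0")
      case False
      then have "(\<Sum>v\<in>?U. (e(u := e u - 1)) v) + 2 = card ?U"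
        using sum_decrement[OF U(1), of e u] u eU U(3) by simp
      then have "ordered_tree_count ?U (e(u := e u - 1)) G =
          fact (card ?U - 2 - card G) * (\<Prod>f\<in>G. \<Sum>v\<in>f. real ((e(u := e u - 1)) v))"
        using G U(3) n by (intro less.hyps[OF U(2,1) G(1,2)]) auto
      also have "(\<Prod>f\<in>G. \<Sum>v\<in>f. real ((e(u := e u - 1)) v)) = (\<Prod>f\<in>G. (\<Sum>v\<in>f. real (e v)) - of_bool (u \<in> f))"
        using False G(1) by (intro prod_sum_decrement) (auto simp: nsets_def)
      also have "card ?U - 2 - card G = card V - 3 - card G" using U(3) by simp
      finally show ?thesis by (simp only:)
    qed simp
    show ?thesis
    proof (cases "\<exists>f\<in>F. l \<in> f")
      case True
      then show ?thesis using ordered_tree_count_step_forced[OF V n F card l(1,2) _ _ IH] by blast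
    next
      case False
      then show ?thesis using ordered_tree_count_step_free[OF V n F _ l(1,2) _ eU IH] l(3) by blast
    qed
  qed
qed

definition tree_mean :: "'a set \<Rightarrow> ('a \<Rightarrow> nat) \<Rightarrow> ('a set set \<Rightarrow> real) \<Rightarrow> real" where
  "tree_mean V e = weighted_mean (trees_with V e {}) (\<lambda>_. 1)"

lemma card_trees_pos:
  assumes V: "finite V" "card V \<ge> 2" and e: "(\<Sum>v\<in>V. e v) + 2 = card V"
  shows "card (trees_with V e {}) > 0"
proof (rule ccontr)
  assume "\<not> ?thesis"
  then show False
    using ordered_tree_count_eq[OF V(1), of "{}" e] V(2) e by (simp add: ordered_tree_count_def)
qed

lemma tree_mean_sum_edges:
  assumes V: "finite V" and R: "\<And>T. T \<in> trees_with V e {} \<Longrightarrow> R T = {x \<in> P. S x \<subseteq> T}" and P: "finite P"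
  shows "tree_mean V e (\<lambda>T. \<Sum>x\<in>R T. a x) =
    (\<Sum>x\<in>P. a x * (real (card (trees_with V e (S x))) / real (card (trees_with V e {}))))"
proof -
  have eq: "{T \<in> trees_with V e {}. S x \<subseteq> T} = trees_with V e (S x)" for x by (auto simp: trees_with_def)
  have "(\<Sum>T\<in>trees_with V e {}. \<Sum>x\<in>R T. a x) = (\<Sum>T\<in>trees_with V e {}. \<Sum>x\<in>{x \<in> P. S x \<subseteq> T}. a x)"
    using R by (intro sum.cong) auto
  also have "\<dots> = (\<Sum>x\<in>P. \<Sum>T\<in>{T \<in> trees_with V e {}. S x \<subseteq> T}. a x)"
    by (rule sum.swap_restrict[OF finite_trees_with[OF V] P])
  also have "\<dots> = (\<Sum>x\<in>P. a x * real (card (trees_with V e (S x))))" by (simp add: eq mult.commute)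
  finally show ?thesis by (simp add: tree_mean_def weighted_mean_def sum_divide_distrib)
qed

lemma card_trees_with_edge:
  assumes V: "finite V" "card V \<ge> 3" and e: "(\<Sum>v\<in>V. e v) + 2 = card V" and f: "f \<in> [V]\<^bsup>2\<^esup>"
  shows "real (card (trees_with V e {f})) / real (card (trees_with V e {})) = (\<Sum>v\<in>f. real (e v)) / (real (card V) - 2)"
proof -
  obtain k where k: "card V = k + 3" using V(2) by (metis add.commute le_Suc_ex)
  let ?p = "\<Prod>v\<in>V. fact (e v) :: real"
  have p: "?p > 0" by (intro prod_pos) simp
  have "real (card (trees_with V e {f})) * ?p = fact k * (\<Sum>v\<in>f. real (e v))"
    using ordered_tree_count_eq[OF V(1), of "{f}" e] f e k by (simp add: ordered_tree_count_def)
  moreover have "real (card (trees_with V e {})) * ?p = fact (Suc k)"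
    using ordered_tree_count_eq[OF V(1), of "{}" e] e k by (simp add: ordered_tree_count_def)
  ultimately have "real (card (trees_with V e {f})) / real (card (trees_with V e {})) =
      (fact k * (\<Sum>v\<in>f. real (e v))) / fact (Suc k)"
    using p by (metis mult_divide_mult_cancel_right less_irrefl)
  also have "\<dots> = (\<Sum>v\<in>f. real (e v)) / (real (card V) - 2)" by (simp add: k)
  finally show ?thesis .
qed

lemma card_trees_with_disjoint_edges:
  assumes V: "finite V" "card V \<ge> 4" and e: "(\<Sum>v\<in>V. e v) + 2 = card V"
    and fg: "f \<in> [V]\<^bsup>2\<^esup>" "g \<in> [V]\<^bsup>2\<^esup>" "disjnt f g"
  shows "real (card (trees_with V e {f, g})) / real (card (trees_with V e {})) =
    (\<Sum>v\<in>f. real (e v)) * (\<Sum>v\<in>g. real (e v)) / ((real (card V) - 2) * (real (card V) - 3))"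
proof -
  obtain k where k: "card V = k + 4" using V(2) by (metis add.commute le_Suc_ex)
  let ?p = "\<Prod>v\<in>V. fact (e v) :: real"
  have p: "?p > 0" by (intro prod_pos) simp
  have "f \<noteq> g" using fg by (auto simp: disjnt_def nsets_def)
  then have "real (card (trees_with V e {f, g})) * ?p = fact k * ((\<Sum>v\<in>f. real (e v)) * (\<Sum>v\<in>g. real (e v)))"
    using ordered_tree_count_eq[OF V(1), of "{f, g}" e] fg e k
    by (simp add: ordered_tree_count_def pairwise_insert disjnt_sym)
  moreover have "real (card (trees_with V e {})) * ?p = fact (Suc (Suc k))"
    using ordered_tree_count_eq[OF V(1), of "{}" e] e k by (simp add: ordered_tree_count_def)
  ultimately have "real (card (trees_with V e {f, g})) / real (card (trees_with V e {})) =
      (fact k * ((\<Sum>v\<in>f. real (e v)) * (\<Sum>v\<in>g. real (e v)))) / fact (Suc (Suc k))"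
    using p by (metis mult_divide_mult_cancel_right less_irrefl)
  also have "\<dots> = (\<Sum>v\<in>f. real (e v)) * (\<Sum>v\<in>g. real (e v)) / ((real (card V) - 2) * (real (card V) - 3))"
    by (simp add: k fact_Suc add.commute mult.assoc)
  finally show ?thesis .
qed

lemma sum_intersecting_edges_le:
  fixes a :: "'a set \<Rightarrow> real"
  assumes V: "finite V" and T: "T \<subseteq> [V]\<^bsup>2\<^esup>" and deg: "\<forall>v\<in>V. graph_degree T v \<le> d"
    and a: "\<forall>f\<in>T. 0 \<le> a f \<and> a f \<le> b"
  shows "(\<Sum>f\<in>T. \<Sum>g\<in>{g \<in> T. \<not> disjnt f g}. a f * a g) \<le> b\<^sup>2 * (real (card V) * real d ^ 2)"
proof -
  have "(\<Sum>g\<in>{g \<in> T. \<not> disjnt f g}. a f * a g) \<le> b\<^sup>2 * (\<Sum>v\<in>f. real (graph_degree T v))" if f: "f \<in> T" for f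
  proof -
    have b: "0 \<le> b" using a f by force
    have "finite f" using f T by (auto simp: nsets_def)
    have "(\<Sum>g\<in>{g \<in> T. \<not> disjnt f g}. a f * a g) \<le> (\<Sum>g\<in>{g \<in> T. \<not> disjnt f g}. b * b)"
      using a f b by (intro sum_mono mult_mono) auto
    also have "\<dots> = b\<^sup>2 * real (card (\<Union>v\<in>f. {g \<in> T. v \<in> g}))"
      by (auto simp: power2_eq_square disjnt_def intro: arg_cong[where f = card])
    also have "\<dots> \<le> b\<^sup>2 * real (\<Sum>v\<in>f. card {g \<in> T. v \<in> g})"
      using card_UN_le[OF \<open>finite f\<close>] by (intro mult_left_mono of_nat_mono) auto
    finally show ?thesis by (simp add: graph_degree_def)
  qed
  then have "(\<Sum>f\<in>T. \<Sum>g\<in>{g \<in> T. \<not> disjnt f g}. a f * a g) \<le> (\<Sum>f\<in>T. b\<^sup>2 * (\<Sum>v\<in>f. real (graph_degree T v)))"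
    by (rule sum_mono)
  also have "\<dots> = b\<^sup>2 * (\<Sum>v\<in>V. real (graph_degree T v) * real (graph_degree T v))"
    unfolding sum_distrib_left[symmetric] sum_edges_vertices[OF V T] ..
  also have "\<dots> \<le> b\<^sup>2 * (\<Sum>v\<in>V. real d * real d)"
    using deg by (intro mult_left_mono sum_mono mult_mono) auto
  finally show ?thesis by (simp add: power2_eq_square)
qed

lemma tree_mean_edge_sum:
  assumes V: "finite V" "card V \<ge> 3" and e: "(\<Sum>v\<in>V. e v) + 2 = card V"
  shows "tree_mean V e (\<lambda>T. \<Sum>f\<in>T. a f) =
    (\<Sum>f\<in>[V]\<^bsup>2\<^esup>. a f * (\<Sum>v\<in>f. real (e v))) / (real (card V) - 2)"
proof -
  have "T = {f \<in> [V]\<^bsup>2\<^esup>. {f} \<subseteq> T}" if "T \<in> trees_with V e {}" for T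
    using that graph_tree_subset[of V T] by (auto simp: trees_with_def)
  then have "tree_mean V e (\<lambda>T. \<Sum>f\<in>T. a f) =
      (\<Sum>f\<in>[V]\<^bsup>2\<^esup>. a f * (real (card (trees_with V e {f})) / real (card (trees_with V e {}))))"
    using V(1) by (intro tree_mean_sum_edges) auto
  also have "\<dots> = (\<Sum>f\<in>[V]\<^bsup>2\<^esup>. a f * ((\<Sum>v\<in>f. real (e v)) / (real (card V) - 2)))"
    by (intro sum.cong refl) (simp only: card_trees_with_edge[OF V e])
  finally show ?thesis
    by (simp only: times_divide_eq_right sum_divide_distrib[of "\<lambda>f. a f * (\<Sum>v\<in>f. real (e v))"])
qed

lemma tree_mean_disjoint_edges_le:
  assumes V: "finite V" "card V \<ge> 4" and e: "(\<Sum>v\<in>V. e v) + 2 = card V" and a: "\<forall>f\<in>[V]\<^bsup>2\<^esup>. 0 \<le> a f"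
  shows "tree_mean V e (\<lambda>T. \<Sum>f\<in>T. \<Sum>g\<in>{g \<in> T. disjnt f g}. a f * a g) \<le>
    (\<Sum>f\<in>[V]\<^bsup>2\<^esup>. a f * (\<Sum>v\<in>f. real (e v)))\<^sup>2 / ((real (card V) - 2) * (real (card V) - 3))"
proof -
  let ?P = "[V]\<^bsup>2\<^esup>" and ?s = "\<lambda>f. \<Sum>v\<in>f. real (e v)" and ?m = "(real (card V) - 2) * (real (card V) - 3)"
  let ?D = "{(f, g) \<in> ?P \<times> ?P. disjnt f g}"
  have m: "?m > 0" using V(2) by simp
  have pairs: "(\<Sum>f\<in>T. \<Sum>g\<in>{g \<in> T. disjnt f g}. a f * a g) = (\<Sum>(f, g)\<in>{(f, g) \<in> T \<times> T. disjnt f g}. a f * a g)"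
    if "finite T" for T
    using that by (auto simp: sum.Sigma intro!: sum.cong)
  have "tree_mean V e (\<lambda>T. \<Sum>f\<in>T. \<Sum>g\<in>{g \<in> T. disjnt f g}. a f * a g) =
      tree_mean V e (\<lambda>T. \<Sum>x\<in>{(f, g) \<in> T \<times> T. disjnt f g}. a (fst x) * a (snd x))"
    unfolding tree_mean_def using V(1)
    by (intro weighted_mean_cong) (auto simp: trees_with_def pairs split_def dest: graph_tree_finite)
  also have "\<dots> = (\<Sum>x\<in>?D. a (fst x) * a (snd x) *
      (real (card (trees_with V e {fst x, snd x})) / real (card (trees_with V e {}))))"
  proof (rule tree_mean_sum_edges[OF V(1)])
    fix T assume "T \<in> trees_with V e {}"
    then have "T \<subseteq> ?P" using graph_tree_subset[of V T] by (simp add: trees_with_def)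
    then show "{(f, g) \<in> T \<times> T. disjnt f g} = {x \<in> ?D. {fst x, snd x} \<subseteq> T}" by auto
  qed (rule finite_subset[of _ "?P \<times> ?P"]; use V in auto)
  also have "\<dots> = (\<Sum>x\<in>?D. (a (fst x) * ?s (fst x)) * (a (snd x) * ?s (snd x)) / ?m)"
  proof (intro sum.cong refl)
    fix x assume "x \<in> ?D"
    then have "real (card (trees_with V e {fst x, snd x})) / real (card (trees_with V e {})) = ?s (fst x) * ?s (snd x) / ?m"
      by (intro card_trees_with_disjoint_edges[OF V e]) auto
    then show "a (fst x) * a (snd x) * (real (card (trees_with V e {fst x, snd x})) / real (card (trees_with V e {}))) =
        (a (fst x) * ?s (fst x)) * (a (snd x) * ?s (snd x)) / ?m"
      by (simp only: times_divide_eq_right mult_ac)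
  qed
  also have "\<dots> \<le> (\<Sum>x\<in>?P \<times> ?P. (a (fst x) * ?s (fst x)) * (a (snd x) * ?s (snd x)) / ?m)"
    using V a m by (intro sum_mono2) (auto intro!: divide_nonneg_nonneg mult_nonneg_nonneg sum_nonneg)
  also have "\<dots> = (\<Sum>f\<in>?P. a f * ?s f)\<^sup>2 / ?m"
    by (simp add: power2_eq_square sum_product sum.cartesian_product split_def sum_divide_distrib)
  finally show ?thesis .
qed

lemma tree_mean_edge_sum_square_le:
  assumes V: "finite V" "card V \<ge> 4" and e: "(\<Sum>v\<in>V. e v) + 2 = card V" and d: "\<forall>v\<in>V. e v < d"
    and a: "\<forall>f\<in>[V]\<^bsup>2\<^esup>. 0 \<le> a f \<and> a f \<le> b"
  shows "tree_mean V e (\<lambda>T. (\<Sum>f\<in>T. a f)\<^sup>2) \<le>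
    (\<Sum>f\<in>[V]\<^bsup>2\<^esup>. a f * (\<Sum>v\<in>f. real (e v)))\<^sup>2 / ((real (card V) - 2) * (real (card V) - 3)) +
    b\<^sup>2 * (real (card V) * real d ^ 2)"
proof -
  let ?disjoint = "\<lambda>T. \<Sum>f\<in>T. \<Sum>g\<in>{g \<in> T. disjnt f g}. a f * a g"
  have "(\<Sum>f\<in>T. a f)\<^sup>2 \<le> ?disjoint T + b\<^sup>2 * (real (card V) * real d ^ 2)" if T: "T \<in> trees_with V e {}" for T
  proof -
    have sub: "T \<subseteq> [V]\<^bsup>2\<^esup>" and deg: "\<forall>v\<in>V. graph_degree T v \<le> d" and fin: "finite T"
      using T V(1) d by (auto simp: trees_with_def Suc_le_eq dest: graph_tree_subset graph_tree_finite)
    have "(\<Sum>f\<in>T. a f)\<^sup>2 = (\<Sum>f\<in>T. (\<Sum>g\<in>{g \<in> T. disjnt f g}. a f * a g) + (\<Sum>g\<in>{g \<in> T. \<not> disjnt f g}. a f * a g))"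
      unfolding power2_eq_square sum_product using fin
      by (intro sum.cong refl) (subst sum.union_disjoint[symmetric], auto intro: sum.cong)
    also have "\<dots> = ?disjoint T + (\<Sum>f\<in>T. \<Sum>g\<in>{g \<in> T. \<not> disjnt f g}. a f * a g)" by (rule sum.distrib)
    finally show ?thesis using sum_intersecting_edges_le[OF V(1) sub deg, of a b] a sub by auto
  qed
  then have "tree_mean V e (\<lambda>T. (\<Sum>f\<in>T. a f)\<^sup>2) \<le> tree_mean V e (\<lambda>T. ?disjoint T + b\<^sup>2 * (real (card V) * real d ^ 2))"
    unfolding tree_mean_def by (intro weighted_mean_mono) auto
  also have "\<dots> = tree_mean V e ?disjoint + b\<^sup>2 * (real (card V) * real d ^ 2)"
    using card_trees_pos[OF V(1) _ e] V(2) by (simp add: tree_mean_def weighted_mean_add weighted_mean_const)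
  finally show ?thesis using tree_mean_disjoint_edges_le[OF V e, of a] a by auto
qed

lemma tree_mean_edge_sum_square_dist_le:
  assumes V: "finite V" "card V \<ge> 4" and e: "(\<Sum>v\<in>V. e v) + 2 = card V" and d: "\<forall>v\<in>V. e v < d"
    and a: "\<forall>f\<in>[V]\<^bsup>2\<^esup>. 0 \<le> a f \<and> a f \<le> b" and K: "K = tree_mean V e (\<lambda>T. \<Sum>f\<in>T. a f)"
  shows "tree_mean V e (\<lambda>T. ((\<Sum>f\<in>T. a f) - c)\<^sup>2) \<le>
    K\<^sup>2 / (real (card V) - 3) + b\<^sup>2 * (real (card V) * real d ^ 2) + (K - c)\<^sup>2"
proof -
  let ?m = "real (card V)"
  have m: "?m - 2 > 0" "?m - 3 > 0" using V(2) by auto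
  have "(\<Sum>f\<in>[V]\<^bsup>2\<^esup>. a f * (\<Sum>v\<in>f. real (e v))) = K * (?m - 2)"
    unfolding K using tree_mean_edge_sum[OF V(1) _ e] V(2) m by simp
  then have square: "tree_mean V e (\<lambda>T. (\<Sum>f\<in>T. a f)\<^sup>2) \<le>
      (K * (?m - 2))\<^sup>2 / ((?m - 2) * (?m - 3)) + b\<^sup>2 * (?m * real d ^ 2)"
    using tree_mean_edge_sum_square_le[OF V e d a] by simp
  have "(K * (?m - 2))\<^sup>2 / ((?m - 2) * (?m - 3)) = K\<^sup>2 + K\<^sup>2 / (?m - 3)"
  proof -
    have "(K * (?m - 2))\<^sup>2 / ((?m - 2) * (?m - 3)) = K\<^sup>2 * ((?m - 2) / (?m - 3))"
      using m by (simp add: power2_eq_square)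
    also have "(?m - 2) / (?m - 3) = 1 + 1 / (?m - 3)" using m by (simp add: field_simps)
    finally show ?thesis by (simp add: distrib_left)
  qed
  moreover have "tree_mean V e (\<lambda>T. ((\<Sum>f\<in>T. a f) - c)\<^sup>2) = tree_mean V e (\<lambda>T. (\<Sum>f\<in>T. a f)\<^sup>2) - 2 * c * K + c\<^sup>2"
    unfolding K tree_mean_def using card_trees_pos[OF V(1) _ e] V(2) by (intro weighted_mean_square_dist) auto
  ultimately show ?thesis using square by (simp add: power2_diff mult_ac)
qed

lemma sum_nsets_2_prod_sum:
  fixes x y :: "'a \<Rightarrow> real"
  assumes V: "finite V"
  shows "(\<Sum>f\<in>[V]\<^bsup>2\<^esup>. (\<Prod>v\<in>f. x v) * (\<Sum>v\<in>f. y v)) =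
    (\<Sum>v\<in>V. x v) * (\<Sum>v\<in>V. x v * y v) - (\<Sum>v\<in>V. (x v)\<^sup>2 * y v)"
proof -
  have "2 * (\<Sum>f\<in>[V]\<^bsup>2\<^esup>. (\<Prod>v\<in>f. x v) * (\<Sum>v\<in>f. y v)) = (\<Sum>u\<in>V. \<Sum>v\<in>V - {u}. x u * x v * (y u + y v))"
    unfolding sum_nsets_2[OF V] by (intro sum.cong refl) auto
  also have "\<dots> = (\<Sum>u\<in>V. (\<Sum>v\<in>V. x u * x v * (y u + y v)) - 2 * ((x u)\<^sup>2 * y u))"
    using V by (intro sum.cong refl) (simp add: sum_diff1 power2_eq_square)
  also have "\<dots> = (\<Sum>u\<in>V. \<Sum>v\<in>V. x u * x v * (y u + y v)) - 2 * (\<Sum>v\<in>V. (x v)\<^sup>2 * y v)"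
    by (simp add: sum_subtractf sum_distrib_left)
  also have "(\<Sum>u\<in>V. \<Sum>v\<in>V. x u * x v * (y u + y v)) =
      (\<Sum>u\<in>V. \<Sum>v\<in>V. (x u * y u) * x v) + (\<Sum>u\<in>V. \<Sum>v\<in>V. x u * (x v * y v))"
    by (simp add: distrib_left sum.distrib mult_ac)
  also have "\<dots> = 2 * ((\<Sum>v\<in>V. x v) * (\<Sum>v\<in>V. x v * y v))"
    unfolding sum_product[symmetric] by (simp add: mult.commute)
  finally show ?thesis by simp
qed

lemma sum_excess_degrees:
  assumes r: "\<forall>v\<in>V. r v \<le> d - 1" and d: "d \<ge> 2" and N: "half_edges V r = (d - 2) * card V + 2"
  shows "(\<Sum>v\<in>V. d - 1 - r v) + 2 = card V"
proof -
  have "(\<Sum>v\<in>V. d - 1 - r v) + half_edges V r = (\<Sum>v\<in>V. d - 1)"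
    unfolding half_edges_def sum.distrib[symmetric] using r by (intro sum.cong) auto
  moreover have "(d - 1) * card V = (d - 2) * card V + card V"
    using d by (metis Suc_1 Suc_diff_Suc Suc_le_eq add.commute mult_Suc)
  ultimately show ?thesis using N by (simp add: mult.commute)
qed

lemma sum_residual_times_excess:
  assumes V: "finite V" and r: "\<forall>v\<in>V. r v \<le> d - 1" and d: "d \<ge> 1" and N: "half_edges V r > 0"
  shows "(\<Sum>v\<in>V. real (r v) * real (d - 1 - r v)) = real (half_edges V r) * (real d - 2 - 2 * loop_mean V r)"
proof -
  have "(\<Sum>v\<in>V. real (r v) * real (d - 1 - r v)) = (\<Sum>v\<in>V. (real d - 2) * real (r v) - 2 * real (r v choose 2))"
  proof (rule sum.cong[OF refl])
    fix v assume "v \<in> V"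
    then have "r v \<le> d - 1" using r by simp
    then have "real (d - 1 - r v) = real d - 1 - real (r v)" using d by (simp add: of_nat_diff)
    moreover have "2 * real (r v choose 2) = real (r v) * (real (r v) - 1)" by (simp add: real_choose_two)
    ultimately show "real (r v) * real (d - 1 - r v) = (real d - 2) * real (r v) - 2 * real (r v choose 2)"
      by (simp only: left_diff_distrib right_diff_distrib mult.commute)
  qed
  also have "\<dots> = (real d - 2) * real (half_edges V r) - 2 * loop_choices V r"
    by (simp add: half_edges_def loop_choices_def sum_subtractf sum_distrib_left)
  also have "\<dots> = real (half_edges V r) * (real d - 2 - 2 * loop_mean V r)"
    using N by (simp add: loop_mean_def right_diff_distrib mult.commute)
  finally show ?thesis .
qed

lemma tree_mean_edge_mean:
  fixes r :: "'a \<Rightarrow> nat"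
  assumes V: "finite V" "card V \<ge> 3" and d: "d \<ge> 2" and r: "\<forall>v\<in>V. r v \<le> d - 1"
    and N: "half_edges V r = (d - 2) * card V + 2"
  shows "tree_mean V (\<lambda>v. d - 1 - r v) (\<lambda>T. edge_mean V T r) =
    (real (half_edges V r) * (real d - 2 - 2 * loop_mean V r) -
      (\<Sum>v\<in>V. (real (r v))\<^sup>2 * real (d - 1 - r v)) / real (half_edges V r)) / (real (card V) - 2)"
proof -
  let ?e = "\<lambda>v. d - 1 - r v" and ?N = "real (half_edges V r)"
  have half_edges_pos: "half_edges V r > 0" using N by simp
  have "tree_mean V ?e (\<lambda>T. edge_mean V T r) = tree_mean V ?e (\<lambda>T. \<Sum>f\<in>T. (\<Prod>v\<in>f. real (r v)) / ?N)"
    by (simp add: edge_mean_def edge_choices_def sum_divide_distrib)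
  also have "\<dots> = (\<Sum>f\<in>[V]\<^bsup>2\<^esup>. (\<Prod>v\<in>f. real (r v)) * (\<Sum>v\<in>f. real (?e v))) / ?N / (real (card V) - 2)"
    using sum_excess_degrees[OF r d N]
    by (subst tree_mean_edge_sum[OF V]) (simp_all add: sum_divide_distrib)
  also have "(\<Sum>f\<in>[V]\<^bsup>2\<^esup>. (\<Prod>v\<in>f. real (r v)) * (\<Sum>v\<in>f. real (?e v))) =
      ?N * (?N * (real d - 2 - 2 * loop_mean V r)) - (\<Sum>v\<in>V. (real (r v))\<^sup>2 * real (?e v))"
    unfolding sum_nsets_2_prod_sum[OF V(1)] using sum_residual_times_excess[OF V(1) r _ half_edges_pos] d
    by (simp add: half_edges_def)
  also have "\<dots> / ?N = ?N * (real d - 2 - 2 * loop_mean V r) - (\<Sum>v\<in>V. (real (r v))\<^sup>2 * real (?e v)) / ?N"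
    using half_edges_pos by (simp add: diff_divide_distrib)
  finally show ?thesis .
qed

lemma card_le_half_edges:
  assumes "d \<ge> 3" "half_edges V r = (d - 2) * card V + 2"
  shows "card V \<le> half_edges V r"
  using mult_le_mono1[of 1 "d - 2" "card V"] assms by linarith

lemma mean_excess_bounds:
  assumes V: "finite V" and d: "d \<ge> 1" and r: "\<forall>v\<in>V. r v \<le> d - 1" and N: "half_edges V r > 0"
  shows "0 \<le> real d - 2 - 2 * loop_mean V r" "real d - 2 - 2 * loop_mean V r \<le> real d"
proof -
  have "0 \<le> (\<Sum>v\<in>V. real (r v) * real (d - 1 - r v))" by (intro sum_nonneg) auto
  then have "0 \<le> real (half_edges V r) * (real d - 2 - 2 * loop_mean V r)"
    using sum_residual_times_excess[OF V r d N] by simp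
  then show "0 \<le> real d - 2 - 2 * loop_mean V r" using N by (simp add: zero_le_mult_iff)
  show "real d - 2 - 2 * loop_mean V r \<le> real d" using loop_mean_bounds(1)[OF r] by simp
qed

lemma sum_residual_square_excess_le:
  assumes d: "d \<ge> 3" and r: "\<forall>v\<in>V. r v \<le> d - 1" and N: "half_edges V r = (d - 2) * card V + 2"
  shows "(\<Sum>v\<in>V. (real (r v))\<^sup>2 * real (d - 1 - r v)) / real (half_edges V r) \<le> real d ^ 3"
proof -
  have "(\<Sum>v\<in>V. (real (r v))\<^sup>2 * real (d - 1 - r v)) \<le> (\<Sum>v\<in>V. (real d)\<^sup>2 * real d)"
    using r by (intro sum_mono mult_mono power_mono) (auto intro: order_trans)
  also have "\<dots> = real (card V) * real d ^ 3" by (simp add: power2_eq_square power3_eq_cube)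
  also have "\<dots> \<le> real (half_edges V r) * real d ^ 3"
    using card_le_half_edges[OF d N] by (intro mult_right_mono) auto
  finally show ?thesis using N by (simp add: divide_le_eq mult.commute del: of_nat_add of_nat_mult)
qed

lemma tree_mean_edge_mean_dist_le:
  fixes r :: "'a \<Rightarrow> nat"
  assumes V: "finite V" "card V \<ge> 4" and d: "d \<ge> 3" and r: "\<forall>v\<in>V. r v \<le> d - 1"
    and N: "half_edges V r = (d - 2) * card V + 2"
  shows "\<bar>tree_mean V (\<lambda>v. d - 1 - r v) (\<lambda>T. edge_mean V T r) -
      (real d - 2) * (real d - 2 - 2 * loop_mean V r)\<bar> \<le> 2 * real d ^ 3 / real (card V)"
proof -
  let ?N = "real (half_edges V r)" and ?y = "real d - 2 - 2 * loop_mean V r"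
  define p where "p = real (card V) - 2"
  define R where "R = (\<Sum>v\<in>V. (real (r v))\<^sup>2 * real (d - 1 - r v)) / ?N"
  have p: "p \<ge> real (card V) / 2" "p > 0" using V(2) by (simp_all add: p_def)
  have y: "0 \<le> ?y" "?y \<le> real d" using mean_excess_bounds[OF V(1) _ r] d N by simp_all
  have "?N = (real d - 2) * p + (2 * real d - 2)" using d by (simp add: N p_def of_nat_diff algebra_simps)
  moreover have "tree_mean V (\<lambda>v. d - 1 - r v) (\<lambda>T. edge_mean V T r) = (?N * ?y - R) / p"
    unfolding R_def p_def using tree_mean_edge_mean[OF V(1) _ _ r N] V(2) d by simp
  ultimately have dist: "tree_mean V (\<lambda>v. d - 1 - r v) (\<lambda>T. edge_mean V T r) - (real d - 2) * ?y =
      ((2 * real d - 2) * ?y - R) / p"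
    using p(2) by (simp add: distrib_right add_divide_distrib diff_divide_distrib)
  have "0 \<le> (2 * real d - 2) * ?y" using y d by simp
  moreover have "(2 * real d - 2) * ?y \<le> real d ^ 3"
  proof -
    have "3 * real d \<le> real d * real d" using d by (intro mult_right_mono) auto
    then have "2 * real d - 2 \<le> real d * real d" by linarith
    then have "(2 * real d - 2) * ?y \<le> (real d * real d) * real d" using y by (intro mult_mono) auto
    then show ?thesis by (simp add: power3_eq_cube)
  qed
  moreover have "0 \<le> R" unfolding R_def by (intro divide_nonneg_nonneg sum_nonneg) auto
  moreover have "R \<le> real d ^ 3" unfolding R_def by (rule sum_residual_square_excess_le[OF d r N])
  ultimately have "\<bar>(2 * real d - 2) * ?y - R\<bar> \<le> real d ^ 3" by (simp add: abs_le_iff)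
  then have "\<bar>((2 * real d - 2) * ?y - R) / p\<bar> \<le> real d ^ 3 / p" using p(2) by (simp add: abs_divide divide_right_mono)
  also have "\<dots> \<le> real d ^ 3 / (real (card V) / 2)" using p V(2) by (intro divide_left_mono) auto
  finally show ?thesis unfolding dist by (simp add: mult.commute)
qed

lemma tree_mean_edge_mean_square_le:
  fixes r :: "'a \<Rightarrow> nat"
  assumes V: "finite V" "card V \<ge> 4" and d: "d \<ge> 3" and r: "\<forall>v\<in>V. r v \<le> d - 1"
    and N: "half_edges V r = (d - 2) * card V + 2"
  shows "(tree_mean V (\<lambda>v. d - 1 - r v) (\<lambda>T. edge_mean V T r))\<^sup>2 \<le> real d ^ 6"
proof -
  let ?K = "tree_mean V (\<lambda>v. d - 1 - r v) (\<lambda>T. edge_mean V T r)"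
  let ?c = "(real d - 2) * (real d - 2 - 2 * loop_mean V r)"
  have "0 \<le> ?c" "?c \<le> real d * real d"
    using d mean_excess_bounds[OF V(1) _ r] N by (auto intro!: mult_nonneg_nonneg mult_mono)
  moreover have "2 * real d ^ 3 / real (card V) \<le> 2 * real d ^ 3 / 4" using V(2) by (intro divide_left_mono) auto
  moreover have "3 * (real d * real d) \<le> real d * (real d * real d)" using d by (intro mult_right_mono) auto
  ultimately have "\<bar>?K\<bar> \<le> real d ^ 3"
    using tree_mean_edge_mean_dist_le[OF assms] by (simp add: power3_eq_cube mult.assoc)
  from power_mono[OF this abs_ge_zero, of 2] show ?thesis by (simp flip: power_mult)
qed

lemma edge_mean_concentration:
  fixes r :: "'a \<Rightarrow> nat"
  assumes V: "finite V" "card V \<ge> 4" and d: "d \<ge> 3" and r: "\<forall>v\<in>V. r v \<le> d - 1"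
    and N: "half_edges V r = (d - 2) * card V + 2"
  shows "tree_mean V (\<lambda>v. d - 1 - r v)
      (\<lambda>T. (edge_mean V T r - (real d - 2) * (real d - 2 - 2 * loop_mean V r))\<^sup>2) \<le> 6 * real d ^ 6 / real (card V)"
proof -
  let ?e = "\<lambda>v. d - 1 - r v" and ?m = "real (card V)"
  define a where "a f = (\<Prod>v\<in>f. real (r v)) / real (half_edges V r)" for f
  define c where "c = (real d - 2) * (real d - 2 - 2 * loop_mean V r)"
  define K where "K = tree_mean V ?e (\<lambda>T. edge_mean V T r)"
  have m: "?m \<ge> 4" using V(2) by simp
  have a_eq: "(\<Sum>f\<in>T. a f) = edge_mean V T r" for T
    by (simp add: a_def edge_mean_def edge_choices_def sum_divide_distrib)
  have "0 \<le> a f \<and> a f \<le> real d ^ 2 / ?m" if "f \<in> [V]\<^bsup>2\<^esup>" for f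
  proof -
    have "(\<Prod>v\<in>f. real (r v)) \<le> (\<Prod>v\<in>f. real d)"
      using that r by (intro prod_mono) (fastforce simp: nsets_def)
    also have "\<dots> = real d ^ 2" using that by (simp add: nsets_def)
    finally show ?thesis using card_le_half_edges[OF d N] m by (auto simp: a_def prod_nonneg intro!: frac_le)
  qed
  moreover have "d - 1 - r v < d" for v using d by simp
  ultimately have "tree_mean V ?e (\<lambda>T. (edge_mean V T r - c)\<^sup>2) \<le>
      K\<^sup>2 / (?m - 3) + (real d ^ 2 / ?m)\<^sup>2 * (?m * real d ^ 2) + (K - c)\<^sup>2"
    using sum_excess_degrees[OF r _ N] d
    by (intro tree_mean_edge_sum_square_dist_le[OF V, of ?e d a, unfolded a_eq]) (auto simp: K_def)
  moreover have "(real d ^ 2 / ?m)\<^sup>2 * (?m * real d ^ 2) = real d ^ 6 / ?m"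
    using m by (simp add: power2_eq_square eval_nat_numeral)
  moreover have "K\<^sup>2 / (?m - 3) \<le> real d ^ 6 / (?m / 4)"
    unfolding K_def using m by (intro frac_le tree_mean_edge_mean_square_le assms) auto
  then have "K\<^sup>2 / (?m - 3) \<le> 4 * real d ^ 6 / ?m" by (simp add: mult.commute)
  moreover have "(K - c)\<^sup>2 \<le> real d ^ 6 / ?m"
  proof -
    have "\<bar>K - c\<bar> \<le> 2 * real d ^ 3 / ?m" unfolding K_def c_def by (rule tree_mean_edge_mean_dist_le[OF assms])
    then have "(K - c)\<^sup>2 \<le> (2 * real d ^ 3 / ?m)\<^sup>2" using m by (simp flip: abs_le_square_iff)
    also have "\<dots> = real d ^ 6 / ?m * (4 / ?m)" by (simp add: power2_eq_square eval_nat_numeral)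
    also have "\<dots> \<le> real d ^ 6 / ?m * 1" using m by (intro mult_left_mono) auto
    finally show ?thesis by simp
  qed
  ultimately show ?thesis unfolding c_def by simp
qed

section \<open>Random degree sequences\<close>

definition degree_seqs :: "'a set \<Rightarrow> ('a \<Rightarrow> nat) \<Rightarrow> nat \<Rightarrow> ('a \<Rightarrow> nat) set" where
  "degree_seqs V c s = {r. (\<forall>v. v \<notin> V \<longrightarrow> r v = 0) \<and> (\<forall>v\<in>V. r v \<le> c v) \<and> half_edges V r = s}"

definition seq_weight :: "'a set \<Rightarrow> ('a \<Rightarrow> nat) \<Rightarrow> ('a \<Rightarrow> nat) \<Rightarrow> real" where
  "seq_weight V c r = (\<Prod>v\<in>V. real (c v choose r v))"

definition seq_mean :: "'a set \<Rightarrow> ('a \<Rightarrow> nat) \<Rightarrow> nat \<Rightarrow> (('a \<Rightarrow> nat) \<Rightarrow> real) \<Rightarrow> real" where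
  "seq_mean V c s = weighted_mean (degree_seqs V c s) (seq_weight V c)"

lemma finite_degree_seqs:
  assumes "finite V"
  shows "finite (degree_seqs V c s)"
proof (rule finite_subset)
  show "degree_seqs V c s \<subseteq> {r. \<forall>v. (v \<in> V \<longrightarrow> r v \<in> {..s}) \<and> (v \<notin> V \<longrightarrow> r v = 0)}"
    using assms by (auto simp: degree_seqs_def half_edges_def intro: member_le_sum)
  show "finite {r. \<forall>v. (v \<in> V \<longrightarrow> r v \<in> {..s}) \<and> (v \<notin> V \<longrightarrow> r v = (0::nat))}"
    by (rule finite_set_of_finite_funs) (use assms in auto)
qed

lemma seq_weight_nonneg: "seq_weight V c r \<ge> 0"
  unfolding seq_weight_def by (intro prod_nonneg) auto

lemma sum_seq_weight_insert:
  assumes V: "finite V" "v \<notin> V"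
  shows "sum (seq_weight (insert v V) c) (degree_seqs (insert v V) c s) =
    (\<Sum>j\<le>s. real (c v choose j) * sum (seq_weight V c) (degree_seqs V c (s - j)))"
proof -
  have rest: "half_edges V (r(v := j)) = half_edges V r" "seq_weight V c (r(v := j)) = seq_weight V c r" for r :: "'a \<Rightarrow> nat" and j
    using V(2) by (auto simp: half_edges_def seq_weight_def intro!: sum.cong prod.cong)
  have "sum (seq_weight (insert v V) c) (degree_seqs (insert v V) c s) =
      (\<Sum>(j, r)\<in>(SIGMA j:{..s} \<inter> {..c v}. degree_seqs V c (s - j)). real (c v choose j) * seq_weight V c r)"
  proof (rule sum.reindex_bij_witness[of _ "\<lambda>(j, r). r(v := j)" "\<lambda>r. (r v, r(v := 0))"])
    fix r assume "r \<in> degree_seqs (insert v V) c s"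
    then have "r v + half_edges V r = s" "r v \<le> c v" "\<forall>w. w \<notin> insert v V \<longrightarrow> r w = 0" "\<forall>w\<in>V. r w \<le> c w"
      using V by (auto simp: degree_seqs_def half_edges_def)
    then show "(r v, r(v := 0)) \<in> (SIGMA j:{..s} \<inter> {..c v}. degree_seqs V c (s - j))"
      by (auto simp: degree_seqs_def rest)
    show "(case (r v, r(v := 0)) of (j, r) \<Rightarrow> real (c v choose j) * seq_weight V c r) = seq_weight (insert v V) c r"
      using V by (simp add: rest) (simp add: seq_weight_def)
  next
    fix x assume "x \<in> (SIGMA j:{..s} \<inter> {..c v}. degree_seqs V c (s - j))"
    then obtain j r where x: "x = (j, r)" "j \<le> s" "j \<le> c v" "r \<in> degree_seqs V c (s - j)" by auto
    have "half_edges (insert v V) (r(v := j)) = j + half_edges V r"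
      using V rest(1)[of r j] by (simp add: half_edges_def)
    then show "(case x of (j, r) \<Rightarrow> r(v := j)) \<in> degree_seqs (insert v V) c s"
      using x V(2) by (auto simp: degree_seqs_def)
    have "r v = 0" using x V(2) by (simp add: degree_seqs_def)
    then show "((case x of (j, r) \<Rightarrow> r(v := j)) v, (case x of (j, r) \<Rightarrow> r(v := j))(v := 0)) = x"
      using x by (auto simp: fun_upd_idem)
  qed auto
  also have "\<dots> = (\<Sum>j\<in>{..s} \<inter> {..c v}. real (c v choose j) * sum (seq_weight V c) (degree_seqs V c (s - j)))"
    using finite_degree_seqs[OF V(1)] by (simp add: sum.Sigma[symmetric] sum_distrib_left)
  also have "\<dots> = (\<Sum>j\<le>s. real (c v choose j) * sum (seq_weight V c) (degree_seqs V c (s - j)))"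
    by (intro sum.mono_neutral_left) auto
  finally show ?thesis .
qed

lemma sum_seq_weight:
  assumes "finite V"
  shows "sum (seq_weight V c) (degree_seqs V c s) = real ((\<Sum>v\<in>V. c v) choose s)"
  using assms
proof (induction V arbitrary: s rule: finite_induct)
  case empty
  have "degree_seqs {} c s = (if s = 0 then {\<lambda>_. 0} else {})"
    by (auto simp: degree_seqs_def half_edges_def)
  then show ?case by (simp add: seq_weight_def)
next
  case (insert v V)
  have "sum (seq_weight (insert v V) c) (degree_seqs (insert v V) c s) =
      real (\<Sum>j\<le>s. (c v choose j) * ((\<Sum>v\<in>V. c v) choose (s - j)))"
    using insert by (simp add: sum_seq_weight_insert)
  then show ?case using insert by (simp add: vandermonde)
qed

lemma sum_seq_weight_prod_choose:
  assumes V: "finite V" and k: "\<forall>v\<in>V. k v \<le> c v" and s: "(\<Sum>v\<in>V. k v) \<le> s"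
  shows "(\<Sum>r\<in>degree_seqs V c s. seq_weight V c r * (\<Prod>v\<in>V. real (r v choose k v))) =
    (\<Prod>v\<in>V. real (c v choose k v)) * real (((\<Sum>v\<in>V. c v) - (\<Sum>v\<in>V. k v)) choose (s - (\<Sum>v\<in>V. k v)))"
proof -
  let ?c = "\<lambda>v. c v - k v" and ?K = "\<Sum>v\<in>V. k v"
  have "(\<Sum>r\<in>degree_seqs V c s. seq_weight V c r * (\<Prod>v\<in>V. real (r v choose k v))) =
      (\<Sum>r\<in>{r \<in> degree_seqs V c s. \<forall>v\<in>V. k v \<le> r v}. seq_weight V c r * (\<Prod>v\<in>V. real (r v choose k v)))"
    using V finite_degree_seqs[OF V] by (intro sum.mono_neutral_right) (auto simp: not_le)
  also have "\<dots> = (\<Sum>r\<in>degree_seqs V ?c (s - ?K). (\<Prod>v\<in>V. real (c v choose k v)) * seq_weight V ?c r)"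
  proof (rule sum.reindex_bij_witness[of _ "\<lambda>r v. if v \<in> V then r v + k v else 0" "\<lambda>r v. if v \<in> V then r v - k v else 0"])
    fix r assume "r \<in> {r \<in> degree_seqs V c s. \<forall>v\<in>V. k v \<le> r v}"
    then have r: "\<forall>v. v \<notin> V \<longrightarrow> r v = 0" "\<forall>v\<in>V. r v \<le> c v" "(\<Sum>v\<in>V. r v) = s" "\<forall>v\<in>V. k v \<le> r v"
      by (auto simp: degree_seqs_def half_edges_def)
    show "(\<lambda>v. if v \<in> V then (if v \<in> V then r v - k v else 0) + k v else 0) = r" using r by auto
    show "(\<lambda>v. if v \<in> V then r v - k v else 0) \<in> degree_seqs V ?c (s - ?K)"
      using r by (auto simp: degree_seqs_def half_edges_def sum_subtractf_nat)
    have "real (c v choose r v) * real (r v choose k v) = real (c v choose k v) * real (?c v choose (r v - k v))" if "v \<in> V" for v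
      using choose_mult[of "k v" "r v" "c v"] r that by (simp flip: of_nat_mult)
    then show "(\<Prod>v\<in>V. real (c v choose k v)) * seq_weight V ?c (\<lambda>v. if v \<in> V then r v - k v else 0) =
        seq_weight V c r * (\<Prod>v\<in>V. real (r v choose k v))"
      by (simp add: seq_weight_def flip: prod.distrib)
  next
    fix r assume r: "r \<in> degree_seqs V ?c (s - ?K)"
    then show "(\<lambda>v. if v \<in> V then (if v \<in> V then r v + k v else 0) - k v else 0) = r"
      by (auto simp: degree_seqs_def)
    show "(\<lambda>v. if v \<in> V then r v + k v else 0) \<in> {r \<in> degree_seqs V c s. \<forall>v\<in>V. k v \<le> r v}"
      using r k s by (auto simp: degree_seqs_def half_edges_def sum.distrib le_diff_conv2)
  qed
  also have "\<dots> = (\<Prod>v\<in>V. real (c v choose k v)) * real ((\<Sum>v\<in>V. ?c v) choose (s - ?K))"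
    by (simp add: sum_seq_weight[OF V] flip: sum_distrib_left)
  also have "(\<Sum>v\<in>V. ?c v) = (\<Sum>v\<in>V. c v) - ?K" using k by (simp add: sum_subtractf_nat)
  finally show ?thesis .
qed

lemma binomial_ratio_2:
  assumes "2 \<le> s" "s \<le> D"
  shows "real ((D - 2) choose (s - 2)) / real (D choose s) = real (s choose 2) / real (D choose 2)"
proof -
  have "real (D choose s) * real (s choose 2) = real (D choose 2) * real ((D - 2) choose (s - 2))"
    using choose_mult[OF assms] by (simp flip: of_nat_mult)
  moreover have "D choose s > 0" "D choose 2 > 0" using assms by auto
  ultimately show ?thesis by (simp add: field_simps)
qed

lemma binomial_ratio_2_mono:
  assumes "4 \<le> s" "s \<le> D"
  shows "real ((s - 2) choose 2) / real ((D - 2) choose 2) \<le> real (s choose 2) / real (D choose 2)"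
proof -
  have frac: "(real s - j - 2) / (real D - j - 2) \<le> (real s - j) / (real D - j)" if "j \<le> 1" for j
    using assms that by (simp add: field_simps)
  have "real ((s - 2) choose 2) / real ((D - 2) choose 2) =
      ((real s - 0 - 2) / (real D - 0 - 2)) * ((real s - 1 - 2) / (real D - 1 - 2))"
    using assms by (simp add: real_choose_two of_nat_diff)
  also have "\<dots> \<le> ((real s - 0) / (real D - 0)) * ((real s - 1) / (real D - 1))"
    using assms by (intro mult_mono frac) auto
  finally show ?thesis by (simp add: real_choose_two)
qed

lemma seq_mean_choose_two:
  assumes V: "finite V" and v: "v \<in> V" and k: "2 \<le> k" and s: "2 \<le> s" "s \<le> k * card V"
  shows "seq_mean V (\<lambda>_. k) s (\<lambda>r. real (r v choose 2)) =
    real (k choose 2) * (real (s choose 2) / real ((k * card V) choose 2))"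
proof -
  let ?j = "(\<lambda>_. 0)(v := 2 :: nat)"
  have "(\<Sum>w\<in>V. ?j w) = 2" using V v by (simp add: sum.remove)
  moreover have "(\<Prod>w\<in>V. real (x w choose ?j w)) = real (x v choose 2)" for x
    using V v by (simp add: prod.remove)
  ultimately have "seq_mean V (\<lambda>_. k) s (\<lambda>r. real (r v choose 2)) =
      real (k choose 2) * (real ((k * card V - 2) choose (s - 2)) / real ((k * card V) choose s))"
    using sum_seq_weight_prod_choose[OF V, of ?j "\<lambda>_. k" s] k s
    by (simp add: seq_mean_def weighted_mean_def sum_seq_weight[OF V] mult.commute)
  then show ?thesis unfolding binomial_ratio_2[OF s] .
qed

lemma seq_mean_choose_two_twice_le:
  assumes V: "finite V" and uv: "u \<in> V" "v \<in> V" "u \<noteq> v" and k: "2 \<le> k" and s: "4 \<le> s" "s \<le> k * card V"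
  shows "seq_mean V (\<lambda>_. k) s (\<lambda>r. real (r u choose 2) * real (r v choose 2)) \<le>
    (real (k choose 2) * (real (s choose 2) / real ((k * card V) choose 2)))\<^sup>2"
proof -
  let ?j = "(\<lambda>_. 0)(u := 2 :: nat, v := 2)" and ?D = "k * card V"
  let ?\<rho> = "real (s choose 2) / real (?D choose 2)"
  have "(\<Sum>w\<in>V. ?j w) = (\<Sum>w\<in>{u, v}. ?j w)" using V uv by (intro sum.mono_neutral_right) auto
  then have "(\<Sum>w\<in>V. ?j w) = 4" using uv by simp
  moreover have "(\<Prod>w\<in>V. real (x w choose ?j w)) = real (x u choose 2) * real (x v choose 2)" for x
  proof -
    have "(\<Prod>w\<in>V. real (x w choose ?j w)) = (\<Prod>w\<in>{u, v}. real (x w choose ?j w))"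
      using V uv by (intro prod.mono_neutral_right) auto
    then show ?thesis using uv by simp
  qed
  ultimately have "seq_mean V (\<lambda>_. k) s (\<lambda>r. real (r u choose 2) * real (r v choose 2)) =
      (real (k choose 2))\<^sup>2 * (real ((?D - 4) choose (s - 4)) / real (?D choose s))"
    using sum_seq_weight_prod_choose[OF V, of ?j "\<lambda>_. k" s] k s
    by (simp add: seq_mean_def weighted_mean_def sum_seq_weight[OF V] mult.commute power2_eq_square)
  moreover have "real ((?D - 4) choose (s - 4)) / real (?D choose s) \<le> ?\<rho> * ?\<rho>"
  proof -
    have "real ((?D - 4) choose (s - 4)) / real (?D choose s) =
        (real ((?D - 2 - 2) choose (s - 2 - 2)) / real ((?D - 2) choose (s - 2))) *
        (real ((?D - 2) choose (s - 2)) / real (?D choose s))"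
      using s by simp
    also have "\<dots> = (real ((s - 2) choose 2) / real ((?D - 2) choose 2)) * ?\<rho>"
      using s by (subst binomial_ratio_2, simp, simp, subst binomial_ratio_2) auto
    also have "\<dots> \<le> ?\<rho> * ?\<rho>" using binomial_ratio_2_mono[OF s] by (intro mult_right_mono) auto
    finally show ?thesis .
  qed
  ultimately show ?thesis unfolding power_mult_distrib power2_eq_square[of ?\<rho>] by (simp only: mult_left_mono zero_le_power2)
qed

lemma seq_weight_total_nonzero:
  assumes "finite V" "s \<le> k * card V"
  shows "sum (seq_weight V (\<lambda>_. k)) (degree_seqs V (\<lambda>_. k) s) \<noteq> 0"
  using assms by (simp add: sum_seq_weight mult.commute)

lemma seq_mean_loop_choices:
  assumes V: "finite V" and k: "2 \<le> k" and s: "2 \<le> s" "s \<le> k * card V"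
  shows "seq_mean V (\<lambda>_. k) s (loop_choices V) =
    real (card V) * (real (k choose 2) * (real (s choose 2) / real ((k * card V) choose 2)))"
proof -
  have "seq_mean V (\<lambda>_. k) s (loop_choices V) = (\<Sum>v\<in>V. seq_mean V (\<lambda>_. k) s (\<lambda>r. real (r v choose 2)))"
    unfolding seq_mean_def loop_choices_def[abs_def] by (rule weighted_mean_sum)
  then show ?thesis using s by (simp add: seq_mean_choose_two[OF V _ k])
qed

lemma seq_mean_choose_two_square_le:
  assumes V: "finite V" and v: "v \<in> V" and s: "s \<le> k * card V"
  shows "seq_mean V (\<lambda>_. k) s (\<lambda>r. real (r v choose 2) * real (r v choose 2)) \<le> real k ^ 4"
proof -
  have "real (r v choose 2) * real (r v choose 2) \<le> real k ^ 4" if "r \<in> degree_seqs V (\<lambda>_. k) s" for r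
  proof -
    have degree_le: "r v \<le> k" using that v by (auto simp: degree_seqs_def)
    have "real (r v choose 2) \<le> real k * real (r v)" by (rule choose_two_le[OF degree_le])
    also have "\<dots> \<le> real k * real k" using degree_le by (intro mult_left_mono) auto
    finally have choose_le: "real (r v choose 2) \<le> real k * real k" .
    from mult_mono[OF choose_le choose_le] show ?thesis by (simp add: power4_eq_xxxx mult.assoc)
  qed
  then have "seq_mean V (\<lambda>_. k) s (\<lambda>r. real (r v choose 2) * real (r v choose 2)) \<le> seq_mean V (\<lambda>_. k) s (\<lambda>_. real k ^ 4)"
    unfolding seq_mean_def by (intro weighted_mean_mono seq_weight_nonneg)
  then show ?thesis unfolding seq_mean_def weighted_mean_const[OF seq_weight_total_nonzero[OF V s]] .
qed

lemma seq_mean_loop_choices_square_le: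
  assumes V: "finite V" and k: "2 \<le> k" and s: "4 \<le> s" "s \<le> k * card V"
  shows "seq_mean V (\<lambda>_. k) s (\<lambda>r. (loop_choices V r)\<^sup>2) \<le>
    (seq_mean V (\<lambda>_. k) s (loop_choices V))\<^sup>2 + real (card V) * real k ^ 4"
proof -
  let ?E = "seq_mean V (\<lambda>_. k) s"
  define p where "p = real (k choose 2) * (real (s choose 2) / real ((k * card V) choose 2))"
  have sum: "?E (\<lambda>r. \<Sum>i\<in>I. f i r) = (\<Sum>i\<in>I. ?E (f i))" for f and I :: "'a set"
    unfolding seq_mean_def by (rule weighted_mean_sum)
  have "?E (\<lambda>r. (loop_choices V r)\<^sup>2) = (\<Sum>u\<in>V. \<Sum>v\<in>V. ?E (\<lambda>r. real (r u choose 2) * real (r v choose 2)))"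
    unfolding loop_choices_def power2_eq_square sum_product sum ..
  also have "\<dots> \<le> (\<Sum>u\<in>V. \<Sum>v\<in>V. p\<^sup>2 + (if v = u then real k ^ 4 else 0))"
  proof (intro sum_mono)
    fix u v assume "u \<in> V" "v \<in> V"
    then show "?E (\<lambda>r. real (r u choose 2) * real (r v choose 2)) \<le> p\<^sup>2 + (if v = u then real k ^ 4 else 0)"
      using seq_mean_choose_two_square_le[OF V _ s(2), of v] seq_mean_choose_two_twice_le[OF V _ _ _ k s, of u v]
      by (cases "v = u") (auto simp: p_def intro: add_increasing)
  qed
  also have "\<dots> = (?E (loop_choices V))\<^sup>2 + real (card V) * real k ^ 4"
    using V seq_mean_loop_choices[OF V k _ s(2)] s(1)
    by (simp add: p_def sum.distrib power_mult_distrib power2_eq_square distrib_left)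
  finally show ?thesis .
qed
lemma loop_mean_limit_dist_le:
  fixes k m s :: nat
  assumes k: "2 \<le> k" and m: "2 \<le> m" and s: "s = (k - 1) * m + 2"
  shows "\<bar>real m * (real (k choose 2) * (real (s choose 2) / real ((k * m) choose 2))) / real s - (real k - 1)\<^sup>2 / (2 * real k)\<bar>
    \<le> 1 / real m"
proof -
  define y where "y = real k"
  define z where "z = y * real m - 1"
  have y: "y \<ge> 2" and m: "real m \<ge> 2" using k m by (auto simp: y_def)
  have "2 * 2 \<le> y * real m" using y m by (intro mult_mono) auto
  then have z: "z > 0" by (simp add: z_def)
  have s1: "real s - 1 = (y - 1) * real m + 1" using k by (simp add: s y_def of_nat_diff)
  have s0: "real s > 0" by (simp add: s del: of_nat_mult)
  have "real m * (real (k choose 2) * (real (s choose 2) / real ((k * m) choose 2))) / real s =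
      (y - 1) * (real s - 1) / (2 * z)"
    using s0 y m z by (simp add: real_choose_two y_def z_def)
  also have "(y - 1) * (real s - 1) / (2 * z) - (y - 1)\<^sup>2 / (2 * y) = (y - 1) * (2 * y - 1) / (2 * y * z)"
  proof -
    have "y * (real s - 1) = (y - 1) * z + (2 * y - 1)" unfolding s1 z_def by (simp add: algebra_simps)
    then have s_eq: "real s - 1 = ((y - 1) * z + (2 * y - 1)) / y" using y by (simp add: nonzero_eq_divide_eq mult.commute)
    show ?thesis unfolding s_eq using y z by (simp add: field_simps power2_eq_square)
  qed
  also have "\<bar>\<dots>\<bar> \<le> 1 / real m"
  proof -
    have "2 * y \<le> (3 * y - 1) * 1" using y by simp
    also have "\<dots> \<le> (3 * y - 1) * real m" using y m by (intro mult_left_mono) auto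
    finally have "2 * y \<le> (3 * y - 1) * real m" .
    moreover have "(y - 1) * (2 * y - 1) * real m = 2 * y * z - ((3 * y - 1) * real m - 2 * y)"
      by (simp add: z_def algebra_simps)
    ultimately have "(y - 1) * (2 * y - 1) * real m \<le> 2 * y * z" by simp
    moreover have "0 \<le> (y - 1) * (2 * y - 1) / (2 * y * z)" using y z by simp
    ultimately show ?thesis using y z m by (simp only: abs_of_nonneg) (simp add: field_simps)
  qed
  finally show ?thesis by (simp add: y_def)
qed

lemma loop_mean_concentration:
  assumes V: "finite V" "2 \<le> card V" and k: "2 \<le> k" and s: "s = (k - 1) * card V + 2"
  shows "seq_mean V (\<lambda>_. k) s (\<lambda>r. (loop_mean V r - (real k - 1)\<^sup>2 / (2 * real k))\<^sup>2) \<le> 2 * real k ^ 4 / real (card V)"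
proof -
  let ?E = "seq_mean V (\<lambda>_. k) s" and ?m = "real (card V)"
  define A where "A = ?E (loop_choices V)"
  define c where "c = (real k - 1)\<^sup>2 / (2 * real k)"
  have m: "?m \<ge> 2" using V(2) by simp
  have "1 * card V \<le> (k - 1) * card V" using k by (intro mult_right_mono) auto
  then have s_bounds: "4 \<le> s" "card V \<le> s" using V(2) s by linarith+
  have "k * card V = (k - 1) * card V + card V" using k by (metis One_nat_def Suc_pred add.commute less_le_trans mult_Suc pos2)
  then have sk: "s \<le> k * card V" using V(2) s by linarith
  note total = seq_weight_total_nonzero[OF V(1) sk]
  have "?E (\<lambda>r. (loop_mean V r - c)\<^sup>2) = ?E (\<lambda>r. (loop_choices V r / real s - c)\<^sup>2)"
    unfolding seq_mean_def by (intro weighted_mean_cong) (simp add: degree_seqs_def loop_mean_def)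
  also have "\<dots> = ?E (\<lambda>r. (1 / (real s)\<^sup>2) * (loop_choices V r)\<^sup>2) - 2 * c * ?E (\<lambda>r. (1 / real s) * loop_choices V r) + c\<^sup>2"
    unfolding seq_mean_def weighted_mean_square_dist[OF total] by (simp add: power_divide)
  also have "\<dots> = ?E (\<lambda>r. (loop_choices V r)\<^sup>2) / (real s)\<^sup>2 - 2 * c * (A / real s) + c\<^sup>2"
    unfolding A_def seq_mean_def weighted_mean_cmult by simp
  also have "\<dots> \<le> (A\<^sup>2 + ?m * real k ^ 4) / (real s)\<^sup>2 - 2 * c * (A / real s) + c\<^sup>2"
    unfolding A_def using seq_mean_loop_choices_square_le[OF V(1) k s_bounds(1) sk]
    by (intro add_right_mono diff_right_mono divide_right_mono) auto
  also have "\<dots> = ?m * real k ^ 4 / (real s)\<^sup>2 + (A / real s - c)\<^sup>2"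
    by (simp add: power2_diff power_divide add_divide_distrib)
  also have "\<dots> \<le> ?m * real k ^ 4 / (?m)\<^sup>2 + (1 / ?m)\<^sup>2"
  proof (rule add_mono)
    show "?m * real k ^ 4 / (real s)\<^sup>2 \<le> ?m * real k ^ 4 / ?m\<^sup>2"
      using s_bounds m by (intro divide_left_mono power_mono) auto
    show "(A / real s - c)\<^sup>2 \<le> (1 / ?m)\<^sup>2"
      using loop_mean_limit_dist_le[OF k V(2) s] seq_mean_loop_choices[OF V(1) k _ sk] s_bounds(1) m
      by (simp add: A_def c_def flip: abs_le_square_iff)
  qed
  also have "\<dots> \<le> real k ^ 4 / ?m + real k ^ 4 / ?m"
  proof (rule add_mono)
    have "(1 / ?m)\<^sup>2 \<le> 1 / ?m" using m by (simp add: power2_eq_square field_simps)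
    also have "\<dots> \<le> real k ^ 4 / ?m" using k m by (intro divide_right_mono one_le_power) auto
    finally show "(1 / ?m)\<^sup>2 \<le> real k ^ 4 / ?m" .
  qed (simp add: power2_eq_square)
  finally show ?thesis by (simp add: c_def)
qed

section \<open>Stirling's formula\<close>

definition stirling :: "real \<Rightarrow> real" where
  "stirling x = sqrt x * (x / exp 1) powr x"

lemma stirling_pos: "x > 0 \<Longrightarrow> stirling x > 0"
  by (simp add: stirling_def)

lemma ln_stirling: "x > 0 \<Longrightarrow> ln (stirling x) = ln x / 2 + x * (ln x - 1)"
  by (simp add: stirling_def ln_mult ln_sqrt ln_powr ln_div)

lemma fact_asymp_equiv_stirling:
  obtains c :: real where "c > 0" "(\<lambda>n. fact n) \<sim>[at_top] (\<lambda>n. c * stirling (real n))"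
proof -
  define a where "a n = ln (fact n) - ln (stirling (real n))" for n
  have "eventually (\<lambda>n. a (Suc n) - a n = 1 - (real n + 1/2) * (ln (real n + 1) - ln (real n))) at_top"
    using eventually_gt_at_top[of 0]
  proof eventually_elim
    case (elim n)
    have "ln (fact (Suc n)) = ln (real (Suc n)) + ln (fact n :: real)"
      by (subst fact_Suc) (simp add: ln_mult del: of_nat_Suc)
    with elim show ?case by (simp add: a_def ln_stirling algebra_simps del: fact_Suc)
  qed
  moreover have "(\<lambda>n. 1 - (real n + 1/2) * (ln (real n + 1) - ln (real n))) \<in> O(\<lambda>n. 1 / real n ^ 2)"
    by real_asymp
  ultimately have "(\<lambda>n. a (Suc n) - a n) \<in> O(\<lambda>n. 1 / real n ^ 2)" by (simp only: landau_o.big.in_cong)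
  moreover have "summable (\<lambda>n. norm (1 / real n ^ 2))"
    using inverse_power_summable[of 2, where ?'a = real] by (simp add: divide_inverse)
  ultimately have "summable (\<lambda>n. a (Suc n) - a n)" by (rule summable_comparison_test_bigo[rotated])
  then have "convergent a"
    unfolding summable_iff_convergent sum_lessThan_telescope convergent_diff_const_right_iff .
  then obtain l where "a \<longlonglongrightarrow> l" by (auto simp: convergent_def)
  then have "(\<lambda>n. exp (a n)) \<longlonglongrightarrow> exp l" by (intro tendsto_intros)
  moreover have "eventually (\<lambda>n. exp (a n) = fact n / stirling (real n)) at_top"
    using eventually_gt_at_top[of 0]
    by eventually_elim (simp add: a_def exp_diff stirling_pos)
  ultimately have "(\<lambda>n. fact n / stirling (real n)) \<longlonglongrightarrow> exp l" by (rule Lim_transform_eventually)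
  then have "(\<lambda>n. fact n) \<sim>[at_top] (\<lambda>n. exp l * stirling (real n))" by (intro asymp_equivI'_const) auto
  then show ?thesis using that[of "exp l"] by simp
qed

lemma stirling_quotient:
  fixes x \<nu> :: real
  assumes x: "x > 2" and \<nu>: "\<nu> > 0"
  shows "x powr \<nu> * 2 powr \<nu> / 2 * (stirling ((x - 1) * \<nu>) * stirling (x * \<nu> / 2) /
      ((x - 2) * \<nu> / 2 * stirling ((x - 2) * \<nu> / 2) * stirling (x * \<nu>))) =
    (x - 1) powr (1/2) / (\<nu> * (x - 2) powr (3/2)) *
      ((x - 1) powr (x - 1) / (x\<^sup>2 - 2 * x) powr (x / 2 - 1)) powr \<nu>" (is "?L = ?R")
proof -
  have square: "x\<^sup>2 - 2 * x = x * (x - 2)" by (simp add: power2_eq_square algebra_simps)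
  have pos: "(x - 1) * \<nu> > 0" "x * \<nu> / 2 > 0" "(x - 2) * \<nu> / 2 > 0" "x * \<nu> > 0"
    using x \<nu> by simp_all
  have logs: "ln ((x - 1) * \<nu>) = ln (x - 1) + ln \<nu>" "ln (x * \<nu> / 2) = ln x + ln \<nu> - ln 2"
    "ln ((x - 2) * \<nu> / 2) = ln (x - 2) + ln \<nu> - ln 2" "ln (x * \<nu>) = ln x + ln \<nu>"
    using x \<nu> by (simp_all add: ln_mult ln_div)
  have "ln ?L = \<nu> * ln x + \<nu> * ln 2 - ln 2 + (ln (stirling ((x - 1) * \<nu>)) + ln (stirling (x * \<nu> / 2)) -
      (ln ((x - 2) * \<nu> / 2) + ln (stirling ((x - 2) * \<nu> / 2)) + ln (stirling (x * \<nu>))))"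
    using x \<nu> pos[THEN stirling_pos] by (simp add: ln_mult_pos ln_divide_pos ln_powr)
  also have "\<dots> = ln (x - 1) / 2 - (ln \<nu> + 3 / 2 * ln (x - 2)) +
      \<nu> * ((x - 1) * ln (x - 1) - (x / 2 - 1) * (ln x + ln (x - 2)))"
    unfolding pos[THEN ln_stirling] logs by (simp add: field_simps)
  also have "\<dots> = ln ?R"
    unfolding square using x \<nu> by (simp add: ln_mult_pos ln_divide_pos ln_powr)
  finally have "ln ?L = ln ?R" .
  moreover have "?L > 0" using x \<nu> pos[THEN stirling_pos] by simp
  moreover have "?R > 0" unfolding square using x \<nu> by simp
  ultimately show ?thesis by (simp only: ln_inj_iff)
qed

section \<open>Spanning trees of regular graphs\<close>

lemma graph_degree_Un:
  assumes "finite E" "finite T" "E \<inter> T = {}"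
  shows "graph_degree (E \<union> T) v = graph_degree E v + graph_degree T v"
proof -
  have "{e \<in> E \<union> T. v \<in> e} = {e \<in> E. v \<in> e} \<union> {e \<in> T. v \<in> e}" by auto
  then show ?thesis unfolding graph_degree_def using assms by (simp add: card_Un_disjoint disjoint_iff)
qed

lemma graph_degree_mono: "finite G \<Longrightarrow> T \<subseteq> G \<Longrightarrow> graph_degree T v \<le> graph_degree G v"
  unfolding graph_degree_def by (intro card_mono) auto

lemma finite_regular_graphs: "finite V \<Longrightarrow> finite (regular_graphs d V)"
  by (simp add: regular_graphs_def simple_graphs_eq_Pow)

lemma card_regular_supergraphs:
  assumes V: "finite V" and T: "T \<subseteq> [V]\<^bsup>2\<^esup>" and deg: "\<And>v. v \<in> V \<Longrightarrow> graph_degree T v + r v = d"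
  shows "card {G \<in> regular_graphs d V. T \<subseteq> G} = card (graphs_avoiding V T r)"
proof -
  have finite: "finite E" if "E \<subseteq> [V]\<^bsup>2\<^esup>" for E using that V finite_subset finite_nsets by blast
  have "bij_betw (\<lambda>G. G - T) {G \<in> regular_graphs d V. T \<subseteq> G} (graphs_avoiding V T r)"
  proof (rule bij_betw_byWitness[where f' = "\<lambda>E. E \<union> T"])
    show "(\<lambda>G. G - T) ` {G \<in> regular_graphs d V. T \<subseteq> G} \<subseteq> graphs_avoiding V T r"
    proof (clarify, unfold graphs_avoiding_def, intro CollectI conjI ballI)
      fix G assume G: "G \<in> regular_graphs d V" "T \<subseteq> G"
      then have sub: "G \<subseteq> [V]\<^bsup>2\<^esup>" by (simp add: regular_graphs_def simple_graphs_eq_Pow)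
      then show "G - T \<in> simple_graphs V" by (auto simp: simple_graphs_eq_Pow)
      fix v assume v: "v \<in> V"
      have "graph_degree (G - T \<union> T) v = graph_degree (G - T) v + graph_degree T v"
        using sub T by (intro graph_degree_Un finite) auto
      then show "graph_degree (G - T) v = r v"
        using deg[OF v] v G by (simp add: regular_graphs_def Un_absorb2)
    qed auto
    show "(\<lambda>E. E \<union> T) ` graphs_avoiding V T r \<subseteq> {G \<in> regular_graphs d V. T \<subseteq> G}"
      using T deg finite
      by (auto simp: regular_graphs_def graphs_avoiding_def simple_graphs_eq_Pow graph_degree_Un add.commute)
  qed (auto simp: graphs_avoiding_def)
  then show ?thesis by (rule bij_betw_same_card)
qed

definition bounded_degree_trees :: "nat \<Rightarrow> 'a set \<Rightarrow> 'a set set set" where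
  "bounded_degree_trees d V = {T. graph_tree V T \<and> (\<forall>v\<in>V. graph_degree T v \<le> d)}"

definition residual_degree :: "nat \<Rightarrow> 'a set \<Rightarrow> 'a set set \<Rightarrow> 'a \<Rightarrow> nat" where
  "residual_degree d V T v = (if v \<in> V then d - graph_degree T v else 0)"

lemma finite_bounded_degree_trees: "finite V \<Longrightarrow> finite (bounded_degree_trees d V)"
  by (rule finite_subset[OF _ finite_graph_trees]) (auto simp: bounded_degree_trees_def)

lemma sum_card_spanning_trees:
  assumes V: "finite V"
  shows "(\<Sum>G\<in>regular_graphs d V. card (spanning_trees V G)) =
    (\<Sum>T\<in>bounded_degree_trees d V. card (graphs_avoiding V T (residual_degree d V T)))"
proof -
  have "spanning_trees V G = {T \<in> bounded_degree_trees d V. T \<subseteq> G}" if "G \<in> regular_graphs d V" for G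
  proof -
    have "finite G" "\<forall>v\<in>V. graph_degree G v = d"
      using that V by (auto simp: regular_graphs_def simple_graphs_eq_Pow intro: finite_subset)
    then show ?thesis
      by (auto simp: spanning_trees_def bounded_degree_trees_def dest: graph_degree_mono)
  qed
  then have "(\<Sum>G\<in>regular_graphs d V. card (spanning_trees V G)) =
      (\<Sum>G\<in>regular_graphs d V. card {T \<in> bounded_degree_trees d V. T \<subseteq> G})"
    by (intro sum.cong) auto
  also have "\<dots> = (\<Sum>T\<in>bounded_degree_trees d V. card {G \<in> regular_graphs d V. T \<subseteq> G})"
    using finite_regular_graphs[OF V] finite_bounded_degree_trees[OF V] by (rule sum_multicount_gen) simp
  also have "\<dots> = (\<Sum>T\<in>bounded_degree_trees d V. card (graphs_avoiding V T (residual_degree d V T)))"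
    by (intro sum.cong card_regular_supergraphs V)
      (auto simp: bounded_degree_trees_def residual_degree_def dest: graph_tree_subset)
  finally show ?thesis .
qed

lemma residual_degree_in_degree_seqs:
  assumes V: "finite V" "card V \<ge> 2" and d: "d \<ge> 2" and T: "T \<in> bounded_degree_trees d V"
  shows "residual_degree d V T \<in> degree_seqs V (\<lambda>_. d - 1) ((d - 2) * card V + 2)"
proof -
  have tree: "graph_tree V T" and degree_le: "\<And>v. v \<in> V \<Longrightarrow> graph_degree T v \<le> d"
    using T by (auto simp: bounded_degree_trees_def)
  have "(\<Sum>v\<in>V. residual_degree d V T v + graph_degree T v) = (\<Sum>v\<in>V. d)"
    using degree_le by (intro sum.cong) (auto simp: residual_degree_def)
  then have "half_edges V (residual_degree d V T) + (\<Sum>v\<in>V. graph_degree T v) = d * card V"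
    by (simp add: half_edges_def sum.distrib mult.commute)
  also have "\<dots> = (d - 2) * card V + 2 * card V"
    using d by (metis add_mult_distrib le_add_diff_inverse2)
  finally have "half_edges V (residual_degree d V T) = (d - 2) * card V + 2"
    using graph_tree_degree_sum[OF V(1) tree] by linarith
  moreover have "residual_degree d V T v \<le> d - 1" if "v \<in> V" for v
    using graph_tree_degree_pos[OF V(1) tree V(2) that] that by (simp add: residual_degree_def)
  ultimately show ?thesis by (simp add: degree_seqs_def residual_degree_def)
qed

lemma bounded_degree_trees_fibre:
  assumes d: "d \<ge> 1" and r: "r \<in> degree_seqs V (\<lambda>_. d - 1) s"
  shows "{T \<in> bounded_degree_trees d V. residual_degree d V T = r} = trees_with V (\<lambda>v. d - 1 - r v) {}"
proof -
  have "graph_degree T v \<le> d \<and> d - graph_degree T v = r v \<longleftrightarrow> graph_degree T v = Suc (d - 1 - r v)"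
    if "v \<in> V" for T v
  proof -
    have "r v \<le> d - 1" using r that by (simp add: degree_seqs_def)
    then show ?thesis using d by linarith
  qed
  then have "(\<forall>v\<in>V. graph_degree T v \<le> d) \<and> (\<forall>v\<in>V. d - graph_degree T v = r v) \<longleftrightarrow>
      (\<forall>v\<in>V. graph_degree T v = Suc (d - 1 - r v))" for T
    by blast
  moreover have "residual_degree d V T = r \<longleftrightarrow> (\<forall>v\<in>V. d - graph_degree T v = r v)" for T
    using r by (auto simp: residual_degree_def degree_seqs_def fun_eq_iff)
  ultimately show ?thesis by (simp add: bounded_degree_trees_def trees_with_def conj_assoc)
qed

definition tree_weight :: "nat \<Rightarrow> 'a set \<Rightarrow> 'a set set \<Rightarrow> real" where
  "tree_weight d V T = 1 / (\<Prod>v\<in>V. fact (residual_degree d V T v))"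

lemma tree_weight_pos: "tree_weight d V T > 0"
  by (auto simp: tree_weight_def intro!: prod_pos)

lemma sum_tree_weight_fibre:
  assumes V: "finite V" "card V \<ge> 2" and d: "d \<ge> 2"
    and r: "r \<in> degree_seqs V (\<lambda>_. d - 1) ((d - 2) * card V + 2)"
  shows "sum (tree_weight d V) {T \<in> bounded_degree_trees d V. residual_degree d V T = r} =
    fact (card V - 2) / fact (d - 1) ^ card V * seq_weight V (\<lambda>_. d - 1) r"
proof -
  let ?e = "\<lambda>v. d - 1 - r v"
  have residual_le: "r v \<le> d - 1" if "v \<in> V" for v using r that by (simp add: degree_seqs_def)
  have "sum (tree_weight d V) {T \<in> bounded_degree_trees d V. residual_degree d V T = r} =
      (\<Sum>T\<in>{T \<in> bounded_degree_trees d V. residual_degree d V T = r}. 1 / (\<Prod>v\<in>V. fact (r v)))"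
    by (intro sum.cong) (auto simp: tree_weight_def)
  also have "\<dots> = real (card (trees_with V ?e {})) / (\<Prod>v\<in>V. fact (r v))"
    using d bounded_degree_trees_fibre[OF _ r] by simp
  also have "real (card (trees_with V ?e {})) = fact (card V - 2) / (\<Prod>v\<in>V. fact (?e v))"
  proof -
    have "(\<Sum>v\<in>V. ?e v) + 2 = card V"
      using residual_le r d by (intro sum_excess_degrees) (auto simp: degree_seqs_def)
    then show ?thesis
      using ordered_tree_count_eq[of V "{}" ?e] V by (simp add: ordered_tree_count_def field_simps)
  qed
  also have "\<dots> / (\<Prod>v\<in>V. fact (r v)) =
      fact (card V - 2) / fact (d - 1) ^ card V * (\<Prod>v\<in>V. fact (d - 1) / (fact (r v) * fact (?e v)))"
    by (simp add: prod_dividef prod.distrib)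
  also have "(\<Prod>v\<in>V. fact (d - 1) / (fact (r v) * fact (?e v))) = seq_weight V (\<lambda>_. d - 1) r"
    unfolding seq_weight_def using residual_le by (intro prod.cong refl) (simp add: binomial_fact)
  finally show ?thesis .
qed

lemma sum_tree_weight:
  assumes V: "finite V" "card V \<ge> 2" and d: "d \<ge> 2"
  shows "sum (tree_weight d V) (bounded_degree_trees d V) =
    fact (card V - 2) / fact (d - 1) ^ card V * real (((d - 1) * card V) choose ((d - 2) * card V + 2))"
proof -
  let ?S = "degree_seqs V (\<lambda>_. d - 1) ((d - 2) * card V + 2)"
  have "sum (tree_weight d V) (bounded_degree_trees d V) =
      (\<Sum>r\<in>?S. sum (tree_weight d V) {T \<in> bounded_degree_trees d V. residual_degree d V T = r})"
    using residual_degree_in_degree_seqs[OF V d]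
    by (intro sum.group[symmetric] finite_bounded_degree_trees finite_degree_seqs V(1)) auto
  also have "\<dots> = fact (card V - 2) / fact (d - 1) ^ card V * sum (seq_weight V (\<lambda>_. d - 1)) ?S"
    unfolding sum_distrib_left using sum_tree_weight_fibre[OF V d] by (rule sum.cong[OF refl])
  finally show ?thesis by (simp add: sum_seq_weight[OF V(1)] mult.commute)
qed

definition planted_mean :: "nat \<Rightarrow> 'a set \<Rightarrow> ('a set set \<Rightarrow> real) \<Rightarrow> real" where
  "planted_mean d V = weighted_mean (bounded_degree_trees d V) (tree_weight d V)"

lemma planted_half_edges_le:
  assumes "card V \<ge> 2" "d \<ge> 2"
  shows "(d - 2) * card V + 2 \<le> (d - 1) * card V"
proof -
  have "d - 1 = Suc (d - 2)" using assms(2) by simp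
  then show ?thesis using assms(1) by simp
qed

lemma sum_tree_weight_nonzero:
  assumes "finite V" "card V \<ge> 2" "d \<ge> 2"
  shows "sum (tree_weight d V) (bounded_degree_trees d V) \<noteq> 0"
  using planted_half_edges_le[of V d] assms by (simp add: sum_tree_weight)

lemma planted_mean_eq_seq_mean:
  assumes V: "finite V" "card V \<ge> 2" and d: "d \<ge> 2"
  shows "planted_mean d V (\<lambda>T. f (residual_degree d V T) T) =
    seq_mean V (\<lambda>_. d - 1) ((d - 2) * card V + 2) (\<lambda>r. tree_mean V (\<lambda>v. d - 1 - r v) (f r))"
proof -
  let ?S = "degree_seqs V (\<lambda>_. d - 1) ((d - 2) * card V + 2)"
  let ?fibre = "\<lambda>r. {T \<in> bounded_degree_trees d V. residual_degree d V T = r}"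
  let ?f = "\<lambda>T. f (residual_degree d V T) T"
  have "planted_mean d V ?f = weighted_mean ?S (seq_weight V (\<lambda>_. d - 1)) (\<lambda>r. weighted_mean (?fibre r) (tree_weight d V) ?f)"
    unfolding planted_mean_def
  proof (rule weighted_mean_fibres)
    show "sum (tree_weight d V) (?fibre r) = fact (card V - 2) / fact (d - 1) ^ card V * seq_weight V (\<lambda>_. d - 1) r"
      if "r \<in> ?S" for r using sum_tree_weight_fibre[OF V d that] .
  qed (use V residual_degree_in_degree_seqs[OF V d] tree_weight_pos[THEN less_imp_le] in
      \<open>auto intro: finite_bounded_degree_trees finite_degree_seqs\<close>)
  also have "\<dots> = seq_mean V (\<lambda>_. d - 1) ((d - 2) * card V + 2) (\<lambda>r. tree_mean V (\<lambda>v. d - 1 - r v) (f r))"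
    unfolding seq_mean_def
  proof (rule weighted_mean_cong)
    fix r assume r: "r \<in> ?S"
    have "weighted_mean (?fibre r) (tree_weight d V) ?f = weighted_mean (?fibre r) (\<lambda>_. 1) ?f"
      using V by (intro weighted_mean_constant_weight[where c = "1 / (\<Prod>v\<in>V. fact (r v))"])
        (auto simp: tree_weight_def)
    also have "\<dots> = weighted_mean (?fibre r) (\<lambda>_. 1) (f r)" by (intro weighted_mean_cong) auto
    finally show "weighted_mean (?fibre r) (tree_weight d V) ?f = tree_mean V (\<lambda>v. d - 1 - r v) (f r)"
      using d bounded_degree_trees_fibre[OF _ r] unfolding tree_mean_def by simp
  qed
  finally show ?thesis .
qed

section \<open>The defects of the complement of a random tree\<close>

definition planted_loop_mean :: "nat \<Rightarrow> real" where
  "planted_loop_mean d = (real d - 2)\<^sup>2 / (2 * (real d - 1))"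

definition planted_defect_mean :: "nat \<Rightarrow> real" where
  "planted_defect_mean d = planted_loop_mean d + (planted_loop_mean d)\<^sup>2 +
     (real d - 2) * (real d - 2 - 2 * planted_loop_mean d)"

lemma planted_loop_mean_bounds:
  assumes "d \<ge> 3"
  shows "0 \<le> planted_loop_mean d" "2 * planted_loop_mean d \<le> real d - 2"
proof -
  show "0 \<le> planted_loop_mean d" using assms by (simp add: planted_loop_mean_def)
  show "2 * planted_loop_mean d \<le> real d - 2"
    using assms by (simp add: planted_loop_mean_def field_simps power2_eq_square)
qed

lemma planted_mean_loop_mean_dist_le:
  assumes V: "finite V" "card V \<ge> 2" and d: "d \<ge> 3"
  shows "planted_mean d V (\<lambda>T. \<bar>loop_mean V (residual_degree d V T) - planted_loop_mean d\<bar>) \<le>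
    sqrt (2 * real d ^ 4 / real (card V))"
proof -
  let ?s = "(d - 2) * card V + 2"
  let ?f = "\<lambda>r. (loop_mean V r - planted_loop_mean d)\<^sup>2"
  have "planted_mean d V (\<lambda>T. ?f (residual_degree d V T)) =
      seq_mean V (\<lambda>_. d - 1) ?s (\<lambda>r. tree_mean V (\<lambda>v. d - 1 - r v) (\<lambda>_. ?f r))"
    using V d by (intro planted_mean_eq_seq_mean) auto
  also have "\<dots> = seq_mean V (\<lambda>_. d - 1) ?s ?f"
    unfolding seq_mean_def
  proof (rule weighted_mean_cong)
    fix r assume "r \<in> degree_seqs V (\<lambda>_. d - 1) ?s"
    then have "(\<Sum>v\<in>V. d - 1 - r v) + 2 = card V"
      using d by (intro sum_excess_degrees) (auto simp: degree_seqs_def)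
    then have "card (trees_with V (\<lambda>v. d - 1 - r v) {}) > 0" by (intro card_trees_pos V)
    then show "tree_mean V (\<lambda>v. d - 1 - r v) (\<lambda>_. ?f r) = ?f r"
      unfolding tree_mean_def by (intro weighted_mean_const) simp
  qed
  also have "\<dots> \<le> 2 * real (d - 1) ^ 4 / real (card V)"
  proof -
    have "planted_loop_mean d = (real (d - 1) - 1)\<^sup>2 / (2 * real (d - 1))" "d - 2 = d - 1 - 1"
      using d by (simp_all add: planted_loop_mean_def of_nat_diff)
    then show ?thesis using loop_mean_concentration[OF V, of "d - 1" ?s] d by simp
  qed
  also have "\<dots> \<le> 2 * real d ^ 4 / real (card V)"
    by (intro divide_right_mono mult_left_mono power_mono) auto
  finally have "planted_mean d V (\<lambda>T. ?f (residual_degree d V T)) \<le> 2 * real d ^ 4 / real (card V)" .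
  then show ?thesis
    using V d tree_weight_pos[THEN less_imp_le] sum_tree_weight_nonzero[of V d]
    unfolding planted_mean_def
    by (intro order_trans[OF weighted_mean_abs_le_sqrt] real_sqrt_le_mono) auto
qed

lemma planted_mean_edge_mean_dist_le:
  assumes V: "finite V" "card V \<ge> 4" and d: "d \<ge> 3"
  shows "planted_mean d V (\<lambda>T. \<bar>edge_mean V T (residual_degree d V T) -
      (real d - 2) * (real d - 2 - 2 * loop_mean V (residual_degree d V T))\<bar>) \<le>
    sqrt (6 * real d ^ 6 / real (card V))"
proof -
  let ?s = "(d - 2) * card V + 2"
  let ?f = "\<lambda>r T. (edge_mean V T r - (real d - 2) * (real d - 2 - 2 * loop_mean V r))\<^sup>2"
  have "planted_mean d V (\<lambda>T. ?f (residual_degree d V T) T) =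
      seq_mean V (\<lambda>_. d - 1) ?s (\<lambda>r. tree_mean V (\<lambda>v. d - 1 - r v) (?f r))"
    using V d by (intro planted_mean_eq_seq_mean) auto
  also have "\<dots> \<le> seq_mean V (\<lambda>_. d - 1) ?s (\<lambda>_. 6 * real d ^ 6 / real (card V))"
    unfolding seq_mean_def
    using edge_mean_concentration[OF V d]
    by (intro weighted_mean_mono) (auto simp: degree_seqs_def seq_weight_nonneg)
  also have "\<dots> = 6 * real d ^ 6 / real (card V)"
    unfolding seq_mean_def
    using V d by (intro weighted_mean_const seq_weight_total_nonzero planted_half_edges_le) auto
  finally have "planted_mean d V (\<lambda>T. ?f (residual_degree d V T) T) \<le> 6 * real d ^ 6 / real (card V)" .
  then show ?thesis
    using V d tree_weight_pos[THEN less_imp_le] sum_tree_weight_nonzero[of V d]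
    unfolding planted_mean_def
    by (intro order_trans[OF weighted_mean_abs_le_sqrt] real_sqrt_le_mono) auto
qed

lemma defect_mean_planted_dist_le:
  assumes d: "d \<ge> 3" and r: "\<forall>v\<in>V. r v \<le> d"
  shows "\<bar>defect_mean V T r - planted_defect_mean d\<bar> \<le> 5 * real d * \<bar>loop_mean V r - planted_loop_mean d\<bar> +
    \<bar>edge_mean V T r - (real d - 2) * (real d - 2 - 2 * loop_mean V r)\<bar>"
proof -
  let ?l = "loop_mean V r" and ?m = "planted_loop_mean d"
  have "defect_mean V T r - planted_defect_mean d =
      (?l - ?m) * (1 + ?l + ?m - 2 * (real d - 2)) + (edge_mean V T r - (real d - 2) * (real d - 2 - 2 * ?l))"
    by (simp add: defect_mean_def planted_defect_mean_def power2_eq_square algebra_simps)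
  moreover have "\<bar>1 + ?l + ?m - 2 * (real d - 2)\<bar> \<le> 5 * real d"
    using loop_mean_bounds[OF r] planted_loop_mean_bounds[OF d] d by simp
  then have "\<bar>(?l - ?m) * (1 + ?l + ?m - 2 * (real d - 2))\<bar> \<le> \<bar>?l - ?m\<bar> * (5 * real d)"
    unfolding abs_mult by (intro mult_left_mono) auto
  ultimately show ?thesis by (simp add: mult.commute)
qed

definition planted_error :: "nat \<Rightarrow> nat \<Rightarrow> real" where
  "planted_error d n = poisson_error d 1 / real n + 5 * real d * sqrt (2 * real d ^ 4 / real n) +
     sqrt (6 * real d ^ 6 / real n)"

lemma planted_defect_gf_dist_le:
  assumes V: "finite V" "card V \<ge> 2" and d: "d \<ge> 3" and even: "even (d * card V)"
    and T: "T \<in> bounded_degree_trees d V" and r: "r = residual_degree d V T"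
  shows "\<bar>defect_gf V T r 1 - exp (- planted_defect_mean d)\<bar> \<le>
    poisson_error d 1 / real (card V) + 5 * real d * \<bar>loop_mean V r - planted_loop_mean d\<bar> +
    \<bar>edge_mean V T r - (real d - 2) * (real d - 2 - 2 * loop_mean V r)\<bar>"
proof -
  have seq: "r \<in> degree_seqs V (\<lambda>_. d - 1) ((d - 2) * card V + 2)"
    unfolding r using V d T by (intro residual_degree_in_degree_seqs) auto
  have residual_le: "\<forall>v\<in>V. r v \<le> d" and N: "half_edges V r = (d - 2) * card V + 2"
    using seq by (auto simp: degree_seqs_def intro: order_trans[OF _ diff_le_self])
  have "even (half_edges V r)" using even d unfolding N by (auto simp: even_diff_nat)
  then have adm: "admissible d V T r"
    using V residual_le T by (auto simp: admissible_def bounded_degree_trees_def dest: graph_tree_subset)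
  have "poisson_error d 1 / real (half_edges V r) \<le> poisson_error d 1 / real (card V)"
    using V card_le_half_edges[OF d N] by (intro divide_left_mono) (auto simp: poisson_error_def)
  then have "\<bar>defect_gf V T r 1 - exp (- defect_mean V T r)\<bar> \<le> poisson_error d 1 / real (card V)"
    using defect_gf_poisson[OF adm, of 1] N by simp
  moreover have "\<bar>exp (- defect_mean V T r) - exp (- planted_defect_mean d)\<bar> \<le>
      \<bar>defect_mean V T r - planted_defect_mean d\<bar>"
  proof (rule exp_minus_dist_le)
    show "0 \<le> planted_defect_mean d"
      using planted_loop_mean_bounds[OF d] d by (simp add: planted_defect_mean_def)
  qed (rule defect_mean_bounds[OF adm])
  ultimately show ?thesis using defect_mean_planted_dist_le[OF d residual_le, of T] by linarith
qed

lemma planted_mean_defect_gf_dist_le: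
  assumes V: "finite V" "card V \<ge> 4" and d: "d \<ge> 3" and even: "even (d * card V)"
  shows "\<bar>planted_mean d V (\<lambda>T. defect_gf V T (residual_degree d V T) 1) - exp (- planted_defect_mean d)\<bar> \<le>
    planted_error d (card V)"
proof -
  let ?r = "residual_degree d V"
  let ?l = "\<lambda>T. \<bar>loop_mean V (?r T) - planted_loop_mean d\<bar>"
  let ?k = "\<lambda>T. \<bar>edge_mean V T (?r T) - (real d - 2) * (real d - 2 - 2 * loop_mean V (?r T))\<bar>"
  let ?\<epsilon> = "poisson_error d 1 / real (card V)"
  note nonneg = tree_weight_pos[THEN less_imp_le]
  have total: "sum (tree_weight d V) (bounded_degree_trees d V) \<noteq> 0"
    using V d by (intro sum_tree_weight_nonzero) auto
  have "\<bar>planted_mean d V (\<lambda>T. defect_gf V T (?r T) 1) - exp (- planted_defect_mean d)\<bar> =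
      \<bar>planted_mean d V (\<lambda>T. defect_gf V T (?r T) 1 - exp (- planted_defect_mean d))\<bar>"
    unfolding planted_mean_def weighted_mean_diff weighted_mean_const[OF total] ..
  also have "\<dots> \<le> planted_mean d V (\<lambda>T. \<bar>defect_gf V T (?r T) 1 - exp (- planted_defect_mean d)\<bar>)"
    unfolding planted_mean_def by (intro abs_weighted_mean_le nonneg)
  also have "\<dots> \<le> planted_mean d V (\<lambda>T. ?\<epsilon> + 5 * real d * ?l T + ?k T)"
    unfolding planted_mean_def
    using V d even by (intro weighted_mean_mono nonneg planted_defect_gf_dist_le) auto
  also have "\<dots> = ?\<epsilon> + 5 * real d * planted_mean d V ?l + planted_mean d V ?k"
    unfolding planted_mean_def weighted_mean_add weighted_mean_cmult weighted_mean_const[OF total] ..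
  also have "\<dots> \<le> planted_error d (card V)"
    unfolding planted_error_def
    using V d by (intro add_mono mult_left_mono planted_mean_loop_mean_dist_le planted_mean_edge_mean_dist_le) auto
  finally show ?thesis .
qed

definition planted_pairing_count :: "nat \<Rightarrow> nat \<Rightarrow> real" where
  "planted_pairing_count d n = matching_count ((d - 2) * n + 2) *
     (fact (n - 2) / fact (d - 1) ^ n * real (((d - 1) * n) choose ((d - 2) * n + 2)))"

lemma sum_card_spanning_trees_eq_planted_mean:
  assumes V: "finite V" "card V \<ge> 2" and d: "d \<ge> 2" and even: "even (d * card V)"
  shows "real (\<Sum>G\<in>regular_graphs d V. card (spanning_trees V G)) =
    planted_pairing_count d (card V) * planted_mean d V (\<lambda>T. defect_gf V T (residual_degree d V T) 1)"
proof -
  let ?r = "residual_degree d V" and ?s = "(d - 2) * card V + 2"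
  have "real (card (graphs_avoiding V T (?r T))) =
      matching_count ?s * (tree_weight d V T * defect_gf V T (?r T) 1)"
    if T: "T \<in> bounded_degree_trees d V" for T
  proof -
    have "half_edges V (?r T) = ?s"
      using residual_degree_in_degree_seqs[OF V d T] by (simp add: degree_seqs_def)
    moreover have "even ?s" using even d by (auto simp: even_diff_nat)
    ultimately show ?thesis using card_graphs_avoiding[OF V(1), of "?r T" T] by (simp add: tree_weight_def)
  qed
  then have "real (\<Sum>G\<in>regular_graphs d V. card (spanning_trees V G)) =
      matching_count ?s * (\<Sum>T\<in>bounded_degree_trees d V. tree_weight d V T * defect_gf V T (?r T) 1)"
    unfolding sum_card_spanning_trees[OF V(1)] of_nat_sum sum_distrib_left by (rule sum.cong[OF refl])
  also have "(\<Sum>T\<in>bounded_degree_trees d V. tree_weight d V T * defect_gf V T (?r T) 1) =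
      sum (tree_weight d V) (bounded_degree_trees d V) * planted_mean d V (\<lambda>T. defect_gf V T (?r T) 1)"
    using sum_tree_weight_nonzero[OF V d] by (simp add: planted_mean_def weighted_mean_def)
  finally show ?thesis by (simp add: planted_pairing_count_def sum_tree_weight[OF V d])
qed

section \<open>Asymptotics\<close>

definition feasible_sizes :: "nat \<Rightarrow> nat filter" where
  "feasible_sizes d = inf at_top (principal {n. odd d \<longrightarrow> even n})"

lemma feasible_sizes_le: "feasible_sizes d \<le> at_top"
  by (simp add: feasible_sizes_def)

lemma eventually_feasible_sizesI:
  "(\<And>n. n \<ge> N \<Longrightarrow> even (d * n) \<Longrightarrow> P n) \<Longrightarrow> eventually P (feasible_sizes d)"
  unfolding feasible_sizes_def eventually_inf_principal eventually_at_top_linorder by auto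

lemma tendsto_feasible_sizesI:
  fixes f :: "nat \<Rightarrow> real"
  assumes "\<And>n. n \<ge> N \<Longrightarrow> even (d * n) \<Longrightarrow> \<bar>f n - l\<bar> \<le> g n" and "g \<longlonglongrightarrow> 0"
  shows "(f \<longlongrightarrow> l) (feasible_sizes d)"
proof -
  have "(g \<longlongrightarrow> 0) (feasible_sizes d)" by (rule tendsto_mono[OF feasible_sizes_le assms(2)])
  moreover have "eventually (\<lambda>n. norm (f n - l) \<le> g n) (feasible_sizes d)"
    using assms(1) by (intro eventually_feasible_sizesI) auto
  ultimately have "((\<lambda>n. f n - l) \<longlongrightarrow> 0) (feasible_sizes d)" by (rule Lim_null_comparison[rotated])
  then show ?thesis by (rule LIM_zero_cancel)
qed

lemma planted_error_tendsto_0: "planted_error d \<longlonglongrightarrow> 0"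
proof -
  have "(\<lambda>n. poisson_error d 1 / real n + 5 * real d * sqrt (2 * real d ^ 4 / real n) + sqrt (6 * real d ^ 6 / real n))
      \<longlonglongrightarrow> 0 + 5 * real d * sqrt 0 + sqrt 0"
    by (intro tendsto_intros lim_const_over_n)
  then show ?thesis by (simp add: planted_error_def[abs_def])
qed

lemma sum_card_spanning_trees_asymp_equiv:
  assumes d: "d \<ge> 3"
  shows "(\<lambda>n. real (\<Sum>G\<in>regular_graphs d {1..n}. card (spanning_trees {1..n} G))) \<sim>[feasible_sizes d]
    (\<lambda>n. exp (- planted_defect_mean d) * planted_pairing_count d n)"
proof -
  let ?m = "\<lambda>n. planted_mean d {1..n} (\<lambda>T. defect_gf {1..n} T (residual_degree d {1..n} T) 1)"
  have "(?m \<longlongrightarrow> exp (- planted_defect_mean d)) (feasible_sizes d)"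
  proof (rule tendsto_feasible_sizesI[OF _ planted_error_tendsto_0])
    fix n assume "n \<ge> 4" "even (d * n)"
    then show "\<bar>?m n - exp (- planted_defect_mean d)\<bar> \<le> planted_error d n"
      using planted_mean_defect_gf_dist_le[of "{1..n}" d] d by simp
  qed
  then have "?m \<sim>[feasible_sizes d] (\<lambda>_. exp (- planted_defect_mean d))" by (simp add: tendsto_imp_asymp_equiv_const)
  then have limit: "(\<lambda>n. ?m n * planted_pairing_count d n) \<sim>[feasible_sizes d]
      (\<lambda>n. exp (- planted_defect_mean d) * planted_pairing_count d n)"
    by (intro asymp_equiv_mult asymp_equiv_refl)
  have "(\<lambda>n. real (\<Sum>G\<in>regular_graphs d {1..n}. card (spanning_trees {1..n} G))) \<sim>[feasible_sizes d]
      (\<lambda>n. ?m n * planted_pairing_count d n)"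
  proof (intro asymp_equiv_refl_ev eventually_feasible_sizesI)
    fix n assume "n \<ge> 2" "even (d * n)"
    then show "real (\<Sum>G\<in>regular_graphs d {1..n}. card (spanning_trees {1..n} G)) = ?m n * planted_pairing_count d n"
      using sum_card_spanning_trees_eq_planted_mean[of "{1..n}" d] d by (simp add: mult.commute)
  qed
  from asymp_equiv_trans[OF this limit] show ?thesis .
qed

definition regular_defect_mean :: "nat \<Rightarrow> real" where
  "regular_defect_mean d = (real d - 1) / 2 + ((real d - 1) / 2)\<^sup>2"

lemma defect_mean_regular:
  assumes "finite V" "V \<noteq> {}" "d \<ge> 1"
  shows "defect_mean V {} (\<lambda>_. d) = regular_defect_mean d"
proof -
  have "loop_mean V (\<lambda>_. d) = (real d - 1) / 2"
    using assms by (simp add: loop_mean_def loop_choices_def half_edges_def real_choose_two card_gt_0_iff)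
  then show ?thesis
    unfolding defect_mean_def regular_defect_mean_def by (simp only: edge_mean_def edge_choices_def sum.empty div_0 add_0_right)
qed

definition pairing_count :: "nat \<Rightarrow> nat \<Rightarrow> real" where
  "pairing_count d n = matching_count (d * n) / fact d ^ n"

lemma card_regular_graphs:
  assumes "finite V" "even (d * card V)"
  shows "real (card (regular_graphs d V)) = pairing_count d (card V) * defect_gf V {} (\<lambda>_. d) 1"
proof -
  have "regular_graphs d V = graphs_avoiding V {} (\<lambda>_. d)"
    by (auto simp: regular_graphs_def graphs_avoiding_def)
  then show ?thesis
    using card_graphs_avoiding[of V "\<lambda>_. d" "{}"] assms
    by (simp add: pairing_count_def half_edges_def mult.commute)
qed

lemma card_regular_graphs_asymp_equiv:
  assumes d: "d \<ge> 1"
  shows "(\<lambda>n. real (card (regular_graphs d {1..n}))) \<sim>[feasible_sizes d]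
    (\<lambda>n. exp (- regular_defect_mean d) * pairing_count d n)"
proof -
  let ?p = "\<lambda>n. defect_gf {1..n} {} (\<lambda>_. d) 1"
  have "(\<lambda>n. poisson_error d 1 / real (n * d)) \<longlonglongrightarrow> 0" using d by real_asymp
  then have "(?p \<longlongrightarrow> exp (- regular_defect_mean d)) (feasible_sizes d)"
  proof (rule tendsto_feasible_sizesI[rotated])
    fix n assume n: "n \<ge> 1" "even (d * n)"
    then have "admissible d {1..n} {} (\<lambda>_. d)"
      by (simp add: admissible_def half_edges_def graph_degree_def mult.commute)
    from defect_gf_poisson[OF this, of 1]
    show "\<bar>?p n - exp (- regular_defect_mean d)\<bar> \<le> poisson_error d 1 / real (n * d)"
      using n d by (simp add: defect_mean_regular half_edges_def)
  qed
  then have "?p \<sim>[feasible_sizes d] (\<lambda>_. exp (- regular_defect_mean d))" by (simp add: tendsto_imp_asymp_equiv_const)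
  then have limit: "(\<lambda>n. ?p n * pairing_count d n) \<sim>[feasible_sizes d]
      (\<lambda>n. exp (- regular_defect_mean d) * pairing_count d n)"
    by (intro asymp_equiv_mult asymp_equiv_refl)
  have "(\<lambda>n. real (card (regular_graphs d {1..n}))) \<sim>[feasible_sizes d] (\<lambda>n. ?p n * pairing_count d n)"
  proof (intro asymp_equiv_refl_ev eventually_feasible_sizesI)
    fix n assume "n \<ge> 0" "even (d * n)"
    then show "real (card (regular_graphs d {1..n})) = ?p n * pairing_count d n"
      using card_regular_graphs[of "{1..n}" d] by (simp add: mult.commute)
  qed
  from asymp_equiv_trans[OF this limit] show ?thesis .
qed

lemma expected_spanning_trees_eq:
  assumes "regular_graphs d {1..n} \<noteq> {}"
  shows "expected_spanning_trees d n =
    real (\<Sum>G\<in>regular_graphs d {1..n}. card (spanning_trees {1..n} G)) / real (card (regular_graphs d {1..n}))"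
  unfolding expected_spanning_trees_def random_regular_graph_def of_nat_sum
  using assms by (intro integral_pmf_of_set finite_regular_graphs) auto

lemma eventually_regular_graphs_nonempty:
  assumes "d \<ge> 1"
  shows "eventually (\<lambda>n. regular_graphs d {1..n} \<noteq> {}) (feasible_sizes d)"
  using asymp_equiv_eventually_zeros[OF card_regular_graphs_asymp_equiv[OF assms]]
proof eventually_elim
  case (elim n)
  then show ?case using matching_count_pos[of "d * n"] by (auto simp: pairing_count_def)
qed

lemma expected_spanning_trees_asymp_equiv:
  assumes d: "d \<ge> 3"
  shows "expected_spanning_trees d \<sim>[feasible_sizes d]
    (\<lambda>n. exp (regular_defect_mean d - planted_defect_mean d) * (planted_pairing_count d n / pairing_count d n))"
proof -
  have "expected_spanning_trees d \<sim>[feasible_sizes d]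
      (\<lambda>n. real (\<Sum>G\<in>regular_graphs d {1..n}. card (spanning_trees {1..n} G)) / real (card (regular_graphs d {1..n})))"
    using d by (intro asymp_equiv_refl_ev eventually_mono[OF eventually_regular_graphs_nonempty expected_spanning_trees_eq]) auto
  also have "\<dots> \<sim>[feasible_sizes d] (\<lambda>n. (exp (- planted_defect_mean d) * planted_pairing_count d n) /
        (exp (- regular_defect_mean d) * pairing_count d n))"
    using d by (intro asymp_equiv_divide sum_card_spanning_trees_asymp_equiv card_regular_graphs_asymp_equiv) auto
  also have "(\<lambda>n. (exp (- planted_defect_mean d) * planted_pairing_count d n) /
        (exp (- regular_defect_mean d) * pairing_count d n)) =
      (\<lambda>n. exp (regular_defect_mean d - planted_defect_mean d) * (planted_pairing_count d n / pairing_count d n))"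
    by (simp add: times_divide_times_eq[symmetric] exp_diff[symmetric] del: times_divide_eq_right times_divide_eq_left)
  finally show ?thesis .
qed

lemma defect_mean_difference:
  assumes "d \<ge> 3"
  shows "regular_defect_mean d - planted_defect_mean d =
    (6 * real d ^ 2 - 14 * real d + 7) / (4 * (real d - 1) ^ 2)"
proof -
  define y where "y = real d - 1"
  have y: "y > 0" "real d = y + 1" using assms by (auto simp: y_def)
  show ?thesis
    unfolding regular_defect_mean_def planted_defect_mean_def planted_loop_mean_def y(2)
    using y(1) by (simp add: field_simps power2_eq_square)
qed

lemma planted_pairing_count_quotient:
  assumes d: "d \<ge> 3" and n: "n \<ge> 2" and p: "2 * p = d * n" and h: "h + n = p"
  shows "planted_pairing_count d n / pairing_count d n =
    real d ^ n * 2 ^ n / 2 * (fact ((d - 1) * n) * fact p / (fact (h + 1) * fact (2 * p)))"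
proof -
  let ?s = "(d - 2) * n + 2" and ?D = "(d - 1) * n"
  have s: "?s = 2 * (h + 1)" using p h d by (simp add: diff_mult_distrib)
  have "d - 1 = Suc (d - 2)" using d by simp
  then have D: "?D = ?s + (n - 2)" using n by simp
  have "real (?D choose ?s) = fact ?D / (fact ?s * fact (n - 2))"
    using binomial_fact[of ?s ?D, where ?'a = real] unfolding D by simp
  moreover have "matching_count ?s = fact ?s / (2 ^ (h + 1) * fact (h + 1))"
    unfolding s matching_count_def by (simp del: fact_Suc)
  ultimately have planted: "planted_pairing_count d n = fact ?D / (2 ^ (h + 1) * fact (h + 1) * fact (d - 1) ^ n)"
    unfolding planted_pairing_count_def by (simp del: fact_Suc add_2_eq_Suc add_2_eq_Suc')
  have "(fact d :: real) = real d * fact (d - 1)" using d by (simp add: fact_reduce)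
  then have regular: "pairing_count d n = fact (2 * p) / (2 ^ p * fact p * (real d ^ n * fact (d - 1) ^ n))"
    unfolding pairing_count_def p[symmetric] by (simp add: matching_count_def power_mult_distrib)
  have pow: "(2 :: real) ^ p = 2 ^ (h + 1) * 2 ^ n / 2" unfolding h[symmetric] by (simp add: power_add)
  show ?thesis unfolding planted regular pow by (simp del: fact_Suc) (simp only: ac_simps)
qed

lemma stirling_quotient_nat:
  assumes d: "d \<ge> 3" and n: "n > 0"
  shows "real d ^ n * 2 ^ n / 2 * (stirling ((real d - 1) * real n) * stirling (real d * real n / 2) /
      ((real d - 2) * real n / 2 * stirling ((real d - 2) * real n / 2) * stirling (real d * real n))) =
    (real d - 1) powr (1/2) / (real n * (real d - 2) powr (3/2)) *
      ((real d - 1) ^ (d - 1) / (real d ^ 2 - 2 * real d) powr (real d / 2 - 1)) ^ n"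
proof -
  have "(real d)\<^sup>2 - 2 * real d = real d * (real d - 2)" by (simp add: power2_eq_square algebra_simps)
  then have "(real d - 1) ^ (d - 1) / (real d ^ 2 - 2 * real d) powr (real d / 2 - 1) > 0" using d by simp
  moreover have "(real d - 1) powr (real d - 1) = (real d - 1) ^ (d - 1)"
    using d powr_realpow[of "real d - 1" "d - 1"] by (simp add: of_nat_diff)
  ultimately show ?thesis
    using stirling_quotient[of "real d" "real n"] d n by (simp add: powr_realpow)
qed

lemma fact_quotient_asymp_equiv:
  assumes "filterlim a at_top F" "filterlim b at_top F" "filterlim h at_top F" "filterlim k at_top F"
  shows "(\<lambda>n. fact (a n) * fact (b n) / (fact (h n + 1) * fact (k n)) :: real) \<sim>[F]
    (\<lambda>n. stirling (real (a n)) * stirling (real (b n)) / (real (h n) * stirling (real (h n)) * stirling (real (k n))))"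
proof -
  obtain c :: real where c: "c > 0" "(\<lambda>n. fact n) \<sim>[at_top] (\<lambda>n. c * stirling (real n))"
    by (rule fact_asymp_equiv_stirling)
  note fact = asymp_equiv_compose'[OF c(2)]
  have "(\<lambda>m. real m + 1) \<sim>[at_top] (\<lambda>m. real m)" by real_asymp
  then have "(\<lambda>n. real (h n) + 1) \<sim>[F] (\<lambda>n. real (h n))" using assms(3) by (rule asymp_equiv_compose')
  then have "(\<lambda>n. fact (a n) * fact (b n) / ((real (h n) + 1) * fact (h n) * fact (k n)) :: real) \<sim>[F]
    (\<lambda>n. c * stirling (real (a n)) * (c * stirling (real (b n))) /
      (real (h n) * (c * stirling (real (h n))) * (c * stirling (real (k n)))))"
    by (intro asymp_equiv_mult asymp_equiv_divide fact assms)
  moreover have "c * x * (c * y) / (u * (c * z) * (c * w)) = x * y / (u * z * w)" for x y u z w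
    using c(1) by simp
  ultimately show ?thesis by (simp add: add.commute)
qed

lemma filterlim_half_multiple_minus:
  fixes d :: nat
  assumes "d \<ge> 3"
  shows "filterlim (\<lambda>n. d * n div 2 - n) at_top at_top"
proof (rule filterlim_at_top_mono[OF filterlim_at_top_div_const_nat[of 2]])
  have "n div 2 \<le> d * n div 2 - n" for n
  proof -
    have "n div 2 + n = 3 * n div 2" by linarith
    also have "\<dots> \<le> d * n div 2" using assms by (intro div_le_mono mult_le_mono1)
    finally show ?thesis by simp
  qed
  then show "eventually (\<lambda>n. n div 2 \<le> d * n div 2 - n) at_top" by simp
qed simp

lemma planted_pairing_count_quotient_asymp_equiv:
  assumes d: "d \<ge> 3"
  shows "(\<lambda>n. planted_pairing_count d n / pairing_count d n) \<sim>[feasible_sizes d]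
    (\<lambda>n. (real d - 1) powr (1/2) / (real n * (real d - 2) powr (3/2)) *
       ((real d - 1) ^ (d - 1) / (real d ^ 2 - 2 * real d) powr (real d / 2 - 1)) ^ n)" (is "_ \<sim>[_] ?target")
proof -
  define p h where "p n = d * n div 2" and "h n = d * n div 2 - n" for n
  have half: "2 * p n = d * n" "h n + n = p n" "real (p n) = real d * real n / 2" "real (h n) = (real d - 2) * real n / 2"
    if "even (d * n)" for n
  proof -
    show p: "2 * p n = d * n" using that by (simp add: p_def)
    then show h: "h n + n = p n" using mult_le_mono1[OF d, of n] unfolding h_def p_def by linarith
    show "real (p n) = real d * real n / 2" using arg_cong[OF p, of real] by simp
    then show "real (h n) = (real d - 2) * real n / 2" using arg_cong[OF h, of real] by (simp add: algebra_simps)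
  qed
  let ?fact = "\<lambda>n. fact ((d - 1) * n) * fact (p n) / (fact (h n + 1) * fact (2 * p n)) :: real"
  let ?stirling = "\<lambda>n. stirling (real ((d - 1) * n)) * stirling (real (p n)) /
    (real (h n) * stirling (real (h n)) * stirling (real (2 * p n)))"
  have h: "filterlim h at_top (feasible_sizes d)"
    unfolding h_def by (rule filterlim_mono[OF filterlim_half_multiple_minus[OF d] order_refl feasible_sizes_le])
  have size_le: "h n \<le> (d - 1) * n" "h n \<le> p n" "h n \<le> 2 * p n" for n
    using d by (auto simp: h_def p_def diff_mult_distrib intro: order_trans[OF diff_le_self])
  have "(\<lambda>n. planted_pairing_count d n / pairing_count d n) \<sim>[feasible_sizes d] (\<lambda>n. real d ^ n * 2 ^ n / 2 * ?fact n)"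
  proof (intro asymp_equiv_refl_ev eventually_feasible_sizesI)
    fix n assume n: "n \<ge> 2" "even (d * n)"
    show "planted_pairing_count d n / pairing_count d n = real d ^ n * 2 ^ n / 2 * ?fact n"
      by (rule planted_pairing_count_quotient[OF d n(1) half(1,2)[OF n(2)]])
  qed
  also have "\<dots> \<sim>[feasible_sizes d] (\<lambda>n. real d ^ n * 2 ^ n / 2 * ?stirling n)"
    by (intro asymp_equiv_mult asymp_equiv_refl fact_quotient_asymp_equiv filterlim_at_top_mono[OF h] always_eventually allI size_le h)
  also have "\<dots> \<sim>[feasible_sizes d] ?target"
  proof (intro asymp_equiv_refl_ev eventually_feasible_sizesI)
    fix n assume n: "n \<ge> 1" "even (d * n)"
    have "real ((d - 1) * n) = (real d - 1) * real n" "real (2 * p n) = real d * real n"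
      using d half(1)[OF n(2)] by (simp_all add: of_nat_diff)
    then show "real d ^ n * 2 ^ n / 2 * ?stirling n = ?target n"
      using stirling_quotient_nat[OF d, of n] n(1) half(3,4)[OF n(2)] by (simp only:)
  qed
  finally show ?thesis .
qed

theorem theorem1p1:
  fixes d :: nat
  assumes "d \<ge> 3"
  shows "(\<lambda>n. expected_spanning_trees d n)
    \<sim>[inf at_top (principal {n. odd d \<longrightarrow> even n})]
    (\<lambda>n. exp ((6 * real d ^ 2 - 14 * real d + 7) / (4 * (real d - 1) ^ 2))
       * ((real d - 1) powr (1/2) / (real n * (real d - 2) powr (3/2)))
       * ((real d - 1) ^ (d - 1) / (real d ^ 2 - 2 * real d) powr (real d / 2 - 1)) ^ n)"
proof -
  have "expected_spanning_trees d \<sim>[feasible_sizes d]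
      (\<lambda>n. exp (regular_defect_mean d - planted_defect_mean d) * (planted_pairing_count d n / pairing_count d n))"
    by (rule expected_spanning_trees_asymp_equiv[OF assms])
  also have "\<dots> \<sim>[feasible_sizes d] (\<lambda>n. exp (regular_defect_mean d - planted_defect_mean d) *
      ((real d - 1) powr (1/2) / (real n * (real d - 2) powr (3/2))
       * ((real d - 1) ^ (d - 1) / (real d ^ 2 - 2 * real d) powr (real d / 2 - 1)) ^ n))"
    by (intro asymp_equiv_mult asymp_equiv_refl planted_pairing_count_quotient_asymp_equiv assms)
  finally show ?thesis
    unfolding defect_mean_difference[OF assms] feasible_sizes_def by (simp only: mult.assoc)
qed

end
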